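(* Let $(\mathcal{C},\mathcal{D})$ be a regular $C^*$-inclusion and suppose $\mathcal{M}_1,\mathcal{M}_2\subseteq\mathcal{C}$ are norm-closed $\mathcal{D}$-bimodules with $\mathcal{M}_1\subseteq\mathcal{M}_2$. There is a unique isometric (i.e., norm-preserving) map $\iota:\mathcal{E}(\mathcal{M}_1)\to\mathcal{E}(\mathcal{M}_2)$ so that, for every $\phi\in\mathcal{E}(\mathcal{M}_1)$, $\iota(\phi)|_{\mathcal{M}_1}=\phi$. The image $\iota(\mathcal{E}(\mathcal{M}_1))$ is an open subset of $\mathcal{E}(\mathcal{M}_2)$. If in addition $\mathcal{M}_2$ is regular, then $\iota$ is $\sigma(\mathcal{M}_1^{\#},\mathcal{M}_1)$--$\sigma(\mathcal{M}_2^{\#},\mathcal{M}_2)$ continuous on bounded subsets of $\mathcal{E}(\mathcal{M}_1)$.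
   Context: Let $\mathcal{C}$ be a unital $C^*$-algebra and $\mathcal{D}\subseteq\mathcal{C}$ an abelian $C^*$-subalgebra containing the unit. For a subspace $\mathcal{M}\subseteq\mathcal{C}$, $\mathcal{N}(\mathcal{M})=\{v\in\mathcal{M}:v\mathcal{D}v^*\cup v^*\mathcal{D}v\subseteq\mathcal{D}\}$; $\mathcal{M}$ is regular if the closed linear span of $\mathcal{N}(\mathcal{M})$ equals $\mathcal{M}$. $\mathcal{D}$ has the extension property in $\mathcal{C}$ if every pure state of $\mathcal{D}$ has a unique extension to a state of $\mathcal{C}$ and no pure state of $\mathcal{C}$ annihilates $\mathcal{D}$. $(\mathcal{C},\mathcal{D})$ is a regular $C^*$-inclusion if $\mathcal{D}$ is a maximal abelian $C^*$-subalgebra of the unital $C^*$-algebra $\mathcal{C}$, $\mathcal{D}$ has the extension property in $\mathcal{C}$, and $\mathcal{C}$ is regular. A $\mathcal{D}$-bimodule $\mathcal{M}\subseteq\mathcal{C}$ is a subspace with $d\,m\,e\in\mathcal{M}$ for $d,e\in\mathcal{D}$, $m\in\mathcal{M}$. $\mathcal{M}^{\#}$ is the Banach space dual of $\mathcal{M}$. $\mathcal{E}(\mathcal{M})$ is the set of $\mathcal{D}$-eigenfunctionals on $\mathcal{M}$: nonzero $\phi\in\mathcal{M}^{\#}$ such that for every $d\in\mathcal{D}$ the functionals $m\mapsto\phi(dm)$ and $m\mapsto\phi(md)$ are scalar multiples of $\phi$. It carries the relative weak-$*$ topology $\sigma(\mathcal{M}^{\#},\mathcal{M})$. *)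

theory Defs
  imports "HOL-Analysis.Analysis"
begin

text \<open>
  The library has real scalars only, so the complex scalar action is a parameter of the class.
  The real one is its restriction, which also gives \<open>1 *\<^sub>C x = x\<close>. As usual for unital
  $C^*$-algebras, the unit has norm one; the zero algebra is not an instance.
\<close>

class cstar_algebra = real_normed_algebra_1 + complete_space +
  fixes scaleC :: "complex \<Rightarrow> 'a \<Rightarrow> 'a" (infixr "*\<^sub>C" 75)
    and star :: "'a \<Rightarrow> 'a"
  assumes scaleC_add_right: "c *\<^sub>C (x + y) = c *\<^sub>C x + c *\<^sub>C y"
    and scaleC_add_left: "(b + c) *\<^sub>C x = b *\<^sub>C x + c *\<^sub>C x"
    and scaleC_scaleC: "b *\<^sub>C c *\<^sub>C x = (b * c) *\<^sub>C x"
    and scaleC_of_real: "complex_of_real r *\<^sub>C x = r *\<^sub>R x"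
    and mult_scaleC_left: "(c *\<^sub>C x) * y = c *\<^sub>C (x * y)"
    and mult_scaleC_right: "x * (c *\<^sub>C y) = c *\<^sub>C (x * y)"
    and norm_scaleC: "norm (c *\<^sub>C x) = cmod c * norm x"
    and star_star: "star (star x) = x"
    and star_add: "star (x + y) = star x + star y"
    and star_scaleC: "star (c *\<^sub>C x) = cnj c *\<^sub>C star x"
    and star_mult: "star (x * y) = star y * star x"
    and cstar_identity: "norm (star x * x) = (norm x)\<^sup>2"

instantiation complex :: cstar_algebra
begin

definition scaleC_complex :: "complex \<Rightarrow> complex \<Rightarrow> complex"
  where "scaleC_complex c x = c * x"

definition star_complex :: "complex \<Rightarrow> complex"
  where "star_complex x = cnj x"

instance
  by standard
    (auto simp: scaleC_complex_def star_complex_def algebra_simps norm_mult scaleR_conv_of_real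
      power2_eq_square)

end

lemma vector_space_scaleC: "vector_space (scaleC :: complex \<Rightarrow> 'a \<Rightarrow> 'a::cstar_algebra)"
proof
  show "1 *\<^sub>C x = x" for x :: 'a
    using scaleC_of_real[of 1 x] by simp
qed (simp_all add: scaleC_add_right scaleC_add_left scaleC_scaleC)

global_interpretation complex_vector: vector_space "scaleC :: complex \<Rightarrow> 'a \<Rightarrow> 'a::cstar_algebra"
  defines csubspace = complex_vector.subspace
    and cspan = complex_vector.span
  by (rule vector_space_scaleC)


subsection \<open>Functionals on a subspace\<close>

text \<open>
  A functional on \<open>M\<close> is a function that is \<open>undefined\<close> outside \<open>M\<close> (library constant
  \<open>extensional\<close>), so that equality of functionals is equality on \<open>M\<close> and \<open>restrict\<close> is the
  restriction to a smaller subspace.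
\<close>

definition dual_space :: "'a::cstar_algebra set \<Rightarrow> ('a \<Rightarrow> complex) set"
  where "dual_space M = {\<phi> \<in> extensional M.
    (\<forall>x\<in>M. \<forall>y\<in>M. \<phi> (x + y) = \<phi> x + \<phi> y) \<and>
    (\<forall>c. \<forall>x\<in>M. \<phi> (c *\<^sub>C x) = c * \<phi> x) \<and>
    (\<exists>K. \<forall>x\<in>M. cmod (\<phi> x) \<le> K * norm x)}"

definition dual_norm :: "'a::cstar_algebra set \<Rightarrow> ('a \<Rightarrow> complex) \<Rightarrow> real"
  where "dual_norm M \<phi> = (SUP x\<in>{x \<in> M. norm x \<le> 1}. cmod (\<phi> x))"

text \<open>
  The weak-$*$ topology is that of pointwise convergence on \<open>M\<close>: the product topology on
  \<open>extensional M\<close>, that is on all functions from \<open>M\<close> to the complex numbers, induced on the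
  dual space.
\<close>

definition weak_star :: "'a::cstar_algebra set \<Rightarrow> ('a \<Rightarrow> complex) topology"
  where "weak_star M = subtopology (product_topology (\<lambda>_. euclidean) M) (dual_space M)"


subsection \<open>Subalgebras and states\<close>

definition cstar_subalgebra :: "'a::cstar_algebra set \<Rightarrow> bool"
  where "cstar_subalgebra A \<longleftrightarrow> csubspace A \<and> closed A \<and>
    (\<forall>x\<in>A. \<forall>y\<in>A. x * y \<in> A) \<and> (\<forall>x\<in>A. star x \<in> A)"

definition abelian_cstar_subalgebra :: "'a::cstar_algebra set \<Rightarrow> bool"
  where "abelian_cstar_subalgebra A \<longleftrightarrow>
    cstar_subalgebra A \<and> (\<forall>x\<in>A. \<forall>y\<in>A. x * y = y * x)"

definition maximal_abelian_cstar_subalgebra :: "'a::cstar_algebra set \<Rightarrow> bool"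
  where "maximal_abelian_cstar_subalgebra D \<longleftrightarrow> abelian_cstar_subalgebra D \<and>
    (\<forall>A. abelian_cstar_subalgebra A \<and> D \<subseteq> A \<longrightarrow> A = D)"

definition states :: "'a::cstar_algebra set \<Rightarrow> ('a \<Rightarrow> complex) set"
  where "states A = {f \<in> dual_space A.
    (\<forall>a\<in>A. f (star a * a) \<in> \<real>\<^sub>\<ge>\<^sub>0) \<and> dual_norm A f = 1}"

text \<open>
  Pure states are the extreme points of the state space. The library's \<open>extreme_point_of\<close> needs
  a type that is a real vector space, which the extensional functions are not.
\<close>

definition pure_states :: "'a::cstar_algebra set \<Rightarrow> ('a \<Rightarrow> complex) set"
  where "pure_states A = {f \<in> states A. \<forall>g\<in>states A. \<forall>h\<in>states A. \<forall>t::real.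
    0 < t \<and> t < 1 \<and> (\<forall>a\<in>A. f a = of_real t * g a + of_real (1 - t) * h a)
      \<longrightarrow> g = f \<and> h = f}"

text \<open>The ambient algebra \<open>\<C>\<close> is the whole type, hence \<open>UNIV\<close> below.\<close>

definition extension_property :: "'a::cstar_algebra set \<Rightarrow> bool"
  where "extension_property D \<longleftrightarrow>
    (\<forall>f\<in>pure_states D. \<exists>!g. g \<in> states UNIV \<and> restrict g D = f) \<and>
    (\<forall>g\<in>pure_states UNIV. \<exists>d\<in>D. g d \<noteq> 0)"


subsection \<open>Regular inclusions, bimodules and eigenfunctionals\<close>

definition normalizers :: "'a::cstar_algebra set \<Rightarrow> 'a set \<Rightarrow> 'a set"
  where "normalizers D M =
    {v \<in> M. \<forall>d\<in>D. v * d * star v \<in> D \<and> star v * d * v \<in> D}"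

definition regular_subspace :: "'a::cstar_algebra set \<Rightarrow> 'a set \<Rightarrow> bool"
  where "regular_subspace D M \<longleftrightarrow> closure (cspan (normalizers D M)) = M"

definition regular_cstar_inclusion :: "'a::cstar_algebra set \<Rightarrow> bool"
  where "regular_cstar_inclusion D \<longleftrightarrow>
    maximal_abelian_cstar_subalgebra D \<and> 1 \<in> D \<and>
    extension_property D \<and> regular_subspace D UNIV"

definition bimodule :: "'a::cstar_algebra set \<Rightarrow> 'a set \<Rightarrow> bool"
  where "bimodule D M \<longleftrightarrow>
    csubspace M \<and> (\<forall>d\<in>D. \<forall>e\<in>D. \<forall>m\<in>M. d * m * e \<in> M)"

definition eigenfunctionals :: "'a::cstar_algebra set \<Rightarrow> 'a set \<Rightarrow> ('a \<Rightarrow> complex) set"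
  where "eigenfunctionals D M = {\<phi> \<in> dual_space M. (\<exists>m\<in>M. \<phi> m \<noteq> 0) \<and>
    (\<forall>d\<in>D. (\<exists>c. \<forall>m\<in>M. \<phi> (d * m) = c * \<phi> m) \<and>
           (\<exists>c. \<forall>m\<in>M. \<phi> (m * d) = c * \<phi> m))}"

definition eigenfunctional_topology ::
    "'a::cstar_algebra set \<Rightarrow> 'a set \<Rightarrow> ('a \<Rightarrow> complex) topology"
  where "eigenfunctional_topology D M = subtopology (weak_star M) (eigenfunctionals D M)"

text \<open>
  The map is \<open>undefined\<close> off its domain (library constant \<open>PiE\<close>), so that uniqueness of the map
  is plain equality.
\<close>

definition isometric_extension_map ::
    "'a::cstar_algebra set \<Rightarrow> 'a set \<Rightarrow> 'a set \<Rightarrow> (('a \<Rightarrow> complex) \<Rightarrow> ('a \<Rightarrow> complex)) \<Rightarrow> bool"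
  where "isometric_extension_map D M1 M2 \<iota> \<longleftrightarrow>
    \<iota> \<in> eigenfunctionals D M1 \<rightarrow>\<^sub>E eigenfunctionals D M2 \<and>
    (\<forall>\<phi>\<in>eigenfunctionals D M1.
      dual_norm M2 (\<iota> \<phi>) = dual_norm M1 \<phi> \<and> restrict (\<iota> \<phi>) M1 = \<phi>)"

end

theory Submission
  imports Defs
begin

text \<open>
An eigenfunctional \<open>\<phi>\<close> on a bimodule \<open>M\<close> determines two characters of \<open>D\<close>: its range \<open>\<rho>\<close> and its
source \<open>\<sigma>\<close>, with \<open>\<phi> (d * m) = \<rho> d * \<phi> m\<close> and \<open>\<phi> (m * d) = \<sigma> d * \<phi> m\<close>. By the extension property
\<open>\<sigma>\<close> has a unique extension to a state \<open>s\<close> of the whole algebra. Regularity of the algebra yields a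
normalizer \<open>v\<close> that carries \<open>\<sigma>\<close> to \<open>\<rho>\<close> (\<open>intertwiner_exists\<close>), and then \<open>\<phi> m = c * s (star v * m)\<close>
for a constant \<open>c\<close> (\<open>eigen_pair_form\<close>). The right-hand side is meaningful on the whole algebra, so it
extends \<open>\<phi>\<close> to every larger bimodule, and the norm of \<open>\<phi>\<close> is \<open>\<bar>c\<bar>\<close> times the square root of
\<open>\<sigma> (star v * v)\<close>, which does not refer to \<open>M\<close> (\<open>dual_norm_eigen_pair\<close>): the extension is isometric.
It is unique because \<open>\<rho>\<close>, \<open>\<sigma>\<close> and \<open>c\<close> can all be read off from \<open>\<phi>\<close>. Hence the image of the extension
map is the set of those eigenfunctionals on \<open>M2\<close> that do not vanish on \<open>M1\<close>, a union of the weak-*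
open sets \<open>{\<psi>. \<psi> m \<noteq> 0}\<close>.

The formula rests on a compression property (\<open>compression\<close>): for every \<open>x\<close> there are self-adjoint
contractions \<open>d\<close> in \<open>D\<close> with \<open>\<sigma> d = 1\<close> and \<open>d * x * d\<close> close to \<open>s x\<close> times \<open>d * d\<close>. Applied to
\<open>star v * m\<close> it shows that \<open>v * d * star v * m * d\<close>, an element of \<open>M\<close>, is close to a multiple of
\<open>v * d * d\<close>; since \<open>\<phi>\<close> takes the value \<open>\<sigma> (star v * v) * \<phi> m\<close> there, the values of \<open>\<phi>\<close> at any two
elements can be compared, and elements of \<open>M\<close> close to \<open>v * d * d\<close> show that the norm of \<open>\<phi>\<close> is as
large as claimed. The compression property in turn comes from the uniqueness of \<open>s\<close>. For
self-adjoint \<open>x\<close>, by the Hahn-Banach theorem, the infimum of \<open>\<sigma> b\<close> over all \<open>b \<ge> x\<close> in \<open>D\<close> is the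
value at \<open>x\<close> of some state that extends \<open>\<sigma>\<close>, hence equals \<open>s x\<close>; so \<open>x\<close> lies between elements
\<open>a \<le> x \<le> b\<close> of \<open>D\<close> with \<open>\<sigma> (b - a)\<close> small, and one compresses this inequality by an element of \<open>D\<close> concentrated near
the point \<open>\<sigma>\<close>. This uses the order of a $C^*$-algebra, in particular the theorem that every
\<open>star a * a\<close> is positive.

For the continuity, boundedness and regularity of \<open>M2\<close> reduce convergence on \<open>M2\<close> to convergence at
normalizers \<open>v\<close> in \<open>M2\<close>. If the limit does not vanish at \<open>v\<close>, then \<open>v\<close> itself intertwines the limiting
characters, and up to a small error \<open>v * d * d\<close> is a multiple of an element of \<open>M1\<close>. If the limit
vanishes at \<open>v\<close>, then either \<open>\<sigma> (star v * v) = 0\<close>, which makes the nearby values at \<open>v\<close> small, or \<open>v\<close>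
does not carry \<open>\<sigma>\<close> to \<open>\<rho>\<close>, and this persists nearby and forces the values at \<open>v\<close> to be zero.
\<close>

instance cstar_algebra \<subseteq> banach ..

section \<open>Arithmetic of the involution\<close>

lemma star_bounded_linear: "bounded_linear (star :: 'a \<Rightarrow> 'a::cstar_algebra)"
  and norm_star: "norm (star x) = norm (x :: 'a::cstar_algebra)"
proof -
  have le: "norm x \<le> norm (star x)" for x :: 'a
  proof (cases "x = 0")
    case False
    have "norm x * norm x \<le> norm (star x) * norm x"
      using norm_mult_ineq[of "star x" x] cstar_identity[of x] by (simp add: power2_eq_square)
    then show ?thesis using False by simp
  qed auto
  show n: "norm (star x) = norm x" for x :: 'a
    using le[of x] le[of "star x"] by (simp add: star_star)
  show "bounded_linear (star :: 'a \<Rightarrow> 'a)"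
  proof (rule bounded_linear_intro[where K = 1])
    show "star (r *\<^sub>R x) = r *\<^sub>R star x" for r and x :: 'a
      using star_scaleC[of "complex_of_real r" x] by (simp add: scaleC_of_real)
  qed (simp_all add: star_add n)
qed

lemma star_zero [simp]: "star (0::'a::cstar_algebra) = 0"
  by (rule linear_0[OF bounded_linear.linear[OF star_bounded_linear]])

lemma star_minus: "star (- x) = - star (x::'a::cstar_algebra)"
  by (rule linear_neg[OF bounded_linear.linear[OF star_bounded_linear]])

lemma star_diff: "star (x - y) = star x - star (y::'a::cstar_algebra)"
  by (rule linear_diff[OF bounded_linear.linear[OF star_bounded_linear]])

lemma star_scaleR: "star (r *\<^sub>R x) = r *\<^sub>R star (x::'a::cstar_algebra)"
  by (rule linear_cmul[OF bounded_linear.linear[OF star_bounded_linear]])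

lemma star_one [simp]: "star (1::'a::cstar_algebra) = 1"
  using star_mult[of "star (1::'a)" 1] by (simp add: star_star)

lemma star_of_real [simp]: "star (of_real r :: 'a::cstar_algebra) = of_real r"
  by (simp add: of_real_def star_scaleR)

lemma star_power: "star (x ^ n) = star (x::'a::cstar_algebra) ^ n"
  by (induction n) (simp_all add: star_mult power_commutes)

lemmas star_simps = star_star star_add star_minus star_diff star_scaleR star_scaleC star_mult
  star_power

lemma scaleC_one [simp]: "1 *\<^sub>C x = (x::'a::cstar_algebra)"
  by (rule complex_vector.scale_one)

lemma norm_two_i_scaleC: "norm (\<i> *\<^sub>C (2 *\<^sub>R x)) = 2 * norm (x::'a::cstar_algebra)"
  by (simp add: norm_scaleC)

lemma norm_square_self_adjoint:
  "star h = h \<Longrightarrow> norm (h * h) = (norm (h::'a::cstar_algebra))\<^sup>2"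
  using cstar_identity[of h] by simp

lemma norm_mult_self_adjoint_right:
  "star d = d \<Longrightarrow> (norm (v * d))\<^sup>2 = norm (d * (star v * v) * (d::'a::cstar_algebra))"
  using cstar_identity[of "v * d"] by (simp add: star_mult mult.assoc)

text \<open>
Serves as a spectral radius formula: a self-adjoint element whose powers grow subexponentially is a
contraction.
\<close>

lemma norm_power_2_power_self_adjoint:
  fixes h :: "'a::cstar_algebra"
  assumes "star h = h"
  shows "norm (h ^ (2 ^ m)) = norm h ^ (2 ^ m)"
proof (induction m)
  case (Suc m)
  have "norm (h ^ (2 ^ Suc m)) = norm (h ^ 2 ^ m * h ^ 2 ^ m)"
    by (simp add: power_add mult_2)
  also have "\<dots> = (norm (h ^ 2 ^ m))\<^sup>2"
    by (rule norm_square_self_adjoint) (simp add: star_power assms)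
  finally show ?case using Suc.IH by (simp add: power_add mult_2 power2_eq_square)
qed simp

section \<open>Square roots\<close>

text \<open>
All coefficients of the series of \<open>sqrt (1 - x)\<close> except the first are negative, so the sum of their
absolute values telescopes and is at most 1. Convergence on the closed unit ball is what makes
square roots available for elements of norm exactly 1.
\<close>

lemma summable_abs_binomial_half:
  "summable (\<lambda>n. \<bar>(1/2::real) gchoose n\<bar>)"
  "(\<Sum>n. \<bar>(1/2::real) gchoose Suc n\<bar>) \<le> 1"
proof -
  define b :: "nat \<Rightarrow> real" where "b n = (1/2 gchoose n)" for n
  have pos: "0 < (-1) ^ n * ((-1/2 :: real) gchoose n)" for n
  proof (induction n)
    case (Suc n)
    have "(-1) ^ Suc n * ((-1/2 :: real) gchoose Suc n) =
        ((-1) ^ n * ((-1/2) gchoose n)) * ((1/2 + real n) / real (Suc n))"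
    proof -
      have "real (Suc n) * ((-1/2 :: real) gchoose Suc n) = - (1/2 + real n) * ((-1/2) gchoose n)"
        using gbinomial_mult_1[of "-1/2::real" n] by (simp add: algebra_simps)
      then have *: "((-1/2 :: real) gchoose Suc n) = - (1/2 + real n) * ((-1/2) gchoose n) / real (Suc n)"
        by (simp add: field_simps del: of_nat_Suc)
      show ?thesis unfolding * by (simp add: divide_simps)
    qed
    with Suc show ?case by (smt (verit) divide_pos_pos mult_pos_pos of_nat_0_le_iff of_nat_0_less_iff zero_less_Suc divide_pos_pos zero_less_divide_iff)
  qed simp
  have abs: "\<bar>b (Suc n)\<bar> = - (b (Suc n) * (-1) ^ Suc n)" for n
  proof -
    have "(-1) ^ n * b (Suc n) = ((-1) ^ n * ((-1/2) gchoose n)) * (1/2) / real (Suc n)"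
      using gbinomial_absorption[of n "1/2::real"] unfolding b_def
      by (simp add: field_simps)
    then have "0 < (-1) ^ n * b (Suc n)" using pos[of n] by simp
    then show ?thesis
      by (cases "even n") (auto simp: abs_if)
  qed
  have sum: "(\<Sum>k<n. \<bar>b (Suc k)\<bar>) \<le> 1" for n
  proof -
    have "1 - (\<Sum>k<n. \<bar>b (Suc k)\<bar>) = (\<Sum>k\<le>n. b k * (-1) ^ k)"
      unfolding abs sum_negf
      by (subst sum.atMost_shift) (simp add: b_def)
    also have "\<dots> > 0"
      using gbinomial_sum_lower_neg[of "1/2::real" n] pos[of n] by (simp add: b_def)
    finally show ?thesis by simp
  qed
  have "summable (\<lambda>n. \<bar>b (Suc n)\<bar>)"
    by (rule summableI_nonneg_bounded[where x = 1]) (use sum in auto)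
  then show "summable (\<lambda>n. \<bar>(1/2::real) gchoose n\<bar>)"
    unfolding b_def by (subst summable_Suc_iff[symmetric])
  show "(\<Sum>n. \<bar>(1/2::real) gchoose Suc n\<bar>) \<le> 1"
    by (rule suminf_le_const[OF \<open>summable (\<lambda>n. \<bar>b (Suc n)\<bar>)\<close>[unfolded b_def]])
      (use sum in \<open>simp add: b_def\<close>)
qed

lemma gbinomial_one: "(1::real) gchoose n = (if n \<le> 1 then 1 else 0)"
  using binomial_gbinomial[of 1 n, where ?'a = real] by (cases n) (auto simp: binomial_eq_0)

text \<open>
The binomial series of \<open>sqrt (1 - x)\<close>. Its square is computed by the Vandermonde identity; as a limit
of polynomials in \<open>x\<close> it inherits self-adjointness and the commutation relations of \<open>x\<close>.
\<close>

lemma square_root_of_one_minus_contraction: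
  fixes x :: "'a::cstar_algebra"
  assumes "norm x \<le> 1"
  obtains s where "s * s = 1 - x" "norm (1 - s) \<le> 1" "star x = x \<Longrightarrow> star s = s"
    "\<And>z. z * x = x * z \<Longrightarrow> z * s = s * z"
proof -
  define t where "t n = (1/2 gchoose n) *\<^sub>R (- x) ^ n" for n
  define s where "s = (\<Sum>n. t n)"
  have bound: "norm (t n) \<le> \<bar>1/2 gchoose n\<bar>" for n
  proof -
    have "norm ((- x) ^ n) \<le> 1"
      using norm_power_ineq[of "- x" n] power_le_one[of "norm x" n] assms by simp
    then show ?thesis by (simp add: t_def mult_left_le)
  qed
  have sn: "summable (\<lambda>n. norm (t n))"
    by (rule summable_comparison_test'[OF summable_abs_binomial_half(1), of 0]) (simp add: bound)
  then have st: "summable t" by (rule summable_norm_cancel)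
  have conv: "(\<Sum>i\<le>n. t i * t (n - i)) = (1 gchoose n) *\<^sub>R (- x) ^ n" for n
  proof -
    have "(\<Sum>i\<le>n. t i * t (n - i)) = (\<Sum>i\<le>n. ((1/2 gchoose i) * (1/2 gchoose (n - i))) *\<^sub>R (- x) ^ n)"
    proof (rule sum.cong)
      fix i assume "i \<in> {..n}"
      then have "(- x) ^ i * (- x) ^ (n - i) = (- x) ^ n"
        by (simp flip: power_add)
      then show "t i * t (n - i) = ((1/2 gchoose i) * (1/2 gchoose (n - i))) *\<^sub>R (- x) ^ n"
        by (simp add: t_def)
    qed simp
    also have "\<dots> = (1 gchoose n) *\<^sub>R (- x) ^ n"
      using gbinomial_Vandermonde[of "1/2::real" "1/2" n]
      by (simp flip: scaleR_sum_left add: atMost_atLeast0)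
    finally show ?thesis .
  qed
  have "s * s = (\<Sum>n. (1 gchoose n) *\<^sub>R (- x) ^ n)"
    unfolding s_def by (subst Cauchy_product[OF sn sn]) (simp add: conv)
  also have "\<dots> = (\<Sum>n\<in>{0,1}. (1 gchoose n) *\<^sub>R (- x) ^ n)"
    by (rule suminf_finite) (auto simp: gbinomial_one)
  finally have 1: "s * s = 1 - x" by simp
  have "1 - s = - (\<Sum>n. t (Suc n))"
    using suminf_split_head[OF st] unfolding s_def by (simp add: t_def[of 0])
  moreover have "norm (\<Sum>n. t (Suc n)) \<le> (\<Sum>n. \<bar>(1/2::real) gchoose Suc n\<bar>)"
    by (rule norm_suminf_le[OF bound])
      (use summable_abs_binomial_half(1) in \<open>subst summable_Suc_iff\<close>)
  ultimately have 2: "norm (1 - s) \<le> 1"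
    using summable_abs_binomial_half(2) by simp
  have 3: "star s = s" if "star x = x"
    unfolding s_def by (subst bounded_linear.suminf[OF star_bounded_linear st])
      (rule suminf_cong, simp add: t_def star_simps that)
  have 4: "z * s = s * z" if z: "z * x = x * z" for z
  proof -
    have pw: "z * (- x) ^ n = (- x) ^ n * z" for n
      using power_commuting_commutes[of "- x" z n] z by simp
    have "z * s = (\<Sum>n. z * t n)" unfolding s_def by (rule suminf_mult[OF st, symmetric])
    also have "\<dots> = (\<Sum>n. t n * z)" by (simp add: t_def pw)
    also have "\<dots> = s * z" unfolding s_def by (rule suminf_mult2[OF st, symmetric])
    finally show ?thesis .
  qed
  show thesis by (rule that[OF 1 2 3 4])
qed

section \<open>Positive elements\<close>

text \<open>
For self-adjoint \<open>h\<close> the norm condition says that the spectrum of \<open>h\<close> lies in the interval from 0 to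
\<open>2 T\<close>. In this form positivity is evidently stable under sums and needs no spectral theory.
\<close>

definition positive :: "'a::cstar_algebra \<Rightarrow> bool"
  where "positive h \<longleftrightarrow> star h = h \<and> (\<exists>T. norm (of_real T - h) \<le> T)"

lemma positive_bound_mono:
  fixes h :: "'a::cstar_algebra"
  assumes "norm (of_real T - h) \<le> T" "T \<le> T'"
  shows "norm (of_real T' - h) \<le> T'"
proof -
  have "of_real T' - h = of_real (T' - T) + (of_real T - h)" by simp
  then have "norm (of_real T' - h) \<le> norm (of_real (T' - T) :: 'a) + norm (of_real T - h)"
    by (metis norm_triangle_ineq)
  moreover have "norm (of_real (T' - T) :: 'a) = T' - T" using assms(2) unfolding norm_of_real by simp
  ultimately show ?thesis using assms by linarith
qed

lemma positive_add: "positive x \<Longrightarrow> positive y \<Longrightarrow> positive (x + y :: 'a::cstar_algebra)"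
proof -
  assume "positive x" "positive y"
  then obtain S T where *: "star x = x" "star y = y"
    "norm (of_real S - x) \<le> S" "norm (of_real T - y) \<le> T"
    unfolding positive_def by auto
  have "of_real (S + T) - (x + y) = (of_real S - x) + (of_real T - y)" by simp
  then have "norm (of_real (S + T) - (x + y)) \<le> S + T"
    by (metis *(3,4) add_mono norm_triangle_ineq order_trans)
  then show "positive (x + y)" using * unfolding positive_def by (auto simp: star_add simp del: of_real_add)
qed

lemma positive_scaleR: "positive x \<Longrightarrow> 0 \<le> r \<Longrightarrow> positive (r *\<^sub>R x :: 'a::cstar_algebra)"
proof -
  assume "positive x" "0 \<le> r"
  then obtain S where *: "star x = x" "norm (of_real S - x) \<le> S"
    unfolding positive_def by auto
  have "of_real (r * S) - r *\<^sub>R x = r *\<^sub>R (of_real S - x)"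
    by (simp add: scaleR_diff_right) (simp add: of_real_def mult.commute)
  then have "norm (of_real (r * S) - r *\<^sub>R x) \<le> r * S"
    using \<open>0 \<le> r\<close> *(2) by (simp add: mult_left_mono)
  then show ?thesis using * unfolding positive_def by (auto simp: star_scaleR simp del: of_real_mult)
qed

lemma positive_of_real_diff:
  "star h = h \<Longrightarrow> norm h \<le> t \<Longrightarrow> positive (of_real t - h :: 'a::cstar_algebra)"
  unfolding positive_def by (auto simp: star_simps intro!: exI[of _ t])

lemma positive_square_root:
  fixes h :: "'a::cstar_algebra"
  assumes "positive h"
  obtains k where "star k = k" "positive k" "k * k = h" "\<And>z. z * h = h * z \<Longrightarrow> z * k = k * z"
proof -
  from assms obtain T0 where sa: "star h = h" and T0: "norm (of_real T0 - h) \<le> T0"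
    unfolding positive_def by auto
  define T where "T = max T0 1"
  have T: "norm (of_real T - h) \<le> T" "T > 0"
    using positive_bound_mono[OF T0, of T] by (auto simp: T_def)
  define x where "x = (1 / T) *\<^sub>R (of_real T - h)"
  have "norm x = norm (of_real T - h) / T" using T(2) by (simp add: x_def)
  then have "norm x \<le> 1" using T by (simp only: divide_le_eq_1_pos)
  then obtain s where s: "s * s = 1 - x" "norm (1 - s) \<le> 1" "star x = x \<Longrightarrow> star s = s"
    "\<And>z. z * x = x * z \<Longrightarrow> z * s = s * z"
    using square_root_of_one_minus_contraction by blast
  have hx: "h = T *\<^sub>R (1 - x)" using T(2) by (simp add: x_def scaleR_diff_right of_real_def)
  have ss: "star s = s" using sa by (intro s(3)) (simp add: x_def star_simps)
  have ps: "positive s" unfolding positive_def using s(2) ss by (auto intro!: exI[of _ 1])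
  show thesis
  proof
    show "star (sqrt T *\<^sub>R s) = sqrt T *\<^sub>R s" by (simp add: star_scaleR ss)
    show "positive (sqrt T *\<^sub>R s)" using T(2) by (intro positive_scaleR ps) simp
    show "sqrt T *\<^sub>R s * sqrt T *\<^sub>R s = h" using T(2) by (simp add: s hx)
    show "z * sqrt T *\<^sub>R s = sqrt T *\<^sub>R s * z" if "z * h = h * z" for z
    proof -
      have "z * x = x * z" using that by (simp add: x_def algebra_simps of_real_def)
      then show ?thesis using s(4) by simp
    qed
  qed
qed

text \<open>
For a self-adjoint \<open>j\<close> of norm at most 1, \<open>j + \<i> sqrt (1 - j\<^sup>2)\<close> is unitary, so that its imaginary part
\<open>sqrt (1 - j\<^sup>2)\<close> has norm at most 1, and so has \<open>1 - j\<^sup>2\<close>.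
\<close>

lemma positive_square:
  fixes k :: "'a::cstar_algebra"
  assumes sa: "star k = k"
  shows "positive (k * k)"
proof -
  define T where "T = norm (k * k) + 1"
  have T: "T > 0" "norm (k * k) \<le> T" by (simp_all add: T_def add_nonneg_pos)
  define x where "x = (1 / T) *\<^sub>R (k * k)"
  have nx: "norm x \<le> 1" using T by (simp add: x_def)
  have sx: "star x = x" by (simp add: x_def star_simps sa)
  obtain s where s: "s * s = 1 - x" "star x = x \<Longrightarrow> star s = s"
    "\<And>z. z * x = x * z \<Longrightarrow> z * s = s * z"
    using square_root_of_one_minus_contraction[OF nx] by metis
  have ss: "star s = s" by (rule s(2)[OF sx])
  have ks: "k * s = s * k" by (rule s(3)) (simp add: x_def mult.assoc)
  define j where "j = (1 / sqrt T) *\<^sub>R k"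
  have js: "star j = j" "j * s = s * j" "j * j = x"
    using T ks by (simp_all add: j_def x_def star_scaleR sa)
  define u where "u = j + \<i> *\<^sub>C s"
  have su: "star u = j - \<i> *\<^sub>C s" by (simp add: u_def star_simps js ss)
  have "star u * u = 1"
    unfolding su by (simp add: u_def algebra_simps mult_scaleC_left mult_scaleC_right js(2,3)
      scaleC_scaleC s(1))
  then have "norm u = 1"
    using cstar_identity[of u] abs_square_eq_1[of "norm u"] by simp
  moreover have "2 * norm s \<le> norm u + norm (star u)"
    using norm_triangle_ineq4[of u "star u"] unfolding norm_two_i_scaleC[symmetric]
    by (simp add: su) (simp add: u_def scaleR_2 scaleC_add_right)
  ultimately have "norm s \<le> 1" unfolding norm_star by linarith
  then have "norm (s * s) \<le> 1"
    using norm_mult_ineq[of s s] mult_le_one[of "norm s" "norm s"] by simp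
  then have "norm (T *\<^sub>R (1 - x)) \<le> T" using T(1) s(1) by simp
  moreover have eq: "T *\<^sub>R (1 - x) = of_real T - k * k"
    using T(1) by (simp add: x_def scaleR_diff_right of_real_def)
  ultimately have "norm (of_real T - k * k) \<le> T" by (simp only:)
  moreover have "star (k * k) = k * k" by (simp add: star_mult sa)
  ultimately show ?thesis unfolding positive_def by blast
qed

text \<open>
If \<open>y = l\<^sup>2\<close> and \<open>t - y = k\<^sup>2\<close>, then \<open>w = k + \<i> l\<close> satisfies \<open>star w * w = t\<close>, which bounds its
imaginary part \<open>l\<close>.
\<close>

lemma norm_le_of_positive:
  fixes y :: "'a::cstar_algebra"
  assumes "positive y" "positive (of_real t - y)"
  shows "norm y \<le> t"
proof -
  obtain l where l: "star l = l" "l * l = y" "\<And>z. z * y = y * z \<Longrightarrow> z * l = l * z"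
    using positive_square_root[OF assms(1)] by metis
  obtain k where k: "star k = k" "k * k = of_real t - y"
    "\<And>z. z * (of_real t - y) = (of_real t - y) * z \<Longrightarrow> z * k = k * z"
    using positive_square_root[OF assms(2)] by metis
  have kl: "l * k = k * l"
  proof (rule k(3))
    have "l * y = y * l" by (simp add: mult.assoc flip: l(2))
    then show "l * (of_real t - y) = (of_real t - y) * l" by (simp add: algebra_simps of_real_def)
  qed
  define w where "w = k + \<i> *\<^sub>C l"
  have sw: "star w = k - \<i> *\<^sub>C l" by (simp add: w_def star_simps k l)
  have "star w * w = of_real t"
    unfolding sw by (simp add: w_def algebra_simps mult_scaleC_left mult_scaleC_right k(2) l(2) kl
      scaleC_scaleC)
  then have nw: "(norm w)\<^sup>2 = \<bar>t\<bar>" using cstar_identity[of w] by simp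
  have "2 * norm l \<le> norm w + norm (star w)"
    using norm_triangle_ineq4[of w "star w"] unfolding norm_two_i_scaleC[symmetric]
    by (simp add: sw) (simp add: w_def scaleR_2 scaleC_add_right)
  then have "norm l \<le> norm w" unfolding norm_star by linarith
  then have "norm y \<le> \<bar>t\<bar>"
    using norm_square_self_adjoint[OF l(1)] l(2) nw power_mono[OF _ norm_ge_zero, of l "norm w" 2]
    by simp
  moreover have "t \<ge> 0"
  proof (rule ccontr)
    assume "\<not> 0 \<le> t"
    have "positive (of_real t :: 'a)" using positive_add[OF assms] by simp
    then obtain S where "norm (of_real S - of_real t :: 'a) \<le> S" unfolding positive_def by auto
    then have "\<bar>S - t\<bar> \<le> S" by (simp flip: of_real_diff)
    with \<open>\<not> 0 \<le> t\<close> show False by simp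
  qed
  ultimately show ?thesis by simp
qed

lemma norm_mono_positive:
  fixes y z :: "'a::cstar_algebra"
  assumes "positive y" "positive (z - y)"
  shows "norm y \<le> norm z"
proof (rule norm_le_of_positive[OF assms(1)])
  have "star z = z" using assms by (auto simp: positive_def star_diff)
  then have "positive (of_real (norm z) - z)" by (intro positive_of_real_diff) auto
  from positive_add[OF this assms(2)] show "positive (of_real (norm z) - y)" by simp
qed

lemma positive_antisym: "positive y \<Longrightarrow> positive (- y) \<Longrightarrow> y = (0 :: 'a::cstar_algebra)"
  using norm_le_of_positive[of y 0] by simp

text \<open>
In spectral terms, \<open>c * star c\<close> and \<open>star c * c\<close> have the same nonzero spectrum. After scaling, the
given positivity says that \<open>z = 1 - c * star c\<close> is a contraction. The intertwining
\<open>x\<^sup>n * star c = star c * z\<^sup>n\<close> for \<open>x = 1 - star c * c\<close> bounds \<open>x\<^sup>n * (1 - x)\<close> uniformly, so \<open>x\<^sup>n\<close>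
grows at most linearly and \<open>x\<close> is a contraction as well.
\<close>

lemma positive_star_mult_swap:
  fixes c :: "'a::cstar_algebra"
  assumes "positive (c * star c)"
  shows "positive (star c * c)"
proof -
  obtain T0 where T0: "norm (of_real T0 - c * star c) \<le> T0" using assms by (auto simp: positive_def)
  define T where "T = max T0 1"
  have T: "norm (of_real T - c * star c) \<le> T" "T > 0"
    using positive_bound_mono[OF T0, of T] by (auto simp: T_def)
  define z where "z = 1 - (1/T) *\<^sub>R (c * star c)"
  define x where "x = 1 - (1/T) *\<^sub>R (star c * c)"
  define C where "C = (norm c)\<^sup>2 / T"
  have "z = (1/T) *\<^sub>R (of_real T - c * star c)"
    using T(2) by (simp add: z_def scaleR_diff_right of_real_def)
  then have z: "norm z \<le> 1" using T by simp
  have sx: "star x = x" by (simp add: x_def star_simps)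
  have cz: "x * star c = star c * z" by (simp add: x_def z_def algebra_simps)
  have pw: "x ^ n * star c = star c * z ^ n" for n
    by (induction n) (simp_all add: mult.assoc cz, simp flip: mult.assoc add: cz)
  have "norm (x ^ n * (1 - x)) \<le> C" for n
  proof -
    have "x ^ n * (1 - x) = (1/T) *\<^sub>R (star c * z ^ n * c)"
      by (simp add: x_def[symmetric] pw[symmetric] mult.assoc) (simp add: x_def)
    moreover have "norm (star c * z ^ n * c) \<le> norm c * 1 * norm c"
    proof -
      have "norm (z ^ n) \<le> 1" using norm_power_ineq[of z n] power_le_one[OF norm_ge_zero z, of n] by simp
      then have "norm (star c * z ^ n) \<le> norm c * 1"
        by (metis norm_star norm_mult_ineq mult_left_mono norm_ge_zero order_trans)
      then show ?thesis
        by (meson norm_mult_ineq mult_right_mono norm_ge_zero order_trans)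
    qed
    ultimately show ?thesis using T(2) by (simp add: C_def power2_eq_square divide_right_mono)
  qed
  note step = this
  have lin: "norm (x ^ n) \<le> 1 + real n * C" for n
  proof (induction n)
    case (Suc n)
    have "x ^ Suc n = x ^ n - x ^ n * (1 - x)" by (simp add: algebra_simps power_commutes)
    then have "norm (x ^ Suc n) \<le> norm (x ^ n) + norm (x ^ n * (1 - x))"
      by (metis norm_triangle_ineq4)
    then show ?case using Suc step[of n] by (simp add: algebra_simps)
  qed simp
  have "norm x \<le> 1"
  proof (rule ccontr)
    assume "\<not> norm x \<le> 1"
    then have n1: "norm x > 1" by simp
    have "(\<lambda>n. (1 + real n * C) / norm x ^ n) \<longlonglongrightarrow> 0"
    proof -
      have "(\<lambda>n. (1/norm x) ^ n + C * (real n * (1/norm x) ^ n)) \<longlonglongrightarrow> 0 + C * 0"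
        using n1 by (intro tendsto_intros LIMSEQ_power_zero powser_times_n_limit_0)
          (auto simp: divide_less_eq)
      then show ?thesis by (simp add: field_simps power_divide add_divide_distrib)
    qed
    then have "eventually (\<lambda>n. (1 + real n * C) / norm x ^ n < 1) sequentially"
      by (rule order_tendstoD) simp
    then obtain N where N: "\<And>n. n \<ge> N \<Longrightarrow> (1 + real n * C) / norm x ^ n < 1"
      by (auto simp: eventually_sequentially)
    have "N \<le> 2 ^ N" by (simp add: less_imp_le)
    moreover have "0 < norm x ^ 2 ^ N" using n1 by (intro zero_less_power) linarith
    ultimately have "1 + real (2 ^ N) * C < norm x ^ 2 ^ N"
      using N[of "2 ^ N"] by (simp only: pos_divide_less_eq mult_1)
    then show False using lin[of "2 ^ N"] norm_power_2_power_self_adjoint[OF sx, of N] by simp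
  qed
  then have "norm (T *\<^sub>R x) \<le> T" using T(2) by simp
  moreover have "T *\<^sub>R x = of_real T - star c * c"
    using T(2) by (simp add: x_def scaleR_diff_right of_real_def)
  ultimately have "norm (of_real T - star c * c) \<le> T" by (simp only:)
  moreover have "star (star c * c) = star c * c" by (simp add: star_simps)
  ultimately show ?thesis unfolding positive_def by blast
qed

lemma self_adjoint_parts:
  fixes x :: "'a::cstar_algebra"
  obtains a b where "star a = a" "star b = b" "x = a + \<i> *\<^sub>C b"
    "a = (1/2) *\<^sub>R (x + star x)" "b = (- \<i>) *\<^sub>C ((1/2) *\<^sub>R (x - star x))"
proof -
  have a: "star ((1/2) *\<^sub>R (x + star x)) = (1/2) *\<^sub>R (x + star x)"
    by (simp add: star_scaleR star_add star_star add.commute)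
  have "star ((- \<i>) *\<^sub>C y) = (- \<i>) *\<^sub>C (- star y)" for y :: 'a
    unfolding star_scaleC
    by (simp only: complex_vector.scale_minus_right complex_vector.scale_minus_left)
      (simp add: complex_vector.scale_minus_left)
  then have b: "star ((- \<i>) *\<^sub>C ((1/2) *\<^sub>R (x - star x))) = (- \<i>) *\<^sub>C ((1/2) *\<^sub>R (x - star x))"
    by (simp only: star_scaleR star_diff star_star minus_diff_eq flip: scaleR_minus_right)
  have "\<i> *\<^sub>C (- \<i>) *\<^sub>C y = y" for y :: 'a
    unfolding scaleC_scaleC by simp
  moreover have "(1/2) *\<^sub>R (x + star x) + (1/2) *\<^sub>R (x - star x) = (1/2) *\<^sub>R (x + x)"
    unfolding scaleR_add_right[symmetric] by simp
  ultimately have c: "x = (1/2) *\<^sub>R (x + star x) + \<i> *\<^sub>C (- \<i>) *\<^sub>C ((1/2) *\<^sub>R (x - star x))"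
    by (simp only: scaleR_half_double)
  show thesis by (rule that[OF a b c refl refl])
qed

lemma star_mult_add_mult_star:
  fixes a b :: "'a::cstar_algebra"
  assumes "star a = a" "star b = b"
  shows "star (a + \<i> *\<^sub>C b) * (a + \<i> *\<^sub>C b) + (a + \<i> *\<^sub>C b) * star (a + \<i> *\<^sub>C b) = 2 *\<^sub>R (a * a + b * b)"
  by (simp add: star_simps algebra_simps mult_scaleC_left mult_scaleC_right scaleC_scaleC scaleR_2
      assms scaleC_add_right)

lemma positive_star_mult_sum:
  fixes c :: "'a::cstar_algebra"
  shows "positive (star c * c + c * star c)"
proof -
  obtain a b where ab: "star a = a" "star b = b" "c = a + \<i> *\<^sub>C b"
    by (metis self_adjoint_parts)
  show ?thesis unfolding ab(3) star_mult_add_mult_star[OF ab(1,2)]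
    by (intro positive_scaleR positive_add positive_square ab) simp
qed

text \<open>
The argument of Fukamiya and Kaplansky. Let \<open>q\<close> be the negative part of \<open>h = star a * a\<close>; it
satisfies \<open>q * h = - q\<^sup>2\<close>. For \<open>c = a * q\<close> one gets \<open>star c * c = - q\<^sup>3\<close>, and \<open>c * star c\<close> is then
positive as a sum of positive elements. Exchanging the factors shows that \<open>- q\<^sup>3\<close> is positive too,
whence \<open>q = 0\<close>.
\<close>

theorem positive_star_mult_self:
  fixes a :: "'a::cstar_algebra"
  shows "positive (star a * a)"
proof -
  define h where "h = star a * a"
  have sh: "star h = h" by (simp add: h_def star_simps)
  obtain s where s: "star s = s" "positive s" "s * s = h * h" "\<And>z. z * (h * h) = (h * h) * z \<Longrightarrow> z * s = s * z"
    using positive_square_root[OF positive_square[OF sh]] by metis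
  have hs: "h * s = s * h" by (rule s(4)) (simp add: mult.assoc)
  \<comment> \<open>The absolute value of \<open>h\<close> is \<open>s\<close>, so this is the negative part of \<open>h\<close>.\<close>
  define q where "q = (1/2) *\<^sub>R (s - h)"
  have sq: "star q = q" by (simp add: q_def star_simps s sh)
  have qs: "q * s = s * q" by (simp add: q_def algebra_simps hs)
  have hq: "q * h = - (q * q)"
  proof -
    have "(s - h) * (s - h) = 2 *\<^sub>R (h * h - s * h)"
      by (simp add: algebra_simps s(3) hs scaleR_2)
    then show ?thesis by (simp add: q_def) (simp add: algebra_simps)
  qed
  obtain k where k: "star k = k" "k * k = s" "\<And>z. z * s = s * z \<Longrightarrow> z * k = k * z"
    using positive_square_root[OF s(2)] by metis
  have qk: "q * k = k * q" by (rule k(3)[OF qs])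
  have "s = 2 *\<^sub>R q + h" by (simp add: q_def)
  then have "q * s = q * (2 *\<^sub>R q + h)" by (rule arg_cong)
  then have "q * s = 2 *\<^sub>R (q * q) + q * h" by (simp add: distrib_left)
  then have qs2: "q * s = q * q" by (simp add: hq scaleR_2)
  have "(k * q) * (k * q) = (q * k) * (k * q)" by (simp only: qk)
  also have "\<dots> = q * (k * k) * q" by (simp only: mult.assoc)
  finally have q3: "q * q * q = (k * q) * (k * q)" by (simp only: k(2) qs2)
  have p3: "positive (q * q * q)" unfolding q3
    by (rule positive_square) (simp add: star_simps k(1) sq qk)
  define c where "c = a * q"
  have cc: "star c * c = - (q * q * q)"
  proof -
    have "star c * c = q * h * q" by (simp add: c_def star_simps sq h_def mult.assoc)
    then show ?thesis by (simp add: hq)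
  qed
  have "positive (c * star c)"
    using positive_add[OF positive_star_mult_sum[of c] p3] by (simp add: cc)
  then have "positive (- (q * q * q))" using positive_star_mult_swap cc by metis
  with p3 have "q * q * q = 0" by (rule positive_antisym)
  then have "norm ((q * q) * (q * q)) = 0" by (simp flip: mult.assoc)
  then have "q = 0"
    using norm_square_self_adjoint[of "q * q"] norm_square_self_adjoint[OF sq] by (simp add: star_simps sq)
  then have "h = s" by (simp add: q_def)
  then show ?thesis using s(2) by (simp add: h_def)
qed

lemma positive_conjugate:
  fixes z :: "'a::cstar_algebra"
  assumes "positive z"
  shows "positive (star d * z * d)"
proof -
  obtain k where k: "star k = k" "k * k = z" using positive_square_root[OF assms] by blast
  have "star (k * d) * (k * d) = star d * (k * k) * d" by (simp add: star_mult k(1) mult.assoc)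
  then have "star d * z * d = star (k * d) * (k * d)" by (simp only: k(2))
  then show ?thesis by (simp add: positive_star_mult_self)
qed

section \<open>Sublinear functionals\<close>

definition sublinear :: "('a::real_vector \<Rightarrow> real) \<Rightarrow> bool"
  where "sublinear p \<longleftrightarrow> (\<forall>x y. p (x + y) \<le> p x + p y) \<and> (\<forall>r x. 0 \<le> r \<longrightarrow> p (r *\<^sub>R x) = r * p x)"

lemma sublinearD:
  assumes "sublinear p"
  shows "p (x + y) \<le> p x + p y" "0 \<le> r \<Longrightarrow> p (r *\<^sub>R x) = r * p x" "p 0 = 0" "- p (- x) \<le> p x"
proof -
  show *: "p (x + y) \<le> p x + p y" "0 \<le> r \<Longrightarrow> p (r *\<^sub>R x) = r * p x" for x y r
    using assms by (auto simp: sublinear_def)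
  show z: "p 0 = 0" using *(2)[of 0 0] by simp
  show "- p (- x) \<le> p x" using *(1)[of x "- x"] z by simp
qed

lemma sublinearI_le:
  assumes add: "\<And>x y. p (x + y) \<le> p x + p y"
    and scale: "\<And>r x. 0 < r \<Longrightarrow> p (r *\<^sub>R x) \<le> r * p x"
    and zero: "p 0 = 0"
  shows "sublinear p"
proof -
  have "p (r *\<^sub>R x) = r * p x" if "0 \<le> r" for r x
  proof (cases "r = 0")
    case False
    then have r: "0 < r" using that by simp
    have "r * p x = r * p ((1 / r) *\<^sub>R (r *\<^sub>R x))" using r by simp
    also have "\<dots> \<le> p (r *\<^sub>R x)"
      using scale[of "1 / r" "r *\<^sub>R x"] r by (simp add: field_simps)
    finally show ?thesis using scale[OF r, of x] by simp
  qed (simp add: zero)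
  with add show ?thesis by (auto simp: sublinear_def)
qed

text \<open>
The infimum of \<open>q (y + t z) - t q z\<close> over \<open>t \<ge> 0\<close> is the largest sublinear functional below \<open>q\<close>
whose value at \<open>- z\<close> is at most \<open>- q z\<close>. A sublinear functional that is minimal cannot be lowered
in this way and is therefore odd, hence linear.
\<close>

lemma sublinear_tilt:
  fixes q :: "'a::real_vector \<Rightarrow> real"
  assumes q: "sublinear q"
  obtains q' where "sublinear q'" "q' \<le> q" "q' (- z) \<le> - q z"
proof -
  define Q where "Q y = (\<lambda>t. q (y + t *\<^sub>R z) - t * q z) ` {0..}" for y
  define q' where "q' y = Inf (Q y)" for y
  note D = sublinearD[OF q]
  have bdd: "bdd_below (Q y)" for y
  proof (rule bdd_belowI)
    fix r assume "r \<in> Q y"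
    then obtain t where t: "t \<ge> 0" "r = q (y + t *\<^sub>R z) - t * q z" by (auto simp: Q_def)
    have "q (t *\<^sub>R z) \<le> q (y + t *\<^sub>R z) + q (- y)" using D(1)[of "y + t *\<^sub>R z" "- y"] by simp
    then show "- q (- y) \<le> r" using t D(2)[of t z] by simp
  qed
  have ne: "Q y \<noteq> {}" for y by (auto simp: Q_def)
  have le: "q' y \<le> q (y + t *\<^sub>R z) - t * q z" if "t \<ge> 0" for t y
    unfolding q'_def by (rule cInf_lower[OF _ bdd]) (use that in \<open>auto simp: Q_def\<close>)
  have ge: "c \<le> q' y" if "\<And>t. t \<ge> 0 \<Longrightarrow> c \<le> q (y + t *\<^sub>R z) - t * q z" for c y
    unfolding q'_def by (rule cInf_greatest[OF ne]) (use that in \<open>auto simp: Q_def\<close>)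
  show thesis
  proof
    show "q' \<le> q" using le[of 0] by (auto simp: le_fun_def)
    show "q' (- z) \<le> - q z" using le[of 1 "- z"] by (simp add: D(3))
    show "sublinear q'"
    proof (rule sublinearI_le)
      fix x y
      have "q' (x + y) - (q (y + t *\<^sub>R z) - t * q z) \<le> q' x" if t: "t \<ge> 0" for t
      proof (rule ge)
        fix s :: real assume s: "s \<ge> 0"
        have "q' (x + y) \<le> q ((x + y) + (s + t) *\<^sub>R z) - (s + t) * q z" using s t by (intro le) simp
        also have "(x + y) + (s + t) *\<^sub>R z = (x + s *\<^sub>R z) + (y + t *\<^sub>R z)" by (simp add: algebra_simps)
        also have "q \<dots> \<le> q (x + s *\<^sub>R z) + q (y + t *\<^sub>R z)" by (rule D(1))
        finally show "q' (x + y) - (q (y + t *\<^sub>R z) - t * q z) \<le> q (x + s *\<^sub>R z) - s * q z"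
          by (simp add: algebra_simps)
      qed
      then have "q' (x + y) - q' x \<le> q' y" by (intro ge) (simp add: algebra_simps)
      then show "q' (x + y) \<le> q' x + q' y" by simp
    next
      fix r :: real and x assume r: "0 < r"
      have "q' (r *\<^sub>R x) / r \<le> q' x"
      proof (rule ge)
        fix t :: real assume t: "t \<ge> 0"
        have "q' (r *\<^sub>R x) \<le> q (r *\<^sub>R x + (r * t) *\<^sub>R z) - (r * t) * q z" using r t by (intro le) simp
        also have "r *\<^sub>R x + (r * t) *\<^sub>R z = r *\<^sub>R (x + t *\<^sub>R z)" by (simp add: algebra_simps)
        also have "q \<dots> = r * q (x + t *\<^sub>R z)" using r by (intro D(2)) simp
        finally show "q' (r *\<^sub>R x) / r \<le> q (x + t *\<^sub>R z) - t * q z"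
          using r by (simp add: field_simps)
      qed
      then show "q' (r *\<^sub>R x) \<le> r * q' x" using r by (simp add: field_simps)
    next
      show "q' 0 = 0"
        using le[of 0 0] by (intro antisym ge) (auto simp: D(2,3))
    qed
  qed
qed

text \<open>
One first tilts \<open>p\<close> to force the value at \<open>z\<close>, and then takes a minimal sublinear functional below the
result. The pointwise infimum of a chain of sublinear functionals is sublinear, so Zorn's lemma
applies.
\<close>

theorem Hahn_Banach_sublinear:
  fixes p :: "'a::real_vector \<Rightarrow> real"
  assumes p: "sublinear p"
  obtains f where "linear f" "\<And>x. f x \<le> p x" "f z = p z"
proof -
  obtain p' where p': "sublinear p'" "p' \<le> p" "p' (- z) \<le> - p z" using sublinear_tilt[OF p] .
  define S where "S = {q. sublinear q \<and> q \<le> p'}"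
  have "\<exists>q\<in>S. \<forall>r\<in>S. q \<ge> r \<longrightarrow> r = q"
  proof (rule predicate_Zorn)
    \<comment> \<open>Minimal functionals are the maximal ones for the reversed order.\<close>
    show "partial_order_on S (relation_of (\<ge>) S)"
      by (rule partial_order_on_relation_ofI) auto
    fix C assume C: "C \<in> Chains (relation_of (\<ge>) S)"
    then have CS: "q \<in> S" and tot: "r \<in> C \<Longrightarrow> q \<le> r \<or> r \<le> q" if "q \<in> C" for q r
      using that unfolding Chains_def relation_of_def by auto
    show "\<exists>u\<in>S. \<forall>q\<in>C. q \<ge> u"
    proof (cases "C = {}")
      case True
      then show ?thesis using p' by (auto simp: S_def)
    next
      case False
      define u where "u x = (INF q\<in>C. q x)" for x
      have bdd: "bdd_below ((\<lambda>q. q x) ` C)" for x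
      proof (rule bdd_belowI2)
        fix q assume "q \<in> C"
        then have "sublinear q" "q (- x) \<le> p' (- x)" using CS by (auto simp: S_def le_fun_def)
        then show "- p' (- x) \<le> q x" using sublinearD(4)[of q x] by simp
      qed
      have le: "u x \<le> q x" if "q \<in> C" for x q
        unfolding u_def by (rule cINF_lower[OF bdd that])
      have ge: "c \<le> u x" if "\<And>q. q \<in> C \<Longrightarrow> c \<le> q x" for c x
        unfolding u_def by (rule cINF_greatest[OF False that])
      have sub: "q \<in> C \<Longrightarrow> sublinear q" for q using CS by (auto simp: S_def)
      have "sublinear u"
      proof (rule sublinearI_le)
        fix x y
        have "u (x + y) \<le> q x + r y" if qr: "q \<in> C" "r \<in> C" for q r
        proof -
          obtain m where m: "m \<in> C" "m \<le> q" "m \<le> r" using tot[OF qr] qr by auto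
          have "u (x + y) \<le> m x + m y"
            using le[OF m(1), of "x + y"] sublinearD(1)[OF sub[OF m(1)], of x y] by simp
          also have "\<dots> \<le> q x + r y" using m by (intro add_mono) (auto simp: le_fun_def)
          finally show ?thesis .
        qed
        then have "u (x + y) - r y \<le> u x" if "r \<in> C" for r using that by (intro ge) (simp add: algebra_simps)
        then have "u (x + y) - u x \<le> u y" by (intro ge) (simp add: algebra_simps)
        then show "u (x + y) \<le> u x + u y" by simp
      next
        fix r :: real and x assume r: "0 < r"
        have "u (r *\<^sub>R x) / r \<le> u x"
        proof (rule ge)
          fix q assume q: "q \<in> C"
          show "u (r *\<^sub>R x) / r \<le> q x"
            using le[OF q, of "r *\<^sub>R x"] sublinearD(2)[OF sub[OF q], of r x] r by (simp add: field_simps)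
        qed
        then show "u (r *\<^sub>R x) \<le> r * u x" using r by (simp add: field_simps)
      next
        have "q 0 = 0" if "q \<in> C" for q using sublinearD(3) sub[OF that] by blast
        then have "(\<lambda>q. q 0) ` C = (\<lambda>q. 0) ` C" by (rule image_cong[OF refl])
        then have "(\<lambda>q. q 0) ` C = {0}" using False by (simp only: image_constant_conv if_False)
        then show "u 0 = 0" by (simp add: u_def)
      qed
      moreover have "u \<le> q" if "q \<in> C" for q using le[OF that] by (simp add: le_fun_def)
      moreover have "u \<le> p'" using False CS calculation(2) by (fastforce simp: S_def intro: order_trans)
      ultimately show ?thesis by (auto simp: S_def)
    qed
  qed
  then obtain f where f: "sublinear f" "f \<le> p'" and min: "\<And>r. sublinear r \<Longrightarrow> r \<le> f \<Longrightarrow> r = f"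
    unfolding S_def by (auto intro: order_trans)
  note D = sublinearD[OF f(1)]
  have neg: "f (- x) = - f x" for x
  proof -
    obtain r where "sublinear r" "r \<le> f" "r (- x) \<le> - f x" using sublinear_tilt[OF f(1)] .
    then show ?thesis using min[of r] D(4)[of x] by simp
  qed
  show thesis
  proof
    show "linear f"
    proof (rule linearI)
      show "f (x + y) = f x + f y" for x y
        using D(1)[of x y] D(1)[of "- x" "- y"] neg[of "x + y"] by (simp add: neg)
      show "f (r *\<^sub>R x) = r *\<^sub>R f x" for r x
      proof (cases "0 \<le> r")
        case False
        then have "f ((- r) *\<^sub>R (- x)) = (- r) * f (- x)" by (intro D(2)) simp
        then show ?thesis by (simp add: neg)
      qed (simp add: D(2))
    qed
    show le: "f x \<le> p x" for x using f(2) p'(2) by (auto simp: le_fun_def intro: order_trans)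
    have "f (- z) \<le> - p z" using f(2) p'(3) by (auto simp: le_fun_def intro: order_trans)
    then show "f z = p z" using le[of z] neg[of z] by simp
  qed
qed

section \<open>Normalized functionals and states\<close>

lemma cstar_subalgebraD:
  assumes "cstar_subalgebra S"
  shows "x \<in> S \<Longrightarrow> y \<in> S \<Longrightarrow> x + y \<in> S" "x \<in> S \<Longrightarrow> y \<in> S \<Longrightarrow> x - y \<in> S"
    "x \<in> S \<Longrightarrow> c *\<^sub>C x \<in> S" "x \<in> S \<Longrightarrow> r *\<^sub>R x \<in> S" "x \<in> S \<Longrightarrow> - x \<in> S" "0 \<in> S"
    "x \<in> S \<Longrightarrow> y \<in> S \<Longrightarrow> x * y \<in> S" "x \<in> S \<Longrightarrow> star x \<in> S" "closed S"
    "1 \<in> S \<Longrightarrow> of_real r \<in> S"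
proof -
  have sub: "csubspace S" using assms by (simp add: cstar_subalgebra_def)
  show "x \<in> S \<Longrightarrow> y \<in> S \<Longrightarrow> x + y \<in> S" "x \<in> S \<Longrightarrow> y \<in> S \<Longrightarrow> x - y \<in> S"
    "x \<in> S \<Longrightarrow> c *\<^sub>C x \<in> S" "x \<in> S \<Longrightarrow> - x \<in> S" "0 \<in> S"
    using sub by (auto intro: complex_vector.subspace_add complex_vector.subspace_diff
      complex_vector.subspace_scale complex_vector.subspace_neg complex_vector.subspace_0)
  show R: "x \<in> S \<Longrightarrow> r *\<^sub>R x \<in> S" for x r
    using complex_vector.subspace_scale[OF sub, of x "complex_of_real r"] by (simp add: scaleC_of_real)
  show "x \<in> S \<Longrightarrow> y \<in> S \<Longrightarrow> x * y \<in> S" "x \<in> S \<Longrightarrow> star x \<in> S" "closed S"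
    using assms by (auto simp: cstar_subalgebra_def)
  show "1 \<in> S \<Longrightarrow> of_real r \<in> S" using R by (simp add: of_real_def)
qed

lemma cstar_subalgebra_UNIV: "cstar_subalgebra (UNIV :: 'a::cstar_algebra set)"
  by (simp add: cstar_subalgebra_def complex_vector.subspace_UNIV)

text \<open>
On a $C^*$-algebra with unit these functionals are the states. The condition \<open>F 1 = 1\<close> with \<open>F\<close>
contractive is easier to check than positivity, and positivity follows from it.
\<close>

definition normalized_functional :: "'a::cstar_algebra set \<Rightarrow> ('a \<Rightarrow> complex) \<Rightarrow> bool"
  where "normalized_functional S F \<longleftrightarrow>
    (\<forall>x\<in>S. \<forall>y\<in>S. F (x + y) = F x + F y) \<and> (\<forall>c. \<forall>x\<in>S. F (c *\<^sub>C x) = c * F x) \<and>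
    (\<forall>x\<in>S. cmod (F x) \<le> norm x) \<and> F 1 = 1"

lemma linear_on_subspace:
  assumes "csubspace S"
    and "\<forall>x\<in>S. \<forall>y\<in>S. F (x + y) = F x + (F y :: complex)" and "\<forall>c. \<forall>x\<in>S. F (c *\<^sub>C x) = c * F x"
  shows "x \<in> S \<Longrightarrow> F (- x) = - F x" "x \<in> S \<Longrightarrow> y \<in> S \<Longrightarrow> F (x - y) = F x - F y"
    "x \<in> S \<Longrightarrow> F (r *\<^sub>R x) = of_real r * F x" "F 0 = 0"
proof -
  have neg: "F (- x) = - F x" if "x \<in> S" for x
    using assms(3)[rule_format, OF that, of "-1"] by simp
  then show "x \<in> S \<Longrightarrow> F (- x) = - F x" .
  show "x \<in> S \<Longrightarrow> y \<in> S \<Longrightarrow> F (x - y) = F x - F y"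
    using assms(2)[rule_format, of x "- y"] neg complex_vector.subspace_neg[OF assms(1)] by simp
  show "x \<in> S \<Longrightarrow> F (r *\<^sub>R x) = of_real r * F x"
    using assms(3)[rule_format, of x "of_real r"] by (simp add: scaleC_of_real)
  show "F 0 = 0"
    using assms(3)[rule_format, OF complex_vector.subspace_0[OF assms(1)], of 0] by simp
qed

context
  fixes S :: "'a::cstar_algebra set" and F
  assumes S: "cstar_subalgebra S" "1 \<in> S" and F: "normalized_functional S F"
begin

lemma normalized_functionalD:
  "x \<in> S \<Longrightarrow> y \<in> S \<Longrightarrow> F (x + y) = F x + F y" "x \<in> S \<Longrightarrow> F (c *\<^sub>C x) = c * F x"
  "x \<in> S \<Longrightarrow> cmod (F x) \<le> norm x" "F 1 = 1"
  "x \<in> S \<Longrightarrow> F (- x) = - F x" "x \<in> S \<Longrightarrow> y \<in> S \<Longrightarrow> F (x - y) = F x - F y"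
  "x \<in> S \<Longrightarrow> F (r *\<^sub>R x) = of_real r * F x" "F 0 = 0" "F (of_real r) = of_real r"
proof -
  have sub: "csubspace S" using S by (simp add: cstar_subalgebra_def)
  show 1: "x \<in> S \<Longrightarrow> y \<in> S \<Longrightarrow> F (x + y) = F x + F y" "x \<in> S \<Longrightarrow> F (c *\<^sub>C x) = c * F x"
    "x \<in> S \<Longrightarrow> cmod (F x) \<le> norm x" "F 1 = 1" for x y c
    using F by (auto simp: normalized_functional_def)
  show "x \<in> S \<Longrightarrow> F (- x) = - F x" "x \<in> S \<Longrightarrow> y \<in> S \<Longrightarrow> F (x - y) = F x - F y" "F 0 = 0"
    using linear_on_subspace[OF sub, of F] 1 by auto
  show 2: "x \<in> S \<Longrightarrow> F (r *\<^sub>R x) = of_real r * F x" for x r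
    using linear_on_subspace[OF sub, of F] 1 by auto
  show "F (of_real r) = of_real r" using 2[OF S(2), of r] 1(4) by (simp add: of_real_def)
qed

text \<open>
The norm of \<open>h + \<i> t\<close> grows like \<open>\<bar>t\<bar>\<close> up to an error of order \<open>1 / \<bar>t\<bar>\<close>, which leaves no room for an
imaginary part of \<open>F h\<close>.
\<close>

lemma normalized_functional_real:
  assumes h: "h \<in> S" "star h = h"
  shows "Im (F h) = 0"
proof (rule ccontr)
  assume *: "Im (F h) \<noteq> 0"
  define \<alpha> \<beta> where "\<alpha> = Re (F h)" and "\<beta> = Im (F h)"
  have bound: "\<alpha>\<^sup>2 + (\<beta> + t)\<^sup>2 \<le> (norm h)\<^sup>2 + t\<^sup>2" for t
  proof -
    define s where "s = \<i> * complex_of_real t"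
    have cs: "cnj s = - s" and ss: "s * s = - complex_of_real (t\<^sup>2)"
      by (simp_all add: s_def complex_eq_iff power2_eq_square)
    define z where "z = h + s *\<^sub>C (1::'a)"
    have "z \<in> S" unfolding z_def using S h cstar_subalgebraD[OF S(1)] by blast
    have sz: "star z = h - s *\<^sub>C 1"
      by (simp add: z_def star_add star_scaleC h cs)
    have "star z * z = (h - s *\<^sub>C 1) * (h + s *\<^sub>C 1)"
      by (simp only: sz) (simp only: z_def)
    also have "\<dots> = h * h - (s * s) *\<^sub>C 1"
      unfolding distrib_left left_diff_distrib mult_scaleC_left mult_scaleC_right
        scaleC_scaleC mult_1 mult_1_right complex_vector.scale_right_diff_distrib by simp
    also have "(s * s) *\<^sub>C (1::'a) = - of_real (t\<^sup>2)"
      unfolding ss complex_vector.scale_minus_left scaleC_of_real by (simp add: of_real_def)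
    finally have "star z * z = h * h + of_real (t\<^sup>2)" by simp
    then have "(norm z)\<^sup>2 \<le> norm (h * h) + norm (of_real (t\<^sup>2) :: 'a)"
      using norm_triangle_ineq[of "h * h" "of_real (t\<^sup>2)"] cstar_identity[of z] by simp
    also have "\<dots> = (norm h)\<^sup>2 + t\<^sup>2"
      unfolding norm_square_self_adjoint[OF h(2)] norm_of_real by simp
    finally have "(norm z)\<^sup>2 \<le> (norm h)\<^sup>2 + t\<^sup>2" .
    moreover have "F z = F h + \<i> * of_real t"
      unfolding z_def using normalized_functionalD(1,2,4) S(2) h cstar_subalgebraD(3)[OF S(1)]
      by (simp add: s_def)
    then have "(cmod (F z))\<^sup>2 = \<alpha>\<^sup>2 + (\<beta> + t)\<^sup>2" by (simp add: cmod_power2 \<alpha>_def \<beta>_def)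
    moreover have "(cmod (F z))\<^sup>2 \<le> (norm z)\<^sup>2"
      using normalized_functionalD(3)[OF \<open>z \<in> S\<close>] by (intro power_mono) auto
    ultimately show ?thesis by simp
  qed
  have "2 * \<beta> * t \<le> (norm h)\<^sup>2" for t
    using bound[of t] zero_le_power2[of \<alpha>] zero_le_power2[of \<beta>] unfolding power2_sum by linarith
  from this[of "((norm h)\<^sup>2 + 1) / (2 * \<beta>)"] show False using * by (simp add: \<beta>_def)
qed

lemma normalized_functional_star:
  assumes x: "x \<in> S"
  shows "F (star x) = cnj (F x)"
proof -
  obtain a b where ab: "star a = a" "star b = b" "x = a + \<i> *\<^sub>C b"
    "a = (1/2) *\<^sub>R (x + star x)" "b = (- \<i>) *\<^sub>C ((1/2) *\<^sub>R (x - star x))"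
    by (rule self_adjoint_parts)
  note U = cstar_subalgebraD[OF S(1)]
  have m: "a \<in> S" "b \<in> S" unfolding ab(4,5) using x U by simp_all
  have "star x = a + (- \<i>) *\<^sub>C b" unfolding ab(3) by (simp add: star_add star_scaleC ab(1,2))
  then have "F (star x) = F a - \<i> * F b" "F x = F a + \<i> * F b"
    unfolding ab(3) using m U(3) normalized_functionalD(1,2,6) by simp_all
  then show ?thesis
    using normalized_functional_real[OF m(1) ab(1)] normalized_functional_real[OF m(2) ab(2)]
    by (simp add: complex_eq_iff)
qed

lemma normalized_functional_positive:
  assumes h: "h \<in> S" "positive h"
  shows "0 \<le> Re (F h)" "F h = of_real (Re (F h))"
proof -
  obtain T where T: "star h = h" "norm (of_real T - h) \<le> T" using h by (auto simp: positive_def)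
  note U = cstar_subalgebraD[OF S(1)]
  have "F (of_real T - h) = of_real T - F h"
    using normalized_functionalD(6,9) h U(10)[OF S(2)] by simp
  moreover have "cmod (F (of_real T - h)) \<le> T"
    using normalized_functionalD(3)[of "of_real T - h"] h U(2) U(10)[OF S(2)] T by force
  ultimately have "\<bar>Re (of_real T - F h)\<bar> \<le> T" by (metis abs_Re_le_cmod order_trans)
  then show "0 \<le> Re (F h)" by simp
  show "F h = of_real (Re (F h))"
    using normalized_functional_real[OF h(1) T(1)] by (simp add: complex_eq_iff)
qed

lemma normalized_functional_square:
  assumes "a \<in> S"
  shows "0 \<le> Re (F (star a * a))" "F (star a * a) = of_real (Re (F (star a * a)))"
  by (rule normalized_functional_positive[OF _ positive_star_mult_self];
      intro cstar_subalgebraD[OF S(1)] assms)+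

lemma normalized_functional_Cauchy_Schwarz:
  assumes x: "x \<in> S" and y: "y \<in> S"
  shows "(cmod (F (star y * x)))\<^sup>2 \<le> Re (F (star y * y)) * Re (F (star x * x))"
proof -
  note U = cstar_subalgebraD[OF S(1)]
  define w P Q where "w = F (star y * x)" "P = Re (F (star y * y))" "Q = Re (F (star x * x))"
  have fx: "F (star x * x) = of_real Q" and fy: "F (star y * y) = of_real P" and PQ: "0 \<le> P" "0 \<le> Q"
    unfolding w_P_Q_def using normalized_functional_square x y by auto
  have fxy: "F (star x * y) = cnj w"
    using normalized_functional_star[of "star y * x"] U x y by (simp add: star_mult star_star w_P_Q_def)
  have main: "0 \<le> Q - 2 * r * (cmod w)\<^sup>2 + r\<^sup>2 * (cmod w)\<^sup>2 * P" for r :: real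
  proof -
    define c where "c = of_real r * w"
    define z where "z = x - c *\<^sub>C y"
    have zS: "z \<in> S" unfolding z_def using x y U by simp
    have "star z * z = (star x * x - c *\<^sub>C (star x * y)) - (cnj c *\<^sub>C (star y * x) - (cnj c * c) *\<^sub>C (star y * y))"
      unfolding z_def star_diff star_scaleC left_diff_distrib right_diff_distrib mult_scaleC_left
        mult_scaleC_right scaleC_scaleC complex_vector.scale_right_diff_distrib by simp
    moreover have "star x * x \<in> S" "star x * y \<in> S" "star y * x \<in> S" "star y * y \<in> S" using x y U by simp_all
    ultimately have "F (star z * z) = (of_real Q - c * cnj w) - (cnj c * w - cnj c * c * of_real P)"
      using U normalized_functionalD(2,6) fx fy fxy by (simp add: w_P_Q_def(1))
    moreover have "cnj w * w = of_real ((cmod w)\<^sup>2)" "w * cnj w = of_real ((cmod w)\<^sup>2)"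
      using complex_norm_square[of w] by (simp_all add: mult.commute)
    moreover have "(of_real Q - c * cnj w) - (cnj c * w - cnj c * c * of_real P) =
        of_real Q - of_real r * (w * cnj w) - of_real r * (cnj w * w) + (of_real r)\<^sup>2 * (cnj w * w) * of_real P"
      by (simp add: c_def power2_eq_square algebra_simps)
    ultimately have "F (star z * z) = of_real (Q - 2 * r * (cmod w)\<^sup>2 + r\<^sup>2 * (cmod w)\<^sup>2 * P)"
      by simp
    then show ?thesis using normalized_functional_square(1)[OF zS] by simp
  qed
  show ?thesis
  proof (cases "P = 0")
    case True
    have "(cmod w)\<^sup>2 = 0"
    proof (rule ccontr)
      assume "(cmod w)\<^sup>2 \<noteq> 0"
      then show False using main[of "(Q + 1) / (2 * (cmod w)\<^sup>2)"] True by simp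
    qed
    then show ?thesis using True by (simp add: w_P_Q_def)
  next
    case False
    then have "0 \<le> Q - (cmod w)\<^sup>2 / P" using main[of "1 / P"] by (simp add: power2_eq_square)
    then show ?thesis using False PQ by (simp add: w_P_Q_def(1)[symmetric] field_simps flip: w_P_Q_def(2,3))
  qed
qed

end

lemma dual_norm_bdd_above:
  assumes "\<phi> \<in> dual_space M"
  shows "bdd_above ((\<lambda>x. cmod (\<phi> x)) ` {x \<in> M. norm x \<le> 1})"
proof -
  obtain K where K: "\<forall>x\<in>M. cmod (\<phi> x) \<le> K * norm x" using assms by (auto simp: dual_space_def)
  show ?thesis
  proof (rule bdd_aboveI2)
    fix x assume "x \<in> {x \<in> M. norm x \<le> 1}"
    then have "cmod (\<phi> x) \<le> K * norm x" "norm x \<le> 1" using K by auto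
    moreover have "K * norm x \<le> \<bar>K\<bar> * 1" using calculation(2) by (intro mult_mono) auto
    ultimately show "cmod (\<phi> x) \<le> \<bar>K\<bar>" by simp
  qed
qed

lemma norm_le_dual_norm:
  assumes M: "csubspace M" and \<phi>: "\<phi> \<in> dual_space M" and x: "x \<in> M"
  shows "cmod (\<phi> x) \<le> dual_norm M \<phi> * norm x"
proof (cases "x = 0")
  case True
  then show ?thesis using linear_on_subspace(4)[OF M, of \<phi>] \<phi> by (auto simp: dual_space_def)
next
  case False
  define y where "y = of_real (1 / norm x) *\<^sub>C x"
  have y: "y \<in> M" "norm y \<le> 1"
    using complex_vector.subspace_scale[OF M x] False by (simp_all add: y_def norm_scaleC norm_divide)
  have "cmod (\<phi> y) \<le> dual_norm M \<phi>" unfolding dual_norm_def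
    by (rule cSUP_upper[OF _ dual_norm_bdd_above[OF \<phi>]]) (use y in simp)
  moreover have "\<phi> y = of_real (1 / norm x) * \<phi> x"
    using \<phi> x unfolding y_def dual_space_def by blast
  ultimately show ?thesis using False by (simp add: norm_mult norm_divide field_simps)
qed

lemma dual_norm_le:
  assumes "csubspace M" "\<And>x. x \<in> M \<Longrightarrow> norm x \<le> 1 \<Longrightarrow> cmod (\<phi> x) \<le> B"
  shows "dual_norm M \<phi> \<le> B"
  unfolding dual_norm_def
  by (rule cSUP_least) (use assms complex_vector.subspace_0[OF assms(1)] in \<open>auto intro!: exI[of _ 0]\<close>)

lemma states_iff_normalized_functional:
  fixes S :: "'a::cstar_algebra set"
  assumes S: "cstar_subalgebra S" "1 \<in> S"
  shows "f \<in> states S \<and> f 1 = 1 \<longleftrightarrow> f \<in> extensional S \<and> normalized_functional S f"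
proof
  have sub: "csubspace S" using S by (simp add: cstar_subalgebra_def)
  assume f: "f \<in> states S \<and> f 1 = 1"
  then have d: "f \<in> dual_space S" "dual_norm S f = 1" by (auto simp: states_def)
  then show "f \<in> extensional S \<and> normalized_functional S f"
    using norm_le_dual_norm[OF sub d(1)] f by (auto simp: normalized_functional_def dual_space_def)
next
  have sub: "csubspace S" using S by (simp add: cstar_subalgebra_def)
  assume f: "f \<in> extensional S \<and> normalized_functional S f"
  then have nf: "normalized_functional S f" by simp
  note D = normalized_functionalD[OF S nf]
  have ds: "f \<in> dual_space S"
    using f by (auto simp: dual_space_def normalized_functional_def intro!: exI[of _ 1])
  have "dual_norm S f \<le> 1" using D(3) by (intro dual_norm_le[OF sub]) (meson order_trans)
  moreover have "1 \<le> dual_norm S f" using norm_le_dual_norm[OF sub ds S(2)] D(4) by simp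
  moreover have "f (star a * a) \<in> \<real>\<^sub>\<ge>\<^sub>0" if "a \<in> S" for a
    by (subst normalized_functional_square(2)[OF S nf that])
      (simp only: nonneg_Reals_of_real_iff normalized_functional_square(1)[OF S nf that])
  ultimately have "f \<in> states S"
    unfolding states_def using ds by (intro CollectI conjI ballI antisym)
  then show "f \<in> states S \<and> f 1 = 1" using D(4) by (intro conjI)
qed

section \<open>Characters and their state extensions\<close>

locale regular_inclusion =
  fixes D :: "'a::cstar_algebra set"
  assumes regular_inclusion: "regular_cstar_inclusion D"
begin

lemma D_subalgebra: "cstar_subalgebra D"
  and D_commute: "x \<in> D \<Longrightarrow> y \<in> D \<Longrightarrow> x * y = y * x"
  and one_in_D [simp]: "1 \<in> D"
  and D_extension: "extension_property D"
  and regular_UNIV: "closure (cspan (normalizers D UNIV)) = UNIV"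
  using regular_inclusion
  by (auto simp: regular_cstar_inclusion_def maximal_abelian_cstar_subalgebra_def
      abelian_cstar_subalgebra_def regular_subspace_def)

lemmas D_closed [simp] = cstar_subalgebraD(1-8)[OF D_subalgebra]
  cstar_subalgebraD(10)[OF D_subalgebra one_in_D]

definition character :: "('a \<Rightarrow> complex) \<Rightarrow> bool"
  where "character \<sigma> \<longleftrightarrow> \<sigma> \<in> extensional D \<and> normalized_functional D \<sigma> \<and>
    (\<forall>x\<in>D. \<forall>y\<in>D. \<sigma> (x * y) = \<sigma> x * \<sigma> y)"

lemma character_mult: "character \<sigma> \<Longrightarrow> x \<in> D \<Longrightarrow> y \<in> D \<Longrightarrow> \<sigma> (x * y) = \<sigma> x * \<sigma> y"
  and character_normalized: "character \<sigma> \<Longrightarrow> normalized_functional D \<sigma>"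
  by (simp_all add: character_def)

lemmas characterD = normalized_functionalD[OF D_subalgebra one_in_D character_normalized]

lemma character_star: "character \<sigma> \<Longrightarrow> x \<in> D \<Longrightarrow> \<sigma> (star x) = cnj (\<sigma> x)"
  by (rule normalized_functional_star[OF D_subalgebra one_in_D character_normalized])

lemma character_star_mult: "character \<sigma> \<Longrightarrow> x \<in> D \<Longrightarrow> \<sigma> (star x * x) = of_real ((cmod (\<sigma> x))\<^sup>2)"
  by (simp only: character_mult character_star D_closed mult.commute[of "cnj _"] complex_norm_square)

text \<open>
If \<open>\<sigma>\<close> vanishes at \<open>a\<close>, it vanishes at \<open>star a * a\<close>; there \<open>g\<close> and \<open>h\<close> are nonnegative, so both
vanish, and the Cauchy-Schwarz inequality gives \<open>g a = 0\<close>. Thus \<open>g\<close> vanishes on the kernel of \<open>\<sigma>\<close>.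
\<close>

lemma convex_component_of_character:
  assumes \<sigma>: "character \<sigma>" and g: "g \<in> states D" and h: "h \<in> states D"
    and t: "0 < t" "t < 1" and eq: "\<forall>a\<in>D. \<sigma> a = of_real t * g a + of_real (1 - t) * h a"
  shows "g = \<sigma>"
proof -
  have sub: "csubspace D" using D_subalgebra by (simp add: cstar_subalgebra_def)
  have Re1: "Re (g 1) \<le> 1" "Re (h 1) \<le> 1" and cg: "cmod (g 1) \<le> 1"
  proof -
    have "cmod (f 1) \<le> 1" if "f \<in> states D" for f
      using norm_le_dual_norm[OF sub, of f 1] that by (simp add: states_def)
    then show "Re (g 1) \<le> 1" "Re (h 1) \<le> 1" "cmod (g 1) \<le> 1"
      using g h complex_Re_le_cmod order_trans by blast+
  qed
  \<comment> \<open>The values \<open>g 1\<close> and \<open>h 1\<close> lie in the unit disc, and 1 is an extreme point of it.\<close>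
  have "t * Re (g 1) + (1 - t) * Re (h 1) = 1"
    using eq[rule_format, OF one_in_D] characterD(4)[OF \<sigma>] by (simp add: complex_eq_iff)
  moreover have "(1 - t) * Re (h 1) \<le> (1 - t) * 1" using t Re1 by (intro mult_left_mono) auto
  ultimately have "t * 1 \<le> t * Re (g 1)" by simp
  then have "1 \<le> Re (g 1)" using t by (simp only: mult_le_cancel_left_pos)
  then have rg: "Re (g 1) = 1" using Re1 by simp
  then have "(Im (g 1))\<^sup>2 \<le> 0" using cg by (simp add: cmod_def)
  then have g1: "g 1 = 1" using rg by (simp add: complex_eq_iff)
  have ng: "normalized_functional D g" and eg: "g \<in> extensional D"
    using states_iff_normalized_functional[OF D_subalgebra one_in_D, of g] g g1 by auto
  have kernel: "g a = 0" if a: "a \<in> D" "\<sigma> a = 0" for a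
  proof -
    have pos: "0 \<le> Re (f (star a * a))" if "f \<in> states D" for f
      using that a(1) by (auto simp: states_def complex_nonneg_Reals_iff)
    have "t * Re (g (star a * a)) + (1 - t) * Re (h (star a * a)) = 0"
      using eq[rule_format, of "star a * a"] a character_star_mult[OF \<sigma> a(1)] by (simp add: complex_eq_iff)
    moreover have "0 \<le> (1 - t) * Re (h (star a * a))" using pos[OF h] t by simp
    moreover have "0 \<le> t * Re (g (star a * a))" using pos[OF g] t by simp
    ultimately have "t * Re (g (star a * a)) = 0" by linarith
    then have "Re (g (star a * a)) = 0" using t by simp
    then have "(cmod (g (star 1 * a)))\<^sup>2 \<le> 0"
      using normalized_functional_Cauchy_Schwarz[OF D_subalgebra one_in_D ng a(1) one_in_D] by simp
    then show ?thesis by simp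
  qed
  show ?thesis
  proof (rule extensionalityI[OF eg])
    show "\<sigma> \<in> extensional D" using \<sigma> by (simp add: character_def)
    fix d assume d: "d \<in> D"
    have "g (d - \<sigma> d *\<^sub>C 1) = 0"
      using d characterD[OF \<sigma>] by (intro kernel) simp_all
    then show "g d = \<sigma> d"
      using normalized_functionalD[OF D_subalgebra one_in_D ng] d by simp
  qed
qed

lemma character_pure: "character \<sigma> \<Longrightarrow> \<sigma> \<in> pure_states D"
  unfolding pure_states_def
proof (intro CollectI conjI ballI allI impI)
  assume \<sigma>: "character \<sigma>"
  then show "\<sigma> \<in> states D"
    using states_iff_normalized_functional[OF D_subalgebra one_in_D, of \<sigma>] by (auto simp: character_def)
  fix g h and t :: real assume gh: "g \<in> states D" "h \<in> states D"
    and t: "0 < t \<and> t < 1 \<and> (\<forall>a\<in>D. \<sigma> a = of_real t * g a + of_real (1 - t) * h a)"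
  show "g = \<sigma>" using t by (intro convex_component_of_character[OF \<sigma> gh, of t]) auto
  show "h = \<sigma>" using t by (intro convex_component_of_character[OF \<sigma> gh(2,1), of "1 - t"]) auto
qed

definition state_ext :: "('a \<Rightarrow> complex) \<Rightarrow> 'a \<Rightarrow> complex"
  where "state_ext \<sigma> = (THE g. normalized_functional UNIV g \<and> (\<forall>d\<in>D. g d = \<sigma> d))"

lemma state_ext_ex1:
  assumes \<sigma>: "character \<sigma>"
  shows "\<exists>!g. normalized_functional UNIV g \<and> (\<forall>d\<in>D. g d = \<sigma> d)"
proof -
  have "g \<in> states UNIV \<and> restrict g D = \<sigma> \<longleftrightarrow>
      normalized_functional UNIV g \<and> (\<forall>d\<in>D. g d = \<sigma> d)" for g
  proof -
    have "restrict g D = \<sigma> \<longleftrightarrow> (\<forall>d\<in>D. g d = \<sigma> d)"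
      using \<sigma> by (auto simp: character_def extensional_def fun_eq_iff restrict_def)
    moreover have "g 1 = 1" if "\<forall>d\<in>D. g d = \<sigma> d"
      using bspec[OF that one_in_D] characterD(4)[OF \<sigma>] by simp
    moreover have "g \<in> states UNIV \<and> g 1 = 1 \<longleftrightarrow> normalized_functional UNIV g"
      using states_iff_normalized_functional[OF cstar_subalgebra_UNIV UNIV_I, of g]
      by (simp only: extensional_UNIV UNIV_I simp_thms)
    ultimately show ?thesis by argo
  qed
  note eq = this
  have "\<exists>!g. g \<in> states UNIV \<and> restrict g D = \<sigma>"
    by (rule bspec[OF conjunct1[OF D_extension[unfolded extension_property_def]] character_pure[OF \<sigma>]])
  then show ?thesis by (simp only: eq)
qed

lemma normalized_state_ext: "character \<sigma> \<Longrightarrow> normalized_functional UNIV (state_ext \<sigma>)"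
  and state_ext_D: "character \<sigma> \<Longrightarrow> d \<in> D \<Longrightarrow> state_ext \<sigma> d = \<sigma> d"
  and state_ext_unique: "character \<sigma> \<Longrightarrow> normalized_functional UNIV g \<Longrightarrow>
    (\<And>d. d \<in> D \<Longrightarrow> g d = \<sigma> d) \<Longrightarrow> state_ext \<sigma> = g"
  using theI'[OF state_ext_ex1, of \<sigma>] the1_equality[OF state_ext_ex1, of \<sigma> g]
  by (auto simp: state_ext_def)

lemmas state_extD =
  normalized_functionalD[OF cstar_subalgebra_UNIV UNIV_I normalized_state_ext, simplified]

lemmas state_ext_Cauchy_Schwarz = normalized_functional_Cauchy_Schwarz
  [OF cstar_subalgebra_UNIV UNIV_I normalized_state_ext UNIV_I UNIV_I]

text \<open>
The elements of \<open>D\<close> lie in the multiplicative domain of the extension: for \<open>e = d - \<sigma> d\<close> it vanishes at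
\<open>star e * e\<close>, hence at every product \<open>x * e\<close> by the Cauchy-Schwarz inequality.
\<close>

lemma state_ext_mult_right:
  assumes \<sigma>: "character \<sigma>" and d: "d \<in> D"
  shows "state_ext \<sigma> (x * d) = state_ext \<sigma> x * \<sigma> d"
proof -
  define e where "e = d - \<sigma> d *\<^sub>C 1"
  have e: "e \<in> D" "\<sigma> e = 0" using d characterD[OF \<sigma>] by (simp_all add: e_def)
  have "state_ext \<sigma> (star e * e) = 0"
    using state_ext_D[OF \<sigma>, of "star e * e"] character_star_mult[OF \<sigma> e(1)] e by simp
  then have "(cmod (state_ext \<sigma> (star (star x) * e)))\<^sup>2 \<le> 0"
    using state_ext_Cauchy_Schwarz[OF \<sigma>, of "star x" e] by simp
  then have "state_ext \<sigma> (x * e) = 0" by (simp add: star_star)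
  moreover have "x * e = x * d - \<sigma> d *\<^sub>C x"
    by (simp add: e_def right_diff_distrib mult_scaleC_right)
  ultimately show ?thesis using state_extD[OF \<sigma>] by simp
qed

section \<open>Order approximation of the state extension\<close>

text \<open>
Taking the self-adjoint part of \<open>x\<close> makes the functional sublinear on the whole algebra, regarded as a
real vector space, so that Hahn-Banach needs no separate space of self-adjoint elements.
\<close>

definition upper_approx :: "('a \<Rightarrow> complex) \<Rightarrow> 'a \<Rightarrow> real"
  where "upper_approx \<sigma> x =
    (INF b\<in>{b \<in> D. star b = b \<and> positive (b - (1/2) *\<^sub>R (x + star x))}. Re (\<sigma> b))"

lemma Re_state_ext_le:
  assumes \<sigma>: "character \<sigma>" and b: "b \<in> D" "positive (b - x)"
  shows "Re (state_ext \<sigma> x) \<le> Re (\<sigma> b)"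
proof -
  have "0 \<le> Re (state_ext \<sigma> (b - x))"
    by (rule normalized_functional_positive[OF cstar_subalgebra_UNIV UNIV_I normalized_state_ext[OF \<sigma>] UNIV_I b(2)])
  then show ?thesis using state_extD(6)[OF \<sigma>, of b x] state_ext_D[OF \<sigma> b(1)] by simp
qed

lemma upper_approx_le:
  assumes \<sigma>: "character \<sigma>" and b: "b \<in> D" "star b = b" "positive (b - (1/2) *\<^sub>R (x + star x))"
  shows "upper_approx \<sigma> x \<le> Re (\<sigma> b)"
  unfolding upper_approx_def
proof (rule cINF_lower)
  show "bdd_below ((\<lambda>b. Re (\<sigma> b)) ` {b \<in> D. star b = b \<and> positive (b - (1/2) *\<^sub>R (x + star x))})"
  proof (rule bdd_belowI2)
    fix a assume "a \<in> {b \<in> D. star b = b \<and> positive (b - (1/2) *\<^sub>R (x + star x))}"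
    then show "Re (state_ext \<sigma> ((1/2) *\<^sub>R (x + star x))) \<le> Re (\<sigma> a)"
      by (intro Re_state_ext_le[OF \<sigma>]) simp_all
  qed
qed (simp add: b)

lemma upper_approx_le_norm:
  assumes \<sigma>: "character \<sigma>"
  shows "upper_approx \<sigma> x \<le> norm x"
    and "{b \<in> D. star b = b \<and> positive (b - (1/2) *\<^sub>R (x + star x))} \<noteq> {}"
proof -
  have "norm (x + star x) \<le> 2 * norm x"
    using norm_triangle_ineq[of x "star x"] by (simp add: norm_star)
  then have p: "positive (of_real (norm x) - (1/2) *\<^sub>R (x + star x))"
    by (intro positive_of_real_diff) (simp_all add: star_simps add.commute)
  show "upper_approx \<sigma> x \<le> norm x"
    using upper_approx_le[OF \<sigma> _ _ p] characterD(9)[OF \<sigma>, of "norm x"] by simp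
  have "of_real (norm x) \<in> {b \<in> D. star b = b \<and> positive (b - (1/2) *\<^sub>R (x + star x))}"
    using p by simp
  then show "{b \<in> D. star b = b \<and> positive (b - (1/2) *\<^sub>R (x + star x))} \<noteq> {}" by blast
qed

lemma upper_approx_greatest:
  assumes \<sigma>: "character \<sigma>" and "\<And>b. b \<in> D \<Longrightarrow> star b = b \<Longrightarrow>
    positive (b - (1/2) *\<^sub>R (x + star x)) \<Longrightarrow> c \<le> Re (\<sigma> b)"
  shows "c \<le> upper_approx \<sigma> x"
  unfolding upper_approx_def
  by (rule cINF_greatest[OF upper_approx_le_norm(2)[OF \<sigma>]])
    (elim CollectE conjE, rule assms(2))

lemma sublinear_upper_approx:
  assumes \<sigma>: "character \<sigma>"
  shows "sublinear (upper_approx \<sigma>)"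
proof (rule sublinearI_le)
  let ?u = "upper_approx \<sigma>"
  let ?H = "\<lambda>x. (1/2) *\<^sub>R (x + star x)"
  fix x y
  have "?u (x + y) \<le> Re (\<sigma> a) + Re (\<sigma> b)"
    if a: "a \<in> D" "star a = a" "positive (a - ?H x)" and b: "b \<in> D" "star b = b" "positive (b - ?H y)" for a b
  proof -
    have "(a + b) - ?H (x + y) = (a - ?H x) + (b - ?H y)"
      unfolding star_add scaleR_add_right by simp
    then have "positive ((a + b) - ?H (x + y))" using positive_add[OF a(3) b(3)] by (simp only:)
    from upper_approx_le[OF \<sigma> _ _ this] show ?thesis
      using a b characterD(1)[OF \<sigma>] by (simp add: star_add)
  qed
  then have "?u (x + y) - Re (\<sigma> b) \<le> ?u x" if "b \<in> D" "star b = b" "positive (b - ?H y)" for b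
    using that by (intro upper_approx_greatest[OF \<sigma>]) (simp add: algebra_simps)
  then have "?u (x + y) - ?u x \<le> ?u y"
    by (intro upper_approx_greatest[OF \<sigma>]) (simp add: algebra_simps)
  then show "?u (x + y) \<le> ?u x + ?u y" by simp
next
  let ?u = "upper_approx \<sigma>"
  let ?H = "\<lambda>x. (1/2) *\<^sub>R (x + star x)"
  fix r :: real and x assume r: "0 < r"
  have "?u (r *\<^sub>R x) / r \<le> ?u x"
  proof (rule upper_approx_greatest[OF \<sigma>])
    fix b assume b: "b \<in> D" "star b = b" "positive (b - ?H x)"
    have "r *\<^sub>R b - ?H (r *\<^sub>R x) = r *\<^sub>R (b - ?H x)"
      by (simp add: star_scaleR scaleR_diff_right scaleR_add_right mult.commute)
    then have "positive (r *\<^sub>R b - ?H (r *\<^sub>R x))" using positive_scaleR[OF b(3)] r by simp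
    from upper_approx_le[OF \<sigma> _ _ this] have "?u (r *\<^sub>R x) \<le> r * Re (\<sigma> b)"
      using b characterD(7)[OF \<sigma>] by (simp add: star_scaleR)
    then show "?u (r *\<^sub>R x) / r \<le> Re (\<sigma> b)" using r by (simp add: field_simps)
  qed
  then show "?u (r *\<^sub>R x) \<le> r * ?u x" using r by (simp add: field_simps)
next
  have "positive (0 - (1/2) *\<^sub>R (0 + star 0) :: 'a)"
    unfolding positive_def by (auto intro: exI[of _ 0])
  then have "upper_approx \<sigma> 0 \<le> Re (\<sigma> 0)" by (intro upper_approx_le[OF \<sigma>]) simp_all
  moreover have "0 \<le> upper_approx \<sigma> 0"
  proof (rule upper_approx_greatest[OF \<sigma>])
    fix b assume "b \<in> D" "positive (b - (1 / 2) *\<^sub>R (0 + star 0))"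
    then show "0 \<le> Re (\<sigma> b)"
      using Re_state_ext_le[OF \<sigma>, of b 0] state_extD(8)[OF \<sigma>] by simp
  qed
  ultimately show "upper_approx \<sigma> 0 = 0" using characterD(8)[OF \<sigma>] by simp
qed

text \<open>
A real linear functional dominated by \<open>upper_approx \<sigma>\<close> that agrees with it at \<open>z\<close> is the real
part of a complex linear functional, which is normalized and restricts to \<open>\<sigma>\<close>. By the extension
property it is the state extension.
\<close>

lemma Re_state_ext_eq_upper_approx:
  assumes \<sigma>: "character \<sigma>"
  shows "Re (state_ext \<sigma> z) = upper_approx \<sigma> z"
proof -
  let ?u = "upper_approx \<sigma>"
  obtain f where f: "linear f" "\<And>x. f x \<le> ?u x" "f z = ?u z"
    using Hahn_Banach_sublinear[OF sublinear_upper_approx[OF \<sigma>]] by blast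
  \<comment> \<open>The complex linear functional with real part \<open>f\<close>.\<close>
  define F where "F x = Complex (f x) (- f (\<i> *\<^sub>C x))" for x
  have fD: "f d = Re (\<sigma> d)" if d: "d \<in> D" for d
  proof -
    have le: "f d \<le> Re (\<sigma> d)" if d: "d \<in> D" for d
    proof -
      let ?h = "(1/2) *\<^sub>R (d + star d)"
      have "positive (?h - ?h)" unfolding positive_def by (auto intro: exI[of _ 0])
      then have "?u d \<le> Re (\<sigma> ?h)"
        using d by (intro upper_approx_le[OF \<sigma>]) (simp_all add: star_simps add.commute)
      moreover have "\<sigma> ?h = of_real (1/2) * (\<sigma> d + cnj (\<sigma> d))"
        using characterD(7)[OF \<sigma>, of "d + star d" "1/2"] characterD(1)[OF \<sigma>, of d "star d"] character_star[OF \<sigma> d] d by simp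
      then have "Re (\<sigma> ?h) = Re (of_real (1/2) * (\<sigma> d + cnj (\<sigma> d)))" by (rule arg_cong)
      then have "Re (\<sigma> ?h) = Re (\<sigma> d)" by simp
      ultimately show ?thesis using f(2)[of d] by simp
    qed
    show ?thesis
      using le[OF d] le[of "- d"] d characterD(5)[OF \<sigma> d] linear_neg[OF f(1), of d] by simp
  qed
  have scale: "F (c *\<^sub>C x) = c * F x" for c x
  proof -
    have sc: "c *\<^sub>C x = Re c *\<^sub>R x + Im c *\<^sub>R (\<i> *\<^sub>C x)" for x
      by (simp add: scaleC_scaleC flip: scaleC_of_real scaleC_add_left)
        (metis complex_eq mult.commute)
    have "f (c *\<^sub>C x) = Re c * f x + Im c * f (\<i> *\<^sub>C x)" for x
      unfolding sc linear_add[OF f(1)] linear_cmul[OF f(1)] by simp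
    note lin = this
    have "\<i> *\<^sub>C c *\<^sub>C x = c *\<^sub>C \<i> *\<^sub>C x" by (simp add: scaleC_scaleC mult.commute)
    moreover have "\<i> *\<^sub>C \<i> *\<^sub>C x = - x" by (simp add: scaleC_scaleC complex_vector.scale_minus_left)
    ultimately have "f (\<i> *\<^sub>C c *\<^sub>C x) = Re c * f (\<i> *\<^sub>C x) - Im c * f x"
      using lin[of "\<i> *\<^sub>C x"] linear_neg[OF f(1), of x] by (simp only:)
    then show ?thesis
      unfolding F_def complex_eq_iff using lin[of x] by simp
  qed
  have "normalized_functional UNIV F"
    unfolding normalized_functional_def
  proof (intro conjI ballI allI)
    show "F (x + y) = F x + F y" for x y
      by (simp add: F_def complex_eq_iff scaleC_add_right linear_add[OF f(1)])
    show "F (c *\<^sub>C x) = c * F x" for c x by (rule scale)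
    show "cmod (F x) \<le> norm x" for x
    proof (cases "F x = 0")
      case False
      \<comment> \<open>Rotating \<open>x\<close> makes \<open>F\<close> real there, so that the bound on its real part applies.\<close>
      define c where "c = cnj (F x) / of_real (cmod (F x))"
      have "cnj (F x) * F x = of_real (cmod (F x)) * of_real (cmod (F x))"
        using complex_norm_square[of "F x"] by (simp add: power2_eq_square mult.commute)
      then have c: "cmod c = 1" "c * F x = of_real (cmod (F x))"
        using False by (simp_all add: c_def norm_divide)
      have ReF: "Re (F y) = f y" for y by (simp add: F_def)
      have "cmod (F x) = Re (F (c *\<^sub>C x))" by (simp only: scale c(2) Re_complex_of_real)
      then have "cmod (F x) = f (c *\<^sub>C x)" by (simp only: ReF)
      also have "\<dots> \<le> norm x"
        using f(2)[of "c *\<^sub>C x"] upper_approx_le_norm(1)[OF \<sigma>, of "c *\<^sub>C x"] c(1) by (simp add: norm_scaleC)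
      finally show ?thesis .
    qed simp
    show "F 1 = 1"
      using fD[OF one_in_D] fD[of "\<i> *\<^sub>C 1"] characterD(2,4)[OF \<sigma>] by (simp add: F_def complex_eq_iff)
  qed
  moreover have "F d = \<sigma> d" if "d \<in> D" for d
    using fD[OF that] fD[of "\<i> *\<^sub>C d"] characterD(2)[OF \<sigma> that] that by (simp add: F_def complex_eq_iff)
  ultimately have "state_ext \<sigma> = F" by (rule state_ext_unique[OF \<sigma>])
  then show ?thesis using f(3) by (simp add: F_def)
qed

lemma approximation_from_above:
  assumes \<sigma>: "character \<sigma>" and z: "star z = z" and \<epsilon>: "0 < \<epsilon>"
  obtains b where "b \<in> D" "star b = b" "positive (b - z)" "Re (\<sigma> b) < Re (state_ext \<sigma> z) + \<epsilon>"
proof -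
  let ?B = "{b \<in> D. star b = b \<and> positive (b - (1/2) *\<^sub>R (z + star z))}"
  have "upper_approx \<sigma> z < Re (state_ext \<sigma> z) + \<epsilon>"
    using Re_state_ext_eq_upper_approx[OF \<sigma>, of z] \<epsilon> by linarith
  then have lt: "Inf ((\<lambda>b. Re (\<sigma> b)) ` ?B) < Re (state_ext \<sigma> z) + \<epsilon>"
    unfolding upper_approx_def .
  have "(\<lambda>b. Re (\<sigma> b)) ` ?B \<noteq> {}"
    using upper_approx_le_norm(2)[OF \<sigma>, of z] by (simp only: image_is_empty not_False_eq_True)
  from cInf_lessD[OF this lt] obtain r
    where r: "r \<in> (\<lambda>b. Re (\<sigma> b)) ` ?B" "r < Re (state_ext \<sigma> z) + \<epsilon>" by (rule bexE)
  from r(1) obtain b where b: "b \<in> ?B" "r = Re (\<sigma> b)" by (rule imageE)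
  have "(1/2) *\<^sub>R (z + star z) = z" by (simp add: z)
  then show thesis using b r(2) by (intro that[of b]) simp_all
qed

section \<open>Compression to a point\<close>

text \<open>
Viewed as functions on the spectrum of \<open>D\<close>, these are the real functions bounded by 1 that take the value
1 at \<open>\<sigma>\<close>. Products of peaks are peaks, so finitely many approximations can be achieved by one peak.
\<close>

definition peaks :: "('a \<Rightarrow> complex) \<Rightarrow> 'a set"
  where "peaks \<sigma> = {d \<in> D. star d = d \<and> norm d \<le> 1 \<and> \<sigma> d = 1}"

lemma peaksD: "d \<in> peaks \<sigma> \<Longrightarrow> d \<in> D" "d \<in> peaks \<sigma> \<Longrightarrow> star d = d" "d \<in> peaks \<sigma> \<Longrightarrow> norm d \<le> 1"
  "d \<in> peaks \<sigma> \<Longrightarrow> \<sigma> d = 1"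
  by (simp_all add: peaks_def)

lemma norm_mult_contraction_right: "norm d \<le> 1 \<Longrightarrow> norm (x * d) \<le> norm (x::'b::real_normed_algebra)"
  and norm_mult_contraction_left: "norm d \<le> 1 \<Longrightarrow> norm (d * x) \<le> norm (x::'b::real_normed_algebra)"
proof -
  assume d: "norm d \<le> 1"
  have "norm (x * d) \<le> norm x * norm d" by (rule norm_mult_ineq)
  also have "\<dots> \<le> norm x" using d by (simp add: mult_left_le)
  finally show "norm (x * d) \<le> norm x" .
next
  assume d: "norm d \<le> 1"
  have "norm (d * x) \<le> norm d * norm x" by (rule norm_mult_ineq)
  also have "\<dots> \<le> norm x" using d by (simp add: mult_left_le_one_le)
  finally show "norm (d * x) \<le> norm x" .
qed

lemma peaks_mult:
  assumes \<sigma>: "character \<sigma>" and d: "d \<in> peaks \<sigma>" and e: "e \<in> peaks \<sigma>"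
  shows "d * e \<in> peaks \<sigma>"
proof -
  note d' = peaksD[OF d] and e' = peaksD[OF e]
  have "star (d * e) = d * e"
    by (simp add: star_mult d'(2) e'(2) D_commute[OF e'(1) d'(1)])
  moreover have "norm (d * e) \<le> 1"
    using norm_mult_contraction_right[OF e'(3), of d] d'(3) by simp
  moreover have "\<sigma> (d * e) = 1"
    by (simp add: character_mult[OF \<sigma> d'(1) e'(1)] d'(4) e'(4))
  ultimately show ?thesis using d'(1) e'(1) by (simp add: peaks_def)
qed

text \<open>
With \<open>h = star a * a\<close>, the element \<open>d = \<delta> / (\<delta> + h)\<close> is a contraction because \<open>h\<close> is positive, and
\<open>h * d = \<delta> (1 - d)\<close> is small. The inverse is a Neumann series, hence an element of \<open>D\<close>.
\<close>

lemma peak_for_kernel: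
  assumes \<sigma>: "character \<sigma>" and a: "a \<in> D" "\<sigma> a = 0" and \<epsilon>: "0 < \<epsilon>"
  obtains d where "d \<in> peaks \<sigma>" "norm (a * d) \<le> \<epsilon>"
proof -
  define h where "h = star a * a"
  define \<delta> where "\<delta> = \<epsilon>\<^sup>2 / 2"
  have \<delta>: "0 < \<delta>" using \<epsilon> by (simp add: \<delta>_def)
  have h: "h \<in> D" "star h = h" "\<sigma> h = 0"
    using a character_star_mult[OF \<sigma> a(1)] by (simp_all add: h_def star_mult star_star)
  obtain T where T: "norm (of_real T - h) \<le> T"
    using positive_star_mult_self[of a] by (auto simp: positive_def h_def)
  then have T0: "0 \<le> T" using norm_ge_zero order_trans by blast
  define y where "y = (1 / (T + \<delta>)) *\<^sub>R (of_real T - h)"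
  have yD: "y \<in> D" using h by (simp add: y_def)
  have sy: "star y = y" by (simp add: y_def star_scaleR star_diff h)
  have ny: "norm y \<le> T / (T + \<delta>)" using T T0 \<delta> by (simp add: y_def divide_right_mono)
  also have "\<dots> < 1" using T0 \<delta> by simp
  finally have ny1: "norm y < 1" .
  define G where "G = (\<Sum>n. y ^ n)"
  have sG: "summable (\<lambda>n. y ^ n)" by (rule complete_algebra_summable_geometric[OF ny1])
  have GD: "G \<in> D"
  proof -
    have pw: "y ^ n \<in> D" for n by (induction n) (simp_all add: yD)
    have "(\<Sum>n<N. y ^ n) \<in> D" for N by (induction N) (simp_all add: pw)
    then show ?thesis
      using closed_sequentially[OF cstar_subalgebraD(9)[OF D_subalgebra] _ summable_LIMSEQ[OF sG]]
      unfolding G_def by blast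
  qed
  have stG: "star G = G"
    unfolding G_def by (subst bounded_linear.suminf[OF star_bounded_linear sG])
      (simp only: star_power sy)
  have "G = 1 + y * G"
    using suminf_split_head[OF sG] suminf_mult[OF sG, of y] by (simp add: G_def)
  moreover have y1: "(T + \<delta>) *\<^sub>R y = of_real T - h" using T0 \<delta> by (simp add: y_def)
  ultimately have "(T + \<delta>) *\<^sub>R G = of_real (T + \<delta>) + (of_real T - h) * G"
    by (metis mult_scaleR_left of_real_def scaleR_add_right)
  moreover have "(T + \<delta>) *\<^sub>R G = of_real T * G + \<delta> *\<^sub>R G" by (simp add: scaleR_add_left of_real_def)
  ultimately have hG: "h * G = of_real (T + \<delta>) - \<delta> *\<^sub>R G" by (simp add: left_diff_distrib)
  have nG: "norm G \<le> (T + \<delta>) / \<delta>"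
  proof -
    have "norm G \<le> (\<Sum>n. norm y ^ n)"
      unfolding G_def by (rule norm_suminf_le) (use ny1 in \<open>simp_all add: norm_power_ineq summable_geometric\<close>)
    also have "\<dots> = 1 / (1 - norm y)" using ny1 by (simp add: suminf_geometric)
    also have "\<dots> \<le> 1 / (1 - T / (T + \<delta>))" using ny ny1 T0 \<delta> by (intro divide_left_mono mult_pos_pos) auto
    also have "\<dots> = (T + \<delta>) / \<delta>" using T0 \<delta> by (simp add: field_simps)
    finally show ?thesis .
  qed
  define d where "d = (\<delta> / (T + \<delta>)) *\<^sub>R G"
  have dD: "d \<in> D" using GD by (simp add: d_def)
  have std: "star d = d" by (simp add: d_def star_scaleR stG)
  have nd: "norm d \<le> 1"
    using mult_left_mono[OF nG, of "\<delta> / (T + \<delta>)"] T0 \<delta> by (simp add: d_def)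
  have hd: "h * d = \<delta> *\<^sub>R (1 - d)"
  proof -
    have "h * d = (\<delta> / (T + \<delta>)) *\<^sub>R (of_real (T + \<delta>) - \<delta> *\<^sub>R G)"
      by (simp only: d_def mult_scaleR_right hG)
    also have "\<dots> = \<delta> *\<^sub>R (1 - d)"
      using T0 \<delta> by (simp add: scaleR_diff_right d_def of_real_def mult.commute flip: scaleR_add_left)
    finally show ?thesis .
  qed
  have "of_real 0 = of_real \<delta> * (1 - \<sigma> d)"
    using arg_cong[OF hd, of \<sigma>] character_mult[OF \<sigma> h(1) dD] h(3) characterD(7)[OF \<sigma>, of "1 - d"]
      characterD(6)[OF \<sigma>, of 1 d] characterD(4)[OF \<sigma>] dD by simp
  then have "\<sigma> d = 1" using \<delta> by simp
  then have peak: "d \<in> peaks \<sigma>" using dD std nd by (simp add: peaks_def)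
  have "(norm (a * d))\<^sup>2 = norm (d * (h * d))"
    using norm_mult_self_adjoint_right[OF std, of a] by (simp only: h_def mult.assoc)
  also have "\<dots> \<le> norm (h * d)" by (rule norm_mult_contraction_left[OF nd])
  also have "\<dots> \<le> \<delta> * 2"
  proof -
    have "norm (1 - d) \<le> 2" using norm_triangle_ineq4[of 1 d] nd by simp
    then show ?thesis using \<delta> by (simp add: hd)
  qed
  also have "\<dots> = \<epsilon>\<^sup>2" by (simp add: \<delta>_def)
  finally have "norm (a * d) \<le> \<epsilon>" by (rule power2_le_imp_le) (rule less_imp_le[OF \<epsilon>])
  with peak show thesis by (rule that)
qed

lemma peak_for_pair:
  assumes \<sigma>: "character \<sigma>" and ab: "a \<in> D" "b \<in> D" and \<epsilon>: "0 < \<epsilon>"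
  obtains d where "d \<in> peaks \<sigma>" "norm ((a - \<sigma> a *\<^sub>C 1) * d) \<le> \<epsilon>" "norm ((b - \<sigma> b *\<^sub>C 1) * d) \<le> \<epsilon>"
proof -
  have k: "c - \<sigma> c *\<^sub>C 1 \<in> D" "\<sigma> (c - \<sigma> c *\<^sub>C 1) = 0" if "c \<in> D" for c
    using that characterD[OF \<sigma>] by simp_all
  obtain d where d: "d \<in> peaks \<sigma>" "norm ((a - \<sigma> a *\<^sub>C 1) * d) \<le> \<epsilon>"
    using peak_for_kernel[OF \<sigma> k[OF ab(1)] \<epsilon>] .
  obtain e where e: "e \<in> peaks \<sigma>" "norm ((b - \<sigma> b *\<^sub>C 1) * e) \<le> \<epsilon>"
    using peak_for_kernel[OF \<sigma> k[OF ab(2)] \<epsilon>] .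
  have de: "d * e = e * d" using peaksD(1) d(1) e(1) D_commute by blast
  show thesis
  proof
    show "d * e \<in> peaks \<sigma>" by (rule peaks_mult[OF \<sigma> d(1) e(1)])
    show "norm ((a - \<sigma> a *\<^sub>C 1) * (d * e)) \<le> \<epsilon>"
      using norm_mult_contraction_right[OF peaksD(3)[OF e(1)], of "(a - \<sigma> a *\<^sub>C 1) * d"] d(2)
      by (simp only: mult.assoc)
    show "norm ((b - \<sigma> b *\<^sub>C 1) * (d * e)) \<le> \<epsilon>"
      unfolding de using norm_mult_contraction_right[OF peaksD(3)[OF d(1)], of "(b - \<sigma> b *\<^sub>C 1) * e"] e(2)
      by (simp only: mult.assoc)
  qed
qed

lemma compression_mult_peak:
  assumes d: "d \<in> peaks \<sigma>" and e: "e \<in> peaks \<sigma>" and le: "norm (d * x * d - s *\<^sub>C (d * d)) \<le> \<epsilon>"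
  shows "norm ((d * e) * x * (d * e) - s *\<^sub>C ((d * e) * (d * e))) \<le> \<epsilon>"
proof -
  have de: "d * e = e * d" using peaksD(1) d e D_commute by blast
  have "(d * e) * x * (d * e) = (e * d) * x * (d * e)" "(d * e) * (d * e) = (e * d) * (d * e)"
    by (simp_all only: de)
  then have "(d * e) * x * (d * e) = e * (d * x * d) * e" "(d * e) * (d * e) = e * (d * d) * e"
    by (simp_all only: mult.assoc)
  then have "(d * e) * x * (d * e) - s *\<^sub>C ((d * e) * (d * e)) = e * (d * x * d - s *\<^sub>C (d * d)) * e"
    by (simp only: right_diff_distrib left_diff_distrib mult_scaleC_left mult_scaleC_right)
  then show ?thesis
    by (simp only:) (intro order_trans[OF norm_mult_contraction_right]
      order_trans[OF norm_mult_contraction_left] le peaksD(3)[OF e])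
qed

text \<open>
Choose \<open>a \<le> z \<le> b\<close> in \<open>D\<close> with \<open>\<sigma> (b - a)\<close> small. If \<open>d\<close> is concentrated where \<open>a\<close> and \<open>b - a\<close> are
nearly equal to their values at \<open>\<sigma>\<close>, then the positive element \<open>d * (z - a) * d\<close> is dominated by the
small element \<open>d * (b - a) * d\<close>.
\<close>

lemma compression_self_adjoint:
  assumes \<sigma>: "character \<sigma>" and z: "star z = z" and \<epsilon>: "0 < \<epsilon>"
  obtains d where "d \<in> peaks \<sigma>" "norm (d * z * d - state_ext \<sigma> z *\<^sub>C (d * d)) \<le> \<epsilon>"
proof -
  \<comment> \<open>The final estimate adds errors \<open>3 \<delta>\<close>, \<open>\<delta>\<close> and \<open>\<delta>\<close>.\<close>
  define \<delta> where "\<delta> = \<epsilon> / 5"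
  have \<delta>: "0 < \<delta>" using \<epsilon> by (simp add: \<delta>_def)
  define e where "e = Re (state_ext \<sigma> z)"
  have ez: "state_ext \<sigma> z = of_real e"
    using normalized_functional_real[OF cstar_subalgebra_UNIV UNIV_I normalized_state_ext[OF \<sigma>] UNIV_I z]
    by (simp add: e_def complex_eq_iff)
  obtain b where b: "b \<in> D" "star b = b" "positive (b - z)" "Re (\<sigma> b) < e + \<delta>"
    using approximation_from_above[OF \<sigma> z \<delta>] unfolding e_def by blast
  have smz: "star (- z) = - z" by (simp add: star_minus z)
  obtain a' where a': "a' \<in> D" "star a' = a'" "positive (a' - (- z))" "Re (\<sigma> a') < - e + \<delta>"
    using approximation_from_above[OF \<sigma> smz \<delta>] state_extD(5)[OF \<sigma>, of z] unfolding e_def by auto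
  \<comment> \<open>An upper approximation of \<open>- z\<close> is the negative of a lower approximation of \<open>z\<close>.\<close>
  define a where "a = - a'"
  have a: "a \<in> D" "star a = a" "positive (z - a)" "e - \<delta> < Re (\<sigma> a)"
    using a' characterD(5)[OF \<sigma>, of a'] by (simp_all add: a_def star_minus add.commute)
  have real: "\<sigma> c = of_real (Re (\<sigma> c))" if "c \<in> D" "star c = c" for c
    using character_star[OF \<sigma> that(1)] that(2) by (simp add: complex_eq_iff)
  have "Re (\<sigma> a) \<le> e"
    using a' Re_state_ext_le[OF \<sigma> a'(1,3)] characterD(5)[OF \<sigma>, of a'] state_extD(5)[OF \<sigma>, of z]
    by (simp add: a_def e_def)
  then have sa: "cmod (\<sigma> a - of_real e) \<le> \<delta>"
    using a(4) by (subst real[OF a(1,2)]) (simp flip: of_real_diff)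
  have be: "e \<le> Re (\<sigma> b)" using Re_state_ext_le[OF \<sigma> b(1,3)] by (simp add: e_def)
  define c where "c = b - a"
  have c: "c \<in> D" "star c = c" "\<sigma> c = \<sigma> b - \<sigma> a"
    using a b characterD(6)[OF \<sigma>] by (simp_all add: c_def star_diff)
  have "\<bar>Re (\<sigma> c)\<bar> \<le> 2 * \<delta>"
    using \<open>Re (\<sigma> a) \<le> e\<close> be a(4) b(4) by (simp add: c(3))
  then have sc: "cmod (\<sigma> c) \<le> 2 * \<delta>" by (subst real[OF c(1,2)]) (simp only: norm_of_real)
  obtain d where d: "d \<in> peaks \<sigma>" "norm ((a - \<sigma> a *\<^sub>C 1) * d) \<le> \<delta>" "norm ((c - \<sigma> c *\<^sub>C 1) * d) \<le> \<delta>"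
    using peak_for_pair[OF \<sigma> a(1) c(1) \<delta>] .
  note dd = peaksD[OF d(1)]
  have n1: "norm (d * (z - a) * d) \<le> 3 * \<delta>"
  proof -
    have "positive (d * (z - a) * d)" "positive (d * (b - z) * d)"
      using positive_conjugate[OF a(3), of d] positive_conjugate[OF b(3), of d] by (simp_all add: dd(2))
    moreover have "d * (b - z) * d = d * c * d - d * (z - a) * d"
      by (simp add: c_def left_diff_distrib right_diff_distrib)
    ultimately have "norm (d * (z - a) * d) \<le> norm (d * c * d)" by (metis norm_mono_positive)
    also have "\<dots> \<le> norm (c * d)"
      using norm_mult_contraction_left[OF dd(3), of "c * d"] by (simp add: mult.assoc)
    also have "c * d = (c - \<sigma> c *\<^sub>C 1) * d + \<sigma> c *\<^sub>C d"
      by (simp add: left_diff_distrib mult_scaleC_left)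
    also have "norm \<dots> \<le> \<delta> + 2 * \<delta> * 1"
    proof (rule order_trans[OF norm_triangle_ineq add_mono])
      show "norm (\<sigma> c *\<^sub>C d) \<le> 2 * \<delta> * 1"
        unfolding norm_scaleC using sc dd(3) \<delta> by (intro mult_mono) auto
    qed (rule d(3))
    finally show ?thesis by simp
  qed
  have n2: "norm (d * ((a - \<sigma> a *\<^sub>C 1) * d)) \<le> \<delta>"
    using norm_mult_contraction_left[OF dd(3)] d(2) order_trans by blast
  have n3: "norm ((\<sigma> a - of_real e) *\<^sub>C (d * d)) \<le> \<delta>"
  proof -
    have "norm (d * d) \<le> 1" using norm_mult_contraction_left[OF dd(3), of d] dd(3) by simp
    then have "cmod (\<sigma> a - of_real e) * norm (d * d) \<le> \<delta> * 1" using sa \<delta> by (intro mult_mono) auto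
    then show ?thesis by (simp add: norm_scaleC)
  qed
  have "d * z * d - of_real e *\<^sub>C (d * d) =
      d * (z - a) * d + d * ((a - \<sigma> a *\<^sub>C 1) * d) + (\<sigma> a - of_real e) *\<^sub>C (d * d)"
    by (simp add: left_diff_distrib right_diff_distrib mult_scaleC_left mult_scaleC_right mult.assoc
        complex_vector.scale_left_diff_distrib)
  also have "norm \<dots> \<le> 3 * \<delta> + \<delta> + \<delta>"
    by (intro norm_triangle_mono n1 n2 n3)
  finally have "norm (d * z * d - state_ext \<sigma> z *\<^sub>C (d * d)) \<le> \<epsilon>" by (simp add: ez \<delta>_def)
  with d(1) show thesis by (rule that)
qed

lemma compression:
  assumes \<sigma>: "character \<sigma>" and \<epsilon>: "0 < \<epsilon>"
  obtains d where "d \<in> peaks \<sigma>" "norm (d * x * d - state_ext \<sigma> x *\<^sub>C (d * d)) \<le> \<epsilon>"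
proof -
  obtain p q where pq: "star p = p" "star q = q" "x = p + \<i> *\<^sub>C q" by (rule self_adjoint_parts)
  have \<epsilon>2: "0 < \<epsilon> / 2" using \<epsilon> by simp
  obtain d where d: "d \<in> peaks \<sigma>" "norm (d * p * d - state_ext \<sigma> p *\<^sub>C (d * d)) \<le> \<epsilon> / 2"
    using compression_self_adjoint[OF \<sigma> pq(1) \<epsilon>2] .
  obtain e where e: "e \<in> peaks \<sigma>" "norm (e * q * e - state_ext \<sigma> q *\<^sub>C (e * e)) \<le> \<epsilon> / 2"
    using compression_self_adjoint[OF \<sigma> pq(2) \<epsilon>2] .
  define f where "f = d * e"
  have fe: "f = e * d" unfolding f_def using peaksD(1) d(1) e(1) D_commute by blast
  have 1: "norm (f * p * f - state_ext \<sigma> p *\<^sub>C (f * f)) \<le> \<epsilon> / 2"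
    unfolding f_def by (rule compression_mult_peak[OF d(1) e(1) d(2)])
  have 2: "norm (f * q * f - state_ext \<sigma> q *\<^sub>C (f * f)) \<le> \<epsilon> / 2"
    unfolding fe by (rule compression_mult_peak[OF e(1) d(1) e(2)])
  have "f * x * f - state_ext \<sigma> x *\<^sub>C (f * f) =
      (f * p * f - state_ext \<sigma> p *\<^sub>C (f * f)) + \<i> *\<^sub>C (f * q * f - state_ext \<sigma> q *\<^sub>C (f * f))"
    unfolding pq(3) state_extD(1)[OF \<sigma>] state_extD(2)[OF \<sigma>]
    by (simp add: distrib_left distrib_right mult_scaleC_left mult_scaleC_right
        complex_vector.scale_right_diff_distrib scaleC_scaleC scaleC_add_left)
  also have "norm \<dots> \<le> \<epsilon> / 2 + \<epsilon> / 2"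
    by (rule norm_triangle_mono[OF 1]) (use 2 in \<open>simp add: norm_scaleC\<close>)
  finally have "norm (f * x * f - state_ext \<sigma> x *\<^sub>C (f * f)) \<le> \<epsilon>" by simp
  moreover have "f \<in> peaks \<sigma>" unfolding f_def by (rule peaks_mult[OF \<sigma> d(1) e(1)])
  ultimately show thesis using that by blast
qed

lemma compression_pair:
  assumes \<sigma>: "character \<sigma>" and \<epsilon>: "0 < \<epsilon>"
  obtains d where "d \<in> peaks \<sigma>" "norm (d * x * d - state_ext \<sigma> x *\<^sub>C (d * d)) \<le> \<epsilon>"
    "norm (d * y * d - state_ext \<sigma> y *\<^sub>C (d * d)) \<le> \<epsilon>"
proof -
  obtain d where d: "d \<in> peaks \<sigma>" "norm (d * x * d - state_ext \<sigma> x *\<^sub>C (d * d)) \<le> \<epsilon>"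
    using compression[OF \<sigma> \<epsilon>] .
  obtain e where e: "e \<in> peaks \<sigma>" "norm (e * y * e - state_ext \<sigma> y *\<^sub>C (e * e)) \<le> \<epsilon>"
    using compression[OF \<sigma> \<epsilon>] .
  have de: "d * e = e * d" using peaksD(1) d(1) e(1) D_commute by blast
  show thesis
    by (rule that[OF peaks_mult[OF \<sigma> d(1) e(1)] compression_mult_peak[OF d(1) e(1) d(2)]])
      (unfold de, rule compression_mult_peak[OF e(1) d(1) e(2)])
qed

section \<open>Eigenfunctionals and their characters\<close>

lemma bimoduleD:
  assumes "bimodule D M"
  shows "csubspace M" "d \<in> D \<Longrightarrow> m \<in> M \<Longrightarrow> d * m \<in> M" "d \<in> D \<Longrightarrow> m \<in> M \<Longrightarrow> m * d \<in> M"
proof -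
  show "csubspace M" using assms by (simp add: bimodule_def)
  have *: "d * m * e \<in> M" if "d \<in> D" "e \<in> D" "m \<in> M" for d e m
    using assms that by (simp add: bimodule_def)
  show "d \<in> D \<Longrightarrow> m \<in> M \<Longrightarrow> d * m \<in> M" using *[of d 1 m] by simp
  show "d \<in> D \<Longrightarrow> m \<in> M \<Longrightarrow> m * d \<in> M" using *[of 1 d m] by simp
qed

lemma dual_spaceD:
  assumes "\<phi> \<in> dual_space M" "csubspace M"
  shows "x \<in> M \<Longrightarrow> y \<in> M \<Longrightarrow> \<phi> (x + y) = \<phi> x + \<phi> y" "x \<in> M \<Longrightarrow> \<phi> (c *\<^sub>C x) = c * \<phi> x"
    "x \<in> M \<Longrightarrow> y \<in> M \<Longrightarrow> \<phi> (x - y) = \<phi> x - \<phi> y" "\<phi> 0 = 0" "\<phi> \<in> extensional M"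
proof -
  have *: "\<forall>x\<in>M. \<forall>y\<in>M. \<phi> (x + y) = \<phi> x + \<phi> y" "\<forall>c. \<forall>x\<in>M. \<phi> (c *\<^sub>C x) = c * \<phi> x"
    using assms(1) by (simp_all add: dual_space_def)
  then show "x \<in> M \<Longrightarrow> y \<in> M \<Longrightarrow> \<phi> (x + y) = \<phi> x + \<phi> y" "x \<in> M \<Longrightarrow> \<phi> (c *\<^sub>C x) = c * \<phi> x" by simp_all
  show "x \<in> M \<Longrightarrow> y \<in> M \<Longrightarrow> \<phi> (x - y) = \<phi> x - \<phi> y" "\<phi> 0 = 0"
    by (rule linear_on_subspace[OF assms(2) *], assumption+) (rule linear_on_subspace(4)[OF assms(2) *])
  show "\<phi> \<in> extensional M" using assms(1) by (simp add: dual_space_def)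
qed

text \<open>
The character \<open>\<rho>\<close> is the range and \<open>\<sigma>\<close> the source of the eigenfunctional \<open>\<phi>\<close>.
\<close>

definition eigen_pair :: "'a set \<Rightarrow> ('a \<Rightarrow> complex) \<Rightarrow> ('a \<Rightarrow> complex) \<Rightarrow> ('a \<Rightarrow> complex) \<Rightarrow> bool"
  where "eigen_pair M \<rho> \<sigma> \<phi> \<longleftrightarrow> character \<rho> \<and> character \<sigma> \<and> \<phi> \<in> dual_space M \<and> (\<exists>m\<in>M. \<phi> m \<noteq> 0) \<and>
    (\<forall>d\<in>D. \<forall>m\<in>M. \<phi> (d * m) = \<rho> d * \<phi> m \<and> \<phi> (m * d) = \<sigma> d * \<phi> m)"

text \<open>
Stated for an abstract action so that it covers left and right multiplication alike. Contractivity of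
the character follows by comparing the norm of \<open>\<phi>\<close> with that of \<open>\<lambda>m. \<phi> (act d m)\<close>.
\<close>

lemma character_of_action:
  fixes act :: "'a \<Rightarrow> 'a \<Rightarrow> 'a"
  assumes M: "csubspace M" and \<phi>: "\<phi> \<in> dual_space M" and m0: "m0 \<in> M" "\<phi> m0 \<noteq> 0"
    and act: "\<And>d m. d \<in> D \<Longrightarrow> m \<in> M \<Longrightarrow> act d m \<in> M"
      "\<And>d m. d \<in> D \<Longrightarrow> m \<in> M \<Longrightarrow> norm (act d m) \<le> norm d * norm m"
      "\<And>d e m. d \<in> D \<Longrightarrow> e \<in> D \<Longrightarrow> m \<in> M \<Longrightarrow> act (d + e) m = act d m + act e m"
      "\<And>c d m. d \<in> D \<Longrightarrow> m \<in> M \<Longrightarrow> act (c *\<^sub>C d) m = c *\<^sub>C act d m"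
      "\<And>d e m. d \<in> D \<Longrightarrow> e \<in> D \<Longrightarrow> m \<in> M \<Longrightarrow> act (d * e) m = act d (act e m)"
      "\<And>m. m \<in> M \<Longrightarrow> act 1 m = m"
    and eigen: "\<And>d. d \<in> D \<Longrightarrow> \<exists>c. \<forall>m\<in>M. \<phi> (act d m) = c * \<phi> m"
  obtains \<sigma> where "character \<sigma>" "\<And>d m. d \<in> D \<Longrightarrow> m \<in> M \<Longrightarrow> \<phi> (act d m) = \<sigma> d * \<phi> m"
proof -
  note \<phi>' = dual_spaceD[OF \<phi> M]
  define \<sigma> where "\<sigma> = (\<lambda>d\<in>D. \<phi> (act d m0) / \<phi> m0)"
  have \<sigma>0: "\<sigma> d * \<phi> m0 = \<phi> (act d m0)" if "d \<in> D" for d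
    using that m0 by (simp add: \<sigma>_def)
  have \<sigma>: "\<phi> (act d m) = \<sigma> d * \<phi> m" if d: "d \<in> D" and m: "m \<in> M" for d m
  proof -
    obtain c where c: "\<forall>m\<in>M. \<phi> (act d m) = c * \<phi> m" using eigen[OF d] by blast
    have "\<sigma> d * \<phi> m0 = c * \<phi> m0" using \<sigma>0[OF d] c m0(1) by simp
    then have "\<sigma> d = c" using m0(2) by simp
    then show ?thesis using c m by simp
  qed
  have cancel: "x = y" if "x * \<phi> m0 = y * \<phi> m0" for x y
    using that m0(2) by simp
  define N where "N = dual_norm M \<phi>"
  have N: "cmod (\<phi> m) \<le> N * norm m" if "m \<in> M" for m
    unfolding N_def by (rule norm_le_dual_norm[OF M \<phi> that])
  have "0 < cmod (\<phi> m0)" using m0 by simp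
  also have "\<dots> \<le> N * norm m0" by (rule N[OF m0(1)])
  finally have N0: "0 < N" by (simp add: zero_less_mult_iff)
  have bound: "cmod (\<sigma> d) \<le> norm d" if d: "d \<in> D" for d
  proof (rule ccontr)
    assume "\<not> cmod (\<sigma> d) \<le> norm d"
    then have lt: "norm d < cmod (\<sigma> d)" by simp
    then have pos: "0 < cmod (\<sigma> d)" using norm_ge_zero[of d] by linarith
    have "N \<le> N * norm d / cmod (\<sigma> d)"
      unfolding N_def
    proof (rule dual_norm_le[OF M], fold N_def)
      fix m assume m: "m \<in> M" "norm m \<le> 1"
      have "cmod (\<sigma> d) * cmod (\<phi> m) = cmod (\<phi> (act d m))" by (simp add: \<sigma>[OF d m(1)] norm_mult)
      also have "\<dots> \<le> N * norm (act d m)" by (rule N[OF act(1)[OF d m(1)]])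
      also have "\<dots> \<le> N * (norm d * norm m)" using act(2)[OF d m(1)] N0 by (intro mult_left_mono) auto
      also have "\<dots> \<le> N * (norm d * 1)" using m N0 by (intro mult_left_mono) auto
      finally show "cmod (\<phi> m) \<le> N * norm d / cmod (\<sigma> d)" using pos by (simp add: field_simps)
    qed
    then have "N * cmod (\<sigma> d) \<le> N * norm d" using pos by (simp add: field_simps)
    then show False using N0 lt by (simp add: mult_le_cancel_left_pos)
  qed
  have "normalized_functional D \<sigma>"
    unfolding normalized_functional_def
  proof (intro conjI ballI allI)
    show "\<sigma> (x + y) = \<sigma> x + \<sigma> y" if "x \<in> D" "y \<in> D" for x y
      by (rule cancel) (simp only: distrib_right \<sigma>0[OF that(1)] \<sigma>0[OF that(2)]
        \<sigma>0[OF D_closed(1)[OF that]] act(3)[OF that m0(1)] \<phi>'(1)[OF act(1)[OF that(1) m0(1)] act(1)[OF that(2) m0(1)]])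
    show "\<sigma> (c *\<^sub>C x) = c * \<sigma> x" if "x \<in> D" for c x
      by (rule cancel) (simp only: mult.assoc \<sigma>0[OF that] \<sigma>0[OF D_closed(3)[OF that]]
        act(4)[OF that m0(1)] \<phi>'(2)[OF act(1)[OF that m0(1)]])
    show "cmod (\<sigma> x) \<le> norm x" if "x \<in> D" for x by (rule bound[OF that])
    show "\<sigma> 1 = 1" by (rule cancel) (simp only: \<sigma>0[OF one_in_D] act(6)[OF m0(1)] mult_1)
  qed
  moreover have "\<sigma> (x * y) = \<sigma> x * \<sigma> y" if "x \<in> D" "y \<in> D" for x y
    by (rule cancel) (simp only: mult.assoc \<sigma>0[OF D_closed(7)[OF that]] \<sigma>0[OF that(2)]
      act(5)[OF that m0(1)] \<sigma>[OF that(1) act(1)[OF that(2) m0(1)]])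
  ultimately have "character \<sigma>" by (simp add: character_def \<sigma>_def)
  then show thesis using \<sigma> by (rule that)
qed

lemma eigen_pair_exists:
  assumes M: "bimodule D M" and \<phi>: "\<phi> \<in> eigenfunctionals D M"
  obtains \<rho> \<sigma> where "eigen_pair M \<rho> \<sigma> \<phi>"
proof -
  note M' = bimoduleD[OF M]
  have d\<phi>: "\<phi> \<in> dual_space M" and ev: "\<And>d. d \<in> D \<Longrightarrow> \<exists>c. \<forall>m\<in>M. \<phi> (d * m) = c * \<phi> m"
    "\<And>d. d \<in> D \<Longrightarrow> \<exists>c. \<forall>m\<in>M. \<phi> (m * d) = c * \<phi> m"
    using \<phi> by (simp_all add: eigenfunctionals_def)
  obtain m0 where m0: "m0 \<in> M" "\<phi> m0 \<noteq> 0" using \<phi> by (auto simp: eigenfunctionals_def)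
  obtain \<rho> where \<rho>: "character \<rho>" "\<And>d m. d \<in> D \<Longrightarrow> m \<in> M \<Longrightarrow> \<phi> (d * m) = \<rho> d * \<phi> m"
  proof (rule character_of_action[OF M'(1) d\<phi> m0, of "\<lambda>d m. d * m"])
    show "norm (d * m) \<le> norm d * norm m" for d m :: 'a by (rule norm_mult_ineq)
  qed (simp_all add: M' ev distrib_right mult_scaleC_left mult.assoc)
  obtain \<sigma> where \<sigma>: "character \<sigma>" "\<And>d m. d \<in> D \<Longrightarrow> m \<in> M \<Longrightarrow> \<phi> (m * d) = \<sigma> d * \<phi> m"
  proof (rule character_of_action[OF M'(1) d\<phi> m0, of "\<lambda>d m. m * d"])
    show "norm (m * d) \<le> norm d * norm m" for d m :: 'a
      using norm_mult_ineq[of m d] by (simp add: mult.commute)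
    show "m * (d * e) = m * e * d" if "d \<in> D" "e \<in> D" for d e m
      by (simp only: D_commute[OF that] mult.assoc)
  qed (simp_all add: M' ev distrib_left mult_scaleC_right)
  show thesis
    by (rule that[of \<rho> \<sigma>]) (use \<rho> \<sigma> d\<phi> m0 in \<open>auto simp: eigen_pair_def\<close>)
qed

lemma eigen_pairD:
  assumes "eigen_pair M \<rho> \<sigma> \<phi>"
  shows "character \<rho>" "character \<sigma>" "\<phi> \<in> dual_space M" "\<exists>m\<in>M. \<phi> m \<noteq> 0"
    "d \<in> D \<Longrightarrow> m \<in> M \<Longrightarrow> \<phi> (d * m) = \<rho> d * \<phi> m" "d \<in> D \<Longrightarrow> m \<in> M \<Longrightarrow> \<phi> (m * d) = \<sigma> d * \<phi> m"
  using assms by (simp_all add: eigen_pair_def)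

lemma eigen_pair_eigenfunctional: "eigen_pair M \<rho> \<sigma> \<phi> \<Longrightarrow> \<phi> \<in> eigenfunctionals D M"
  unfolding eigen_pair_def eigenfunctionals_def by blast

lemma eigen_pair_bound:
  assumes "bimodule D M" "eigen_pair M \<rho> \<sigma> \<phi>" "m \<in> M"
  shows "cmod (\<phi> m) \<le> dual_norm M \<phi> * norm m"
  by (rule norm_le_dual_norm[OF bimoduleD(1)[OF assms(1)] eigen_pairD(3)[OF assms(2)] assms(3)])

lemma dual_norm_pos:
  assumes "bimodule D M" "eigen_pair M \<rho> \<sigma> \<phi>"
  shows "0 < dual_norm M \<phi>"
proof -
  obtain m where m: "m \<in> M" "\<phi> m \<noteq> 0" using eigen_pairD(4)[OF assms(2)] by blast
  have "0 < cmod (\<phi> m)" using m(2) by simp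
  also have "\<dots> \<le> dual_norm M \<phi> * norm m" by (rule eigen_pair_bound[OF assms m(1)])
  finally show ?thesis by (simp add: zero_less_mult_iff)
qed

lemma eigen_pair_peaks:
  assumes M: "bimodule D M" and \<phi>: "eigen_pair M \<rho> \<sigma> \<phi>" and m: "m \<in> M"
    and e: "e \<in> peaks \<rho>" and d: "d \<in> peaks \<sigma>"
  shows "\<phi> (e * m * d) = \<phi> m"
  using eigen_pairD(5)[OF \<phi> peaksD(1)[OF e] m]
    eigen_pairD(6)[OF \<phi> peaksD(1)[OF d] bimoduleD(2)[OF M peaksD(1)[OF e] m]]
  by (simp only: peaksD(4)[OF d] peaksD(4)[OF e] mult_1)

section \<open>Normalizers that intertwine two characters\<close>

text \<open>
These are the elements whose corner at \<open>(\<rho>, \<sigma>)\<close> is zero. They form a closed subspace on which no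
eigenfunctional with range \<open>\<rho>\<close> and source \<open>\<sigma>\<close> lives, since the value of such a functional does not
change when an element is compressed by peaks.
\<close>

definition negligible_corner :: "('a \<Rightarrow> complex) \<Rightarrow> ('a \<Rightarrow> complex) \<Rightarrow> 'a set"
  where "negligible_corner \<rho> \<sigma> = {x. \<forall>\<epsilon>>0. \<exists>e\<in>peaks \<rho>. \<exists>d\<in>peaks \<sigma>. norm (e * x * d) \<le> \<epsilon>}"

lemma not_negligible:
  assumes M: "bimodule D M" and \<phi>: "eigen_pair M \<rho> \<sigma> \<phi>" and m: "m \<in> M" "\<phi> m \<noteq> 0"
  shows "m \<notin> negligible_corner \<rho> \<sigma>"
proof
  assume neg: "m \<in> negligible_corner \<rho> \<sigma>"
  define N where "N = dual_norm M \<phi>"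
  have N0: "0 < N" unfolding N_def by (rule dual_norm_pos[OF M \<phi>])
  then have "0 < cmod (\<phi> m) / (2 * N)" using m by simp
  then obtain e d where ed: "e \<in> peaks \<rho>" "d \<in> peaks \<sigma>" "norm (e * m * d) \<le> cmod (\<phi> m) / (2 * N)"
    using neg unfolding negligible_corner_def by blast
  have "e * m * d \<in> M"
    using bimoduleD(2,3)[OF M] peaksD(1)[OF ed(1)] peaksD(1)[OF ed(2)] m(1) by simp
  then have "cmod (\<phi> m) \<le> N * norm (e * m * d)"
    using eigen_pair_bound[OF M \<phi>] eigen_pair_peaks[OF M \<phi> m(1) ed(1,2)] unfolding N_def by force
  also have "\<dots> \<le> N * (cmod (\<phi> m) / (2 * N))" using ed(3) N0 by (intro mult_left_mono) auto
  finally show False using N0 m(2) by simp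
qed

lemma norm_corner_mult_peaks:
  assumes "e \<in> peaks \<rho>" "e' \<in> peaks \<rho>" "d \<in> peaks \<sigma>" "d' \<in> peaks \<sigma>"
  shows "norm ((e * e') * x * (d * d')) \<le> norm (e * x * d)" "norm ((e * e') * x * (d * d')) \<le> norm (e' * x * d')"
proof -
  have c: "e * e' = e' * e" "d * d' = d' * d"
    using D_commute peaksD(1) assms by blast+
  have "(e * e') * x * (d * d') = (e' * e) * x * (d * d')" "(e * e') * x * (d * d') = (e * e') * x * (d' * d)"
    by (simp_all only: c)
  then have eq: "(e * e') * x * (d * d') = e' * (e * x * d) * d'" "(e * e') * x * (d * d') = e * (e' * x * d') * d"
    by (simp_all only: mult.assoc)
  note n = assms[THEN peaksD(3)]
  show "norm ((e * e') * x * (d * d')) \<le> norm (e * x * d)"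
    by (subst eq(1), rule order_trans[OF norm_mult_contraction_right[OF n(4)] norm_mult_contraction_left[OF n(2)]])
  show "norm ((e * e') * x * (d * d')) \<le> norm (e' * x * d')"
    by (subst eq(2), rule order_trans[OF norm_mult_contraction_right[OF n(3)] norm_mult_contraction_left[OF n(1)]])
qed

lemma one_peak: "character \<sigma> \<Longrightarrow> 1 \<in> peaks \<sigma>"
  by (simp add: peaks_def characterD(4))

lemma subspace_negligible_corner:
  assumes \<rho>: "character \<rho>" and \<sigma>: "character \<sigma>"
  shows "csubspace (negligible_corner \<rho> \<sigma>)"
proof (rule complex_vector.subspaceI)
  show "0 \<in> negligible_corner \<rho> \<sigma>"
    unfolding negligible_corner_def
    by (intro CollectI allI impI bexI[OF _ one_peak[OF \<rho>]] bexI[OF _ one_peak[OF \<sigma>]]) simp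
next
  fix x y assume x: "x \<in> negligible_corner \<rho> \<sigma>" and y: "y \<in> negligible_corner \<rho> \<sigma>"
  show "x + y \<in> negligible_corner \<rho> \<sigma>"
    unfolding negligible_corner_def
  proof (intro CollectI allI impI)
    fix \<epsilon> :: real assume "0 < \<epsilon>"
    then have "0 < \<epsilon> / 2" by simp
    then obtain e d e' d' where *: "e \<in> peaks \<rho>" "d \<in> peaks \<sigma>" "norm (e * x * d) \<le> \<epsilon> / 2"
      "e' \<in> peaks \<rho>" "d' \<in> peaks \<sigma>" "norm (e' * y * d') \<le> \<epsilon> / 2"
      using x y unfolding negligible_corner_def by blast
    have eq: "(e * e') * (x + y) * (d * d') = (e * e') * x * (d * d') + (e * e') * y * (d * d')"
      by (simp add: distrib_left distrib_right)
    have "norm ((e * e') * (x + y) * (d * d')) \<le> \<epsilon> / 2 + \<epsilon> / 2"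
      unfolding eq
      by (rule norm_triangle_mono)
        (rule order_trans[OF norm_corner_mult_peaks(1)[OF *(1,4,2,5)] *(3)],
         rule order_trans[OF norm_corner_mult_peaks(2)[OF *(1,4,2,5)] *(6)])
    then have "norm ((e * e') * (x + y) * (d * d')) \<le> \<epsilon>" by simp
    then show "\<exists>e\<in>peaks \<rho>. \<exists>d\<in>peaks \<sigma>. norm (e * (x + y) * d) \<le> \<epsilon>"
      using peaks_mult[OF \<rho> *(1,4)] peaks_mult[OF \<sigma> *(2,5)] by blast
  qed
next
  fix c x assume x: "x \<in> negligible_corner \<rho> \<sigma>"
  show "c *\<^sub>C x \<in> negligible_corner \<rho> \<sigma>"
    unfolding negligible_corner_def
  proof (intro CollectI allI impI)
    fix \<epsilon> :: real assume "0 < \<epsilon>"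
    then have "0 < \<epsilon> / (cmod c + 1)" by (simp add: add_nonneg_pos)
    then obtain e d where *: "e \<in> peaks \<rho>" "d \<in> peaks \<sigma>" "norm (e * x * d) \<le> \<epsilon> / (cmod c + 1)"
      using x unfolding negligible_corner_def by blast
    have "norm (e * (c *\<^sub>C x) * d) = cmod c * norm (e * x * d)"
      by (simp add: mult_scaleC_left mult_scaleC_right norm_scaleC)
    also have "\<dots> \<le> (cmod c + 1) * norm (e * x * d)" by (simp add: mult_right_mono)
    also have "\<dots> \<le> \<epsilon>"
    proof -
      have "0 < cmod c + 1" by (simp add: add_nonneg_pos)
      then show ?thesis using *(3) by (simp only: pos_le_divide_eq mult.commute)
    qed
    finally show "\<exists>e\<in>peaks \<rho>. \<exists>d\<in>peaks \<sigma>. norm (e * (c *\<^sub>C x) * d) \<le> \<epsilon>" using * by blast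
  qed
qed

lemma closed_negligible_corner: "closed (negligible_corner \<rho> \<sigma>)"
proof (rule closure_subset_eq[THEN iffD1], rule subsetI)
  fix x assume x: "x \<in> closure (negligible_corner \<rho> \<sigma>)"
  show "x \<in> negligible_corner \<rho> \<sigma>"
    unfolding negligible_corner_def
  proof (intro CollectI allI impI)
    fix \<epsilon> :: real assume "0 < \<epsilon>"
    then have \<epsilon>: "0 < \<epsilon> / 2" by simp
    then obtain y where y: "y \<in> negligible_corner \<rho> \<sigma>" "dist y x < \<epsilon> / 2"
      using x closure_approachable by blast
    obtain e d where *: "e \<in> peaks \<rho>" "d \<in> peaks \<sigma>" "norm (e * y * d) \<le> \<epsilon> / 2"
      using y(1) \<epsilon> unfolding negligible_corner_def by blast
    have "norm (e * (x - y) * d) \<le> norm (x - y)"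
      by (rule order_trans[OF norm_mult_contraction_right[OF peaksD(3)[OF *(2)]]
            norm_mult_contraction_left[OF peaksD(3)[OF *(1)]]])
    also have "\<dots> \<le> \<epsilon> / 2" using y(2) by (simp add: dist_norm norm_minus_commute)
    finally have 1: "norm (e * (x - y) * d) \<le> \<epsilon> / 2" .
    have eq: "e * x * d = e * (x - y) * d + e * y * d" by (simp add: left_diff_distrib right_diff_distrib)
    have "norm (e * x * d) \<le> \<epsilon> / 2 + \<epsilon> / 2"
      unfolding eq by (rule norm_triangle_mono[OF 1 *(3)])
    then have "norm (e * x * d) \<le> \<epsilon>" by simp
    then show "\<exists>e\<in>peaks \<rho>. \<exists>d\<in>peaks \<sigma>. norm (e * x * d) \<le> \<epsilon>" using *(1,2) by blast
  qed
qed

text \<open>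
Conjugation by a normalizer \<open>v\<close> induces a partial homeomorphism of the spectrum of \<open>D\<close>, defined at \<open>\<sigma>\<close> if
\<open>\<sigma> (star v * v) \<noteq> 0\<close>; the last condition says that it maps \<open>\<sigma>\<close> to \<open>\<rho>\<close>.
\<close>

definition intertwines :: "'a \<Rightarrow> ('a \<Rightarrow> complex) \<Rightarrow> ('a \<Rightarrow> complex) \<Rightarrow> bool"
  where "intertwines v \<rho> \<sigma> \<longleftrightarrow> v \<in> normalizers D UNIV \<and> \<sigma> (star v * v) \<noteq> 0 \<and>
    (\<forall>d\<in>D. \<rho> (v * d * star v) = \<sigma> d * \<sigma> (star v * v))"

lemma normalizersD:
  assumes "v \<in> normalizers D UNIV"
  shows "d \<in> D \<Longrightarrow> v * d * star v \<in> D" "d \<in> D \<Longrightarrow> star v * d * v \<in> D" "star v * v \<in> D" "v * star v \<in> D"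
proof -
  show *: "d \<in> D \<Longrightarrow> v * d * star v \<in> D" "d \<in> D \<Longrightarrow> star v * d * v \<in> D" for d
    using assms by (simp_all add: normalizers_def)
  show "star v * v \<in> D" "v * star v \<in> D" using *[OF one_in_D] by simp_all
qed

lemma intertwinesD:
  assumes "intertwines v \<rho> \<sigma>"
  shows "v \<in> normalizers D UNIV" "\<sigma> (star v * v) \<noteq> 0"
    "d \<in> D \<Longrightarrow> \<rho> (v * d * star v) = \<sigma> d * \<sigma> (star v * v)"
  using assms by (simp_all add: intertwines_def)

lemma norm_normalizer_peak:
  assumes \<sigma>: "character \<sigma>" and v: "v \<in> normalizers D UNIV" and \<epsilon>: "0 < \<epsilon>"
  obtains d where "d \<in> peaks \<sigma>" "(norm (v * d))\<^sup>2 \<le> cmod (\<sigma> (star v * v)) + \<epsilon>"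
proof -
  let ?n = "star v * v"
  note nD = normalizersD(3)[OF v]
  obtain d where d: "d \<in> peaks \<sigma>" "norm ((?n - \<sigma> ?n *\<^sub>C 1) * d) \<le> \<epsilon>"
    using peak_for_pair[OF \<sigma> nD nD \<epsilon>] .
  note d' = peaksD[OF d(1)]
  have "(norm (v * d))\<^sup>2 = norm (d * (?n * d))"
    using norm_mult_self_adjoint_right[OF d'(2), of v] by (simp only: mult.assoc)
  also have "\<dots> \<le> norm (?n * d)" by (rule norm_mult_contraction_left[OF d'(3)])
  also have "?n * d = \<sigma> ?n *\<^sub>C d + (?n - \<sigma> ?n *\<^sub>C 1) * d" by (simp add: left_diff_distrib mult_scaleC_left)
  also have "norm \<dots> \<le> cmod (\<sigma> ?n) + \<epsilon>"
  proof (rule norm_triangle_mono)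
    show "norm (\<sigma> ?n *\<^sub>C d) \<le> cmod (\<sigma> ?n)" using d'(3) by (simp add: norm_scaleC mult_left_le)
  qed (rule d(2))
  finally show thesis using d(1) by (intro that)
qed

text \<open>
From \<open>(v * a * star v) * v = v * (a * star v * v)\<close>: compressed by peaks, the left factor acts as the
number \<open>\<rho> (v * a * star v)\<close> and the right factor as \<open>\<sigma> (a * star v * v)\<close>. If the numbers differ, the
compression of \<open>v\<close> must be small.
\<close>

lemma normalizer_not_negligible:
  assumes \<rho>: "character \<rho>" and \<sigma>: "character \<sigma>" and v: "v \<in> normalizers D UNIV"
    and nn: "v \<notin> negligible_corner \<rho> \<sigma>"
  shows "intertwines v \<rho> \<sigma>"
proof -
  obtain \<epsilon> where \<epsilon>: "0 < \<epsilon>" "\<And>e d. e \<in> peaks \<rho> \<Longrightarrow> d \<in> peaks \<sigma> \<Longrightarrow> \<epsilon> < norm (e * v * d)"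
    using nn unfolding negligible_corner_def by (auto simp: not_le)
  let ?n = "star v * v"
  note nv = normalizersD[OF v]
  have "\<sigma> ?n \<noteq> 0"
  proof
    assume z: "\<sigma> ?n = 0"
    obtain d where d: "d \<in> peaks \<sigma>" "(norm (v * d))\<^sup>2 \<le> cmod (\<sigma> ?n) + \<epsilon>\<^sup>2"
      using norm_normalizer_peak[OF \<sigma> v, of "\<epsilon>\<^sup>2"] \<epsilon>(1) by auto
    then have "(norm (v * d))\<^sup>2 \<le> \<epsilon>\<^sup>2" using z by simp
    then have "norm (v * d) \<le> \<epsilon>" by (rule power2_le_imp_le) (rule less_imp_le[OF \<epsilon>(1)])
    then show False using \<epsilon>(2)[OF one_peak[OF \<rho>] d(1)] by simp
  qed
  moreover have "\<rho> (v * a * star v) = \<sigma> a * \<sigma> ?n" if a: "a \<in> D" for a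
  proof (rule ccontr)
    assume ne: "\<rho> (v * a * star v) \<noteq> \<sigma> a * \<sigma> ?n"
    define b where "b = v * a * star v"
    define c where "c = a * ?n"
    have b: "b \<in> D" and c: "c \<in> D" "\<sigma> c = \<sigma> a * \<sigma> ?n" and bc: "b * v = v * c"
      using nv a by (simp_all add: b_def c_def character_mult[OF \<sigma>] mult.assoc)
    define \<Delta> where "\<Delta> = cmod (\<rho> b - \<sigma> c)"
    have \<Delta>: "0 < \<Delta>" using ne by (simp add: \<Delta>_def b_def c(2))
    \<comment> \<open>Chosen so that the two error terms \<open>norm v * \<delta>\<close> together stay below \<open>\<Delta> * \<epsilon>\<close>.\<close>
    define \<delta> where "\<delta> = \<epsilon> * \<Delta> / (2 * (norm v + 1))"
    have \<delta>: "0 < \<delta>" using \<epsilon>(1) \<Delta> by (simp add: \<delta>_def add_nonneg_pos)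
    obtain e where e: "e \<in> peaks \<rho>" "norm ((b - \<rho> b *\<^sub>C 1) * e) \<le> \<delta>"
      using peak_for_pair[OF \<rho> b b \<delta>] .
    obtain d where d: "d \<in> peaks \<sigma>" "norm ((c - \<sigma> c *\<^sub>C 1) * d) \<le> \<delta>"
      using peak_for_pair[OF \<sigma> c(1) c(1) \<delta>] .
    note e' = peaksD[OF e(1)] and d' = peaksD[OF d(1)]
    define r where "r = (b - \<rho> b *\<^sub>C 1) * e"
    define s where "s = (c - \<sigma> c *\<^sub>C 1) * d"
    have r_eq: "r = e * (b - \<rho> b *\<^sub>C 1)" unfolding r_def using D_commute[OF _ e'(1)] b by simp
    have "e * (b * v) * d = e * (v * c) * d" by (simp only: bc)
    then have "r * v * d + \<rho> b *\<^sub>C (e * v * d) = e * v * s + \<sigma> c *\<^sub>C (e * v * d)"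
      unfolding r_eq s_def
      by (simp add: left_diff_distrib right_diff_distrib mult_scaleC_left mult_scaleC_right mult.assoc)
    then have "(\<rho> b - \<sigma> c) *\<^sub>C (e * v * d) = e * v * s - r * v * d"
      by (simp add: complex_vector.scale_left_diff_distrib algebra_simps)
    then have "\<Delta> * norm (e * v * d) = norm (e * v * s - r * v * d)"
      unfolding \<Delta>_def by (simp flip: norm_scaleC)
    also have "\<dots> \<le> norm (e * v * s) + norm (r * v * d)" by (rule norm_triangle_ineq4)
    also have "\<dots> \<le> norm v * \<delta> + \<delta> * norm v"
    proof (rule add_mono)
      have "norm (e * v * s) \<le> norm (e * v) * norm s" by (rule norm_mult_ineq)
      also have "\<dots> \<le> norm v * \<delta>"
        using norm_mult_contraction_left[OF e'(3), of v] d(2) by (intro mult_mono) (simp_all add: s_def)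
      finally show "norm (e * v * s) \<le> norm v * \<delta>" .
      have "norm (r * v * d) \<le> norm (r * v)" by (rule norm_mult_contraction_right[OF d'(3)])
      also have "\<dots> \<le> norm r * norm v" by (rule norm_mult_ineq)
      also have "\<dots> \<le> \<delta> * norm v" using e(2) by (intro mult_right_mono) (simp_all add: r_def)
      finally show "norm (r * v * d) \<le> \<delta> * norm v" .
    qed
    also have "\<dots> = (2 * norm v) * \<delta>" by simp
    also have "\<dots> \<le> (2 * (norm v + 1)) * \<delta>" using \<delta> by (intro mult_right_mono) simp_all
    also have "\<dots> = \<Delta> * \<epsilon>"
    proof -
      have "norm v + 1 \<noteq> 0" using norm_ge_zero[of v] by linarith
      then show ?thesis by (simp add: \<delta>_def)
    qed
    finally have "norm (e * v * d) \<le> \<epsilon>" using \<Delta> by (simp only: mult_le_cancel_left_pos)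
    then show False using \<epsilon>(2)[OF e(1) d(1)] by simp
  qed
  ultimately show ?thesis using v by (simp add: intertwines_def)
qed

text \<open>
If all normalizers were negligible, so would be their closed linear span, which is the whole algebra by
regularity.
\<close>

lemma intertwiner_exists:
  assumes M: "bimodule D M" and \<phi>: "eigen_pair M \<rho> \<sigma> \<phi>"
  obtains v where "intertwines v \<rho> \<sigma>"
proof -
  note \<rho>\<sigma> = eigen_pairD(1,2)[OF \<phi>]
  obtain m where m: "m \<in> M" "\<phi> m \<noteq> 0" using eigen_pairD(4)[OF \<phi>] by blast
  have "\<exists>v\<in>normalizers D UNIV. v \<notin> negligible_corner \<rho> \<sigma>"
  proof (rule ccontr)
    assume "\<not> (\<exists>v\<in>normalizers D UNIV. v \<notin> negligible_corner \<rho> \<sigma>)"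
    then have "normalizers D UNIV \<subseteq> negligible_corner \<rho> \<sigma>" by blast
    then have "cspan (normalizers D UNIV) \<subseteq> negligible_corner \<rho> \<sigma>"
      by (rule complex_vector.span_minimal[OF _ subspace_negligible_corner[OF \<rho>\<sigma>]])
    then have "closure (cspan (normalizers D UNIV)) \<subseteq> negligible_corner \<rho> \<sigma>"
      by (rule closure_minimal[OF _ closed_negligible_corner])
    then show False using not_negligible[OF M \<phi> m] regular_UNIV by blast
  qed
  then show thesis using normalizer_not_negligible[OF \<rho>\<sigma>] that by blast
qed

lemma normalizer_intertwines_of_nonzero:
  assumes M: "bimodule D M" and \<phi>: "eigen_pair M \<rho> \<sigma> \<phi>" and v: "v \<in> normalizers D M" "\<phi> v \<noteq> 0"
  shows "intertwines v \<rho> \<sigma>"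
proof -
  have "v \<in> M" "v \<in> normalizers D UNIV" using v(1) by (simp_all add: normalizers_def)
  then show ?thesis
    using normalizer_not_negligible[OF eigen_pairD(1,2)[OF \<phi>]] not_negligible[OF M \<phi> _ v(2)] by simp
qed

section \<open>The form and the norm of an eigenfunctional\<close>

lemma le_of_le_mult_small:
  fixes x C :: real
  assumes "\<And>\<epsilon>. 0 < \<epsilon> \<Longrightarrow> x \<le> C * \<epsilon>"
  shows "x \<le> 0"
proof -
  have "((\<lambda>\<epsilon>. C * \<epsilon>) \<longlongrightarrow> C * 0) (at_right 0)" by (intro tendsto_intros)
  moreover have "eventually (\<lambda>\<epsilon>. x \<le> C * \<epsilon>) (at_right 0)"
    using assms by (auto simp: eventually_at_right_field intro!: exI[of _ 1])
  ultimately have "x \<le> C * 0" by (rule tendsto_lowerbound) simp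
  then show ?thesis by simp
qed

text \<open>
The key step. The element \<open>v * d * star v * m * d\<close> lies in \<open>M\<close> because \<open>v * d * star v\<close> lies in \<open>D\<close>,
and yet it is nearly a multiple of \<open>v * (d * d)\<close>, which need not lie in \<open>M\<close>.
\<close>

lemma intertwiner_compression:
  assumes M: "bimodule D M" and \<phi>: "eigen_pair M \<rho> \<sigma> \<phi>" and v: "intertwines v \<rho> \<sigma>" and m: "m \<in> M"
    and d: "d \<in> peaks \<sigma>"
    and le: "norm (d * (star v * m) * d - state_ext \<sigma> (star v * m) *\<^sub>C (d * d)) \<le> \<epsilon>"
  shows "v * d * star v * m * d \<in> M"
    and "\<phi> (v * d * star v * m * d) = \<sigma> (star v * v) * \<phi> m"
    and "norm (v * d * star v * m * d - state_ext \<sigma> (star v * m) *\<^sub>C (v * (d * d))) \<le> norm v * \<epsilon>"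
proof -
  note d' = peaksD[OF d] and v' = intertwinesD[OF v]
  have vdv: "v * d * star v \<in> D" by (rule normalizersD(1)[OF v'(1) d'(1)])
  have m1: "v * d * star v * m \<in> M" by (rule bimoduleD(2)[OF M vdv m])
  show "v * d * star v * m * d \<in> M" by (rule bimoduleD(3)[OF M d'(1) m1])
  show "\<phi> (v * d * star v * m * d) = \<sigma> (star v * v) * \<phi> m"
    by (simp only: eigen_pairD(6)[OF \<phi> d'(1) m1] eigen_pairD(5)[OF \<phi> vdv m] v'(3)[OF d'(1)] d'(4) mult_1)
  have "v * d * star v * m * d - state_ext \<sigma> (star v * m) *\<^sub>C (v * (d * d)) =
      v * (d * (star v * m) * d - state_ext \<sigma> (star v * m) *\<^sub>C (d * d))"
    by (simp add: right_diff_distrib mult_scaleC_right mult.assoc)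
  then have "norm (v * d * star v * m * d - state_ext \<sigma> (star v * m) *\<^sub>C (v * (d * d))) \<le>
      norm v * norm (d * (star v * m) * d - state_ext \<sigma> (star v * m) *\<^sub>C (d * d))"
    by (simp only: norm_mult_ineq)
  also have "\<dots> \<le> norm v * \<epsilon>" using le by (rule mult_left_mono) simp
  finally show "norm (v * d * star v * m * d - state_ext \<sigma> (star v * m) *\<^sub>C (v * (d * d))) \<le> norm v * \<epsilon>" .
qed

text \<open>
Let \<open>s\<close> be the state extension of \<open>\<sigma>\<close>. The compressed element built from \<open>x\<close>, scaled by
\<open>s (star v * y)\<close>, and the one built from \<open>y\<close>, scaled by \<open>s (star v * x)\<close>, are both close to the same
multiple of \<open>v * (d * d)\<close>.
\<close>

lemma eigen_pair_proportional:
  assumes M: "bimodule D M" and \<phi>: "eigen_pair M \<rho> \<sigma> \<phi>" and v: "intertwines v \<rho> \<sigma>"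
    and x: "x \<in> M" and y: "y \<in> M"
  shows "state_ext \<sigma> (star v * y) * \<phi> x = state_ext \<sigma> (star v * x) * \<phi> y"
proof -
  define n s t where "n = \<sigma> (star v * v)" and "s = state_ext \<sigma> (star v * x)"
    and "t = state_ext \<sigma> (star v * y)"
  define N where "N = dual_norm M \<phi>"
  note \<sigma> = eigen_pairD(2)[OF \<phi>] and lin = dual_spaceD[OF eigen_pairD(3)[OF \<phi>] bimoduleD(1)[OF M]]
  have n: "n \<noteq> 0" using intertwinesD(2)[OF v] by (simp add: n_def)
  have N0: "0 \<le> N" unfolding N_def by (rule less_imp_le[OF dual_norm_pos[OF M \<phi>]])
  have "cmod (n * (t * \<phi> x - s * \<phi> y)) \<le> (N * ((cmod t + cmod s) * norm v)) * \<epsilon>" if \<epsilon>: "0 < \<epsilon>" for \<epsilon>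
  proof -
    obtain d where d: "d \<in> peaks \<sigma>" "norm (d * (star v * x) * d - s *\<^sub>C (d * d)) \<le> \<epsilon>"
      "norm (d * (star v * y) * d - t *\<^sub>C (d * d)) \<le> \<epsilon>"
      unfolding s_def t_def using compression_pair[OF \<sigma> \<epsilon>] .
    define wx wy where "wx = v * d * star v * x * d" and "wy = v * d * star v * y * d"
    note wx = intertwiner_compression[OF M \<phi> v x d(1) d(2)[unfolded s_def], folded wx_def s_def n_def]
    note wy = intertwiner_compression[OF M \<phi> v y d(1) d(3)[unfolded t_def], folded wy_def t_def n_def]
    have sub: "csubspace M" by (rule bimoduleD(1)[OF M])
    have mem: "t *\<^sub>C wx \<in> M" "s *\<^sub>C wy \<in> M"
      using complex_vector.subspace_scale[OF sub] wx(1) wy(1) by simp_all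
    have memd: "t *\<^sub>C wx - s *\<^sub>C wy \<in> M" by (rule complex_vector.subspace_diff[OF sub mem])
    have "\<phi> (t *\<^sub>C wx - s *\<^sub>C wy) = t * (n * \<phi> x) - s * (n * \<phi> y)"
      by (simp only: lin(3)[OF mem] lin(2)[OF wx(1)] lin(2)[OF wy(1)] wx(2) wy(2))
    also have "\<dots> = n * (t * \<phi> x - s * \<phi> y)" by (simp add: algebra_simps)
    finally have "cmod (n * (t * \<phi> x - s * \<phi> y)) \<le> N * norm (t *\<^sub>C wx - s *\<^sub>C wy)"
      using eigen_pair_bound[OF M \<phi> memd] by (simp only: N_def)
    also have "\<dots> \<le> N * (cmod t * (norm v * \<epsilon>) + cmod s * (norm v * \<epsilon>))"
    proof (rule mult_left_mono[OF _ N0])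
      have "t *\<^sub>C wx - s *\<^sub>C wy = t *\<^sub>C (wx - s *\<^sub>C (v * (d * d))) - s *\<^sub>C (wy - t *\<^sub>C (v * (d * d)))"
        by (simp add: complex_vector.scale_right_diff_distrib scaleC_scaleC mult.commute)
      also have "norm \<dots> \<le> norm (t *\<^sub>C (wx - s *\<^sub>C (v * (d * d)))) + norm (s *\<^sub>C (wy - t *\<^sub>C (v * (d * d))))"
        by (rule norm_triangle_ineq4)
      also have "\<dots> \<le> cmod t * (norm v * \<epsilon>) + cmod s * (norm v * \<epsilon>)"
        unfolding norm_scaleC by (intro add_mono mult_left_mono wx(3) wy(3)) simp_all
      finally show "norm (t *\<^sub>C wx - s *\<^sub>C wy) \<le> cmod t * (norm v * \<epsilon>) + cmod s * (norm v * \<epsilon>)" .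
    qed
    finally show ?thesis by (simp add: algebra_simps)
  qed
  then have "cmod (n * (t * \<phi> x - s * \<phi> y)) \<le> 0" by (rule le_of_le_mult_small)
  then show ?thesis using n by (simp add: s_def t_def)
qed

lemma state_ext_nonzero:
  assumes M: "bimodule D M" and \<phi>: "eigen_pair M \<rho> \<sigma> \<phi>" and v: "intertwines v \<rho> \<sigma>"
    and m: "m \<in> M" "\<phi> m \<noteq> 0"
  shows "state_ext \<sigma> (star v * m) \<noteq> 0"
proof
  assume z: "state_ext \<sigma> (star v * m) = 0"
  note \<sigma> = eigen_pairD(2)[OF \<phi>]
  define N where "N = dual_norm M \<phi>"
  have N0: "0 \<le> N" unfolding N_def by (rule less_imp_le[OF dual_norm_pos[OF M \<phi>]])
  have "cmod (\<sigma> (star v * v) * \<phi> m) \<le> (N * norm v) * \<epsilon>" if \<epsilon>: "0 < \<epsilon>" for \<epsilon>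
  proof -
    obtain d where d: "d \<in> peaks \<sigma>"
      "norm (d * (star v * m) * d - state_ext \<sigma> (star v * m) *\<^sub>C (d * d)) \<le> \<epsilon>"
      using compression[OF \<sigma> \<epsilon>] .
    note w = intertwiner_compression[OF M \<phi> v m(1) d]
    have "cmod (\<sigma> (star v * v) * \<phi> m) \<le> N * norm (v * d * star v * m * d)"
      using eigen_pair_bound[OF M \<phi> w(1)] by (simp only: w(2) N_def)
    also have "\<dots> \<le> N * (norm v * \<epsilon>)" using w(3) N0 by (intro mult_left_mono) (simp_all add: z)
    finally show ?thesis by (simp only: mult.assoc)
  qed
  then have "cmod (\<sigma> (star v * v) * \<phi> m) \<le> 0" by (rule le_of_le_mult_small)
  then show False using m(2) intertwinesD(2)[OF v] by simp
qed

theorem eigen_pair_form: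
  assumes M: "bimodule D M" and \<phi>: "eigen_pair M \<rho> \<sigma> \<phi>" and v: "intertwines v \<rho> \<sigma>"
  obtains c where "c \<noteq> 0" "\<And>x. x \<in> M \<Longrightarrow> \<phi> x = c * state_ext \<sigma> (star v * x)"
proof -
  obtain m where m: "m \<in> M" "\<phi> m \<noteq> 0" using eigen_pairD(4)[OF \<phi>] by blast
  have s: "state_ext \<sigma> (star v * m) \<noteq> 0" by (rule state_ext_nonzero[OF M \<phi> v m])
  show thesis
  proof
    show "\<phi> m / state_ext \<sigma> (star v * m) \<noteq> 0" using m s by simp
    show "\<phi> x = \<phi> m / state_ext \<sigma> (star v * m) * state_ext \<sigma> (star v * x)" if "x \<in> M" for x
      using eigen_pair_proportional[OF M \<phi> v that m(1)] s by (simp add: field_simps)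
  qed
qed

lemma intertwiner_weight:
  assumes \<sigma>: "character \<sigma>" and v: "intertwines v \<rho> \<sigma>"
  obtains r where "0 < r" "\<sigma> (star v * v) = of_real r" "state_ext \<sigma> (star v * v) = of_real r"
proof -
  have eq: "state_ext \<sigma> (star v * v) = \<sigma> (star v * v)"
    by (rule state_ext_D[OF \<sigma> normalizersD(3)[OF intertwinesD(1)[OF v]]])
  define r where "r = Re (\<sigma> (star v * v))"
  have r: "0 \<le> r" "\<sigma> (star v * v) = of_real r"
    using normalized_functional_square[OF cstar_subalgebra_UNIV UNIV_I normalized_state_ext[OF \<sigma>] UNIV_I, of v]
    unfolding eq r_def .
  then have "0 < r" using intertwinesD(2)[OF v] by (cases "r = 0") simp_all
  then show thesis using r(2) eq by (intro that) simp_all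
qed

lemma state_ext_bound:
  assumes \<sigma>: "character \<sigma>" and r: "state_ext \<sigma> (star v * v) = of_real r"
  shows "cmod (state_ext \<sigma> (star v * x)) \<le> sqrt r * norm x"
proof -
  have "Re (state_ext \<sigma> (star x * x)) \<le> cmod (state_ext \<sigma> (star x * x))" by (rule complex_Re_le_cmod)
  also have "\<dots> \<le> norm (star x * x)" by (rule state_extD(3)[OF \<sigma>])
  finally have x: "Re (state_ext \<sigma> (star x * x)) \<le> (norm x)\<^sup>2" by (simp only: cstar_identity)
  have r0: "0 \<le> r"
    using normalized_functional_square(1)[OF cstar_subalgebra_UNIV UNIV_I normalized_state_ext[OF \<sigma>] UNIV_I, of v]
    by (simp add: r)
  have "(cmod (state_ext \<sigma> (star v * x)))\<^sup>2 \<le> r * Re (state_ext \<sigma> (star x * x))"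
    using state_ext_Cauchy_Schwarz[OF \<sigma>, of v x] by (simp add: r)
  also have "\<dots> \<le> r * (norm x)\<^sup>2" by (rule mult_left_mono[OF x r0])
  also have "\<dots> = (sqrt r * norm x)\<^sup>2" using r0 by (simp add: power_mult_distrib)
  finally show ?thesis by (rule power2_le_imp_le) (simp add: r0)
qed

text \<open>
The upper bound is the Cauchy-Schwarz inequality. For the lower bound, \<open>M\<close> contains elements
arbitrarily close to \<open>v * (d * d)\<close>; their norm is at most about the square root of
\<open>r = \<sigma> (star v * v)\<close>, and \<open>\<phi>\<close> takes there the value \<open>c * r\<close>.
\<close>

lemma dual_norm_eigen_pair:
  assumes M: "bimodule D M" and \<phi>: "eigen_pair M \<rho> \<sigma> \<phi>" and v: "intertwines v \<rho> \<sigma>"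
    and c: "\<And>x. x \<in> M \<Longrightarrow> \<phi> x = c * state_ext \<sigma> (star v * x)"
  shows "dual_norm M \<phi> = cmod c * sqrt (Re (\<sigma> (star v * v)))"
proof (rule antisym)
  note \<sigma> = eigen_pairD(2)[OF \<phi>]
  obtain r where r: "0 < r" "\<sigma> (star v * v) = of_real r" "state_ext \<sigma> (star v * v) = of_real r"
    using intertwiner_weight[OF \<sigma> v] .
  have Rr: "Re (\<sigma> (star v * v)) = r" by (simp add: r(2))
  define N where "N = dual_norm M \<phi>"
  show "dual_norm M \<phi> \<le> cmod c * sqrt (Re (\<sigma> (star v * v)))"
  proof (rule dual_norm_le[OF bimoduleD(1)[OF M]])
    fix x assume x: "x \<in> M" "norm x \<le> 1"
    have "cmod (\<phi> x) \<le> cmod c * (sqrt r * norm x)"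
      unfolding c[OF x(1)] norm_mult by (rule mult_left_mono[OF state_ext_bound[OF \<sigma> r(3)]]) simp
    also have "\<dots> \<le> cmod c * (sqrt r * 1)" using x r(1) by (intro mult_left_mono) simp_all
    finally show "cmod (\<phi> x) \<le> cmod c * sqrt (Re (\<sigma> (star v * v)))" by (simp add: Rr)
  qed
  obtain m where m: "m \<in> M" "\<phi> m \<noteq> 0" using eigen_pairD(4)[OF \<phi>] by blast
  define s where "s = state_ext \<sigma> (star v * m)"
  have s: "s \<noteq> 0" unfolding s_def by (rule state_ext_nonzero[OF M \<phi> v m])
  have N0: "0 \<le> N" unfolding N_def by (rule less_imp_le[OF dual_norm_pos[OF M \<phi>]])
  have ineq: "cmod c * r \<le> N * (sqrt (r + \<epsilon>) + norm v * \<epsilon> / cmod s)" if \<epsilon>: "0 < \<epsilon>" for \<epsilon>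
  proof -
    obtain d1 where d1: "d1 \<in> peaks \<sigma>" "norm (d1 * (star v * m) * d1 - s *\<^sub>C (d1 * d1)) \<le> \<epsilon>"
      unfolding s_def using compression[OF \<sigma> \<epsilon>] .
    obtain d2 where d2: "d2 \<in> peaks \<sigma>" "(norm (v * d2))\<^sup>2 \<le> cmod (\<sigma> (star v * v)) + \<epsilon>"
      using norm_normalizer_peak[OF \<sigma> intertwinesD(1)[OF v] \<epsilon>] .
    \<comment> \<open>The peak \<open>d1\<close> provides the compression, \<open>d2\<close> controls the norm of \<open>v * d\<close>.\<close>
    define d where "d = d1 * d2"
    have d: "d \<in> peaks \<sigma>" unfolding d_def by (rule peaks_mult[OF \<sigma> d1(1) d2(1)])
    note w = intertwiner_compression[OF M \<phi> v m(1) d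
      compression_mult_peak[OF d1(1) d2(1) d1(2), folded d_def, unfolded s_def], folded s_def]
    have "d * d = d2 * (d1 * d)" unfolding d_def
      by (subst D_commute[OF peaksD(1)[OF d1(1)] peaksD(1)[OF d2(1)]]) (simp only: mult.assoc)
    then have vdd: "v * (d * d) = (v * d2) * (d1 * d)" by (simp only: mult.assoc)
    have "norm (d1 * d) \<le> 1"
      using norm_mult_contraction_left[OF peaksD(3)[OF d1(1)], of d] peaksD(3)[OF d] by linarith
    then have "norm (v * (d * d)) \<le> norm (v * d2)" unfolding vdd by (rule norm_mult_contraction_right)
    also have "\<dots> \<le> sqrt (r + \<epsilon>)"
      using d2(2) r by (intro real_le_rsqrt) simp
    finally have nv: "norm (v * (d * d)) \<le> sqrt (r + \<epsilon>)" .
    have "cmod c * r = cmod (\<phi> (v * d * star v * m * d)) / cmod s"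
      using s r(1) by (simp add: w(2) r(2) c[OF m(1)] norm_mult flip: s_def)
    also have "\<dots> \<le> N * norm (v * d * star v * m * d) / cmod s"
      using eigen_pair_bound[OF M \<phi> w(1)] unfolding N_def by (rule divide_right_mono) simp
    also have "\<dots> \<le> N * (norm v * \<epsilon> + cmod s * sqrt (r + \<epsilon>)) / cmod s"
    proof (intro divide_right_mono mult_left_mono N0)
      have "norm (v * d * star v * m * d) \<le> norm (v * d * star v * m * d - s *\<^sub>C (v * (d * d))) + norm (s *\<^sub>C (v * (d * d)))"
        using norm_triangle_ineq[of "v * d * star v * m * d - s *\<^sub>C (v * (d * d))" "s *\<^sub>C (v * (d * d))"] by simp
      also have "\<dots> \<le> norm v * \<epsilon> + cmod s * sqrt (r + \<epsilon>)"
        unfolding norm_scaleC by (intro add_mono mult_left_mono w(3) nv) simp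
      finally show "norm (v * d * star v * m * d) \<le> norm v * \<epsilon> + cmod s * sqrt (r + \<epsilon>)" .
    qed simp
    also have "\<dots> = N * (sqrt (r + \<epsilon>) + norm v * \<epsilon> / cmod s)" using s by (simp add: field_simps)
    finally show ?thesis .
  qed
  \<comment> \<open>The limit \<open>\<epsilon> \<rightarrow> 0\<close> gives \<open>\<bar>c\<bar> r \<le> N sqrt r\<close>.\<close>
  have "((\<lambda>\<epsilon>. N * (sqrt (r + \<epsilon>) + norm v * \<epsilon> / cmod s)) \<longlongrightarrow> N * (sqrt (r + 0) + norm v * 0 / cmod s)) (at_right 0)"
    using s by (intro tendsto_intros) simp_all
  moreover have "eventually (\<lambda>\<epsilon>. cmod c * r \<le> N * (sqrt (r + \<epsilon>) + norm v * \<epsilon> / cmod s)) (at_right 0)"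
    using ineq by (auto simp: eventually_at_right_field intro!: exI[of _ 1])
  ultimately have "cmod c * r \<le> N * (sqrt (r + 0) + norm v * 0 / cmod s)"
    by (rule tendsto_lowerbound) simp
  then have le: "cmod c * r \<le> N * sqrt r" by simp
  have eq: "(cmod c * sqrt r) * sqrt r = cmod c * r" using r(1) by (simp add: mult.assoc)
  have "(cmod c * sqrt r) * sqrt r \<le> N * sqrt r" unfolding eq by (rule le)
  then have "cmod c * sqrt r \<le> N" by (rule mult_right_le_imp_le) (simp add: r(1))
  then show "cmod c * sqrt (Re (\<sigma> (star v * v))) \<le> dual_norm M \<phi>"
    by (simp only: Rr N_def)
qed

lemma state_ext_mult_left:
  assumes \<sigma>: "character \<sigma>" and d: "d \<in> D"
  shows "state_ext \<sigma> (d * x) = \<sigma> d * state_ext \<sigma> x"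
proof -
  note st = normalized_functional_star[OF cstar_subalgebra_UNIV UNIV_I normalized_state_ext[OF \<sigma>] UNIV_I]
  have "state_ext \<sigma> (star (star x * star d)) = cnj (state_ext \<sigma> (star x) * \<sigma> (star d))"
    unfolding st state_ext_mult_right[OF \<sigma> D_closed(8)[OF d]] ..
  then show ?thesis
    by (simp add: star_mult star_star st character_star[OF \<sigma> d])
qed

text \<open>
Inserting \<open>star v * v\<close> on the left moves \<open>d\<close> past \<open>v\<close>, where it becomes \<open>star v * d * v\<close>. Its value
under \<open>\<sigma>\<close> is found by applying the intertwining relation to it.
\<close>

lemma intertwiner_left_eigen:
  assumes \<rho>: "character \<rho>" and \<sigma>: "character \<sigma>" and v: "intertwines v \<rho> \<sigma>" and d: "d \<in> D"
  shows "state_ext \<sigma> (star v * (d * x)) = \<rho> d * state_ext \<sigma> (star v * x)"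
proof -
  note nv = normalizersD[OF intertwinesD(1)[OF v]]
  define n where "n = \<sigma> (star v * v)"
  have n: "n \<noteq> 0" using intertwinesD(2)[OF v] by (simp add: n_def)
  have \<rho>1: "\<rho> (v * star v) = n"
    using intertwinesD(3)[OF v one_in_D] characterD(4)[OF \<sigma>] by (simp add: n_def)
  have "\<rho> (v * (star v * d * v) * star v) = \<sigma> (star v * d * v) * n"
    unfolding n_def by (rule intertwinesD(3)[OF v nv(2)[OF d]])
  also have "v * (star v * d * v) * star v = (v * star v) * d * (v * star v)" by (simp only: mult.assoc)
  also have "\<rho> \<dots> = n * \<rho> d * n"
    using nv(4) d by (simp add: character_mult[OF \<rho>] \<rho>1)
  finally have \<sigma>d: "\<sigma> (star v * d * v) = n * \<rho> d" using n by simp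
  have "n * state_ext \<sigma> (star v * (d * x)) = state_ext \<sigma> ((star v * v) * (star v * (d * x)))"
    unfolding n_def by (rule state_ext_mult_left[OF \<sigma> nv(3), symmetric])
  also have "(star v * v) * (star v * (d * x)) = star v * ((v * star v) * d) * x" by (simp only: mult.assoc)
  also have "(v * star v) * d = d * (v * star v)" by (rule D_commute[OF nv(4) d])
  also have "star v * (d * (v * star v)) * x = (star v * d * v) * (star v * x)" by (simp only: mult.assoc)
  also have "state_ext \<sigma> \<dots> = n * \<rho> d * state_ext \<sigma> (star v * x)"
    by (simp only: state_ext_mult_left[OF \<sigma> nv(2)[OF d]] \<sigma>d)
  finally show ?thesis using n by simp
qed

lemma eigen_pair_of_intertwiner:
  assumes M: "bimodule D M" and \<rho>: "character \<rho>" and \<sigma>: "character \<sigma>" and v: "intertwines v \<rho> \<sigma>"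
    and nz: "c \<noteq> 0" "m \<in> M" "state_ext \<sigma> (star v * m) \<noteq> 0"
  shows "eigen_pair M \<rho> \<sigma> (\<lambda>x\<in>M. c * state_ext \<sigma> (star v * x))"
    (is "eigen_pair M \<rho> \<sigma> ?\<psi>")
proof -
  have sub: "csubspace M" by (rule bimoduleD(1)[OF M])
  have "?\<psi> \<in> dual_space M"
    unfolding dual_space_def
  proof (intro CollectI conjI ballI allI exI)
    show "?\<psi> (x + y) = ?\<psi> x + ?\<psi> y" if "x \<in> M" "y \<in> M" for x y
      using that complex_vector.subspace_add[OF sub that]
      by (simp add: distrib_left state_extD(1)[OF \<sigma>])
    show "?\<psi> (a *\<^sub>C x) = a * ?\<psi> x" if "x \<in> M" for a x
      using that complex_vector.subspace_scale[OF sub that]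
      by (simp add: mult_scaleC_right state_extD(2)[OF \<sigma>])
    show "cmod (?\<psi> x) \<le> (cmod c * norm v) * norm x" if "x \<in> M" for x
    proof -
      have "cmod (state_ext \<sigma> (star v * x)) \<le> norm (star v * x)" by (rule state_extD(3)[OF \<sigma>])
      also have "\<dots> \<le> norm v * norm x" using norm_mult_ineq[of "star v" x] by (simp only: norm_star)
      finally show ?thesis using that by (simp add: norm_mult mult.assoc mult_left_mono)
    qed
  qed simp
  moreover have "?\<psi> m \<noteq> 0" using nz by simp
  moreover have "?\<psi> (d * x) = \<rho> d * ?\<psi> x" if "d \<in> D" "x \<in> M" for d x
    using that bimoduleD(2)[OF M that] by (simp add: intertwiner_left_eigen[OF \<rho> \<sigma> v])
  moreover have "?\<psi> (x * d) = \<sigma> d * ?\<psi> x" if "d \<in> D" "x \<in> M" for d x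
  proof -
    have "state_ext \<sigma> (star v * (x * d)) = state_ext \<sigma> (star v * x) * \<sigma> d"
      using state_ext_mult_right[OF \<sigma> that(1), of "star v * x"] by (simp only: mult.assoc)
    then show ?thesis using that bimoduleD(3)[OF M that] by simp
  qed
  ultimately show ?thesis using \<rho> \<sigma> nz(2) unfolding eigen_pair_def by blast
qed

section \<open>Extension of eigenfunctionals\<close>

lemma eigen_pair_restrict:
  assumes M: "bimodule D M1" "bimodule D M2" "M1 \<subseteq> M2" and \<psi>: "eigen_pair M2 \<rho> \<sigma> \<psi>"
    and m: "m \<in> M1" "\<psi> m \<noteq> 0"
  shows "eigen_pair M1 \<rho> \<sigma> (restrict \<psi> M1)"
proof -
  note lin = dual_spaceD[OF eigen_pairD(3)[OF \<psi>] bimoduleD(1)[OF M(2)]]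
  have sub: "csubspace M1" by (rule bimoduleD(1)[OF M(1)])
  have in2: "x \<in> M2" if "x \<in> M1" for x using that M(3) by blast
  have "restrict \<psi> M1 \<in> dual_space M1"
    unfolding dual_space_def
  proof (intro CollectI conjI ballI allI exI)
    show "restrict \<psi> M1 (x + y) = restrict \<psi> M1 x + restrict \<psi> M1 y" if "x \<in> M1" "y \<in> M1" for x y
      using that complex_vector.subspace_add[OF sub that] lin(1)[OF in2 in2] by simp
    show "restrict \<psi> M1 (a *\<^sub>C x) = a * restrict \<psi> M1 x" if "x \<in> M1" for a x
      using that complex_vector.subspace_scale[OF sub that] lin(2)[OF in2] by simp
    show "cmod (restrict \<psi> M1 x) \<le> dual_norm M2 \<psi> * norm x" if "x \<in> M1" for x
      using that eigen_pair_bound[OF M(2) \<psi> in2[OF that]] by simp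
  qed simp
  moreover have "restrict \<psi> M1 (d * x) = \<rho> d * restrict \<psi> M1 x"
    "restrict \<psi> M1 (x * d) = \<sigma> d * restrict \<psi> M1 x" if "d \<in> D" "x \<in> M1" for d x
    using that bimoduleD(2,3)[OF M(1) that] eigen_pairD(5,6)[OF \<psi> that(1) in2[OF that(2)]] by simp_all
  moreover have "restrict \<psi> M1 m \<noteq> 0" using m by simp
  ultimately show ?thesis using eigen_pairD(1,2)[OF \<psi>] m(1) unfolding eigen_pair_def by blast
qed

lemma eigen_pair_extension:
  assumes M: "bimodule D M1" "bimodule D M2" "M1 \<subseteq> M2" and \<phi>: "eigen_pair M1 \<rho> \<sigma> \<phi>"
  obtains \<psi> where "eigen_pair M2 \<rho> \<sigma> \<psi>" "restrict \<psi> M1 = \<phi>" "dual_norm M2 \<psi> = dual_norm M1 \<phi>"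
proof -
  note \<rho> = eigen_pairD(1)[OF \<phi>] and \<sigma> = eigen_pairD(2)[OF \<phi>]
  obtain v where v: "intertwines v \<rho> \<sigma>" using intertwiner_exists[OF M(1) \<phi>] .
  obtain c where c: "c \<noteq> 0" "\<And>x. x \<in> M1 \<Longrightarrow> \<phi> x = c * state_ext \<sigma> (star v * x)"
    using eigen_pair_form[OF M(1) \<phi> v] by blast
  obtain m where m: "m \<in> M1" "\<phi> m \<noteq> 0" using eigen_pairD(4)[OF \<phi>] by blast
  have s: "state_ext \<sigma> (star v * m) \<noteq> 0" by (rule state_ext_nonzero[OF M(1) \<phi> v m])
  have m2: "m \<in> M2" using m(1) M(3) by blast
  define \<psi> where "\<psi> = (\<lambda>x\<in>M2. c * state_ext \<sigma> (star v * x))"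
  have \<psi>: "eigen_pair M2 \<rho> \<sigma> \<psi>"
    unfolding \<psi>_def by (rule eigen_pair_of_intertwiner[OF M(2) \<rho> \<sigma> v c(1) m2 s])
  show thesis
  proof (rule that[OF \<psi>])
    show "restrict \<psi> M1 = \<phi>"
    proof (rule extensionalityI)
      show "restrict \<psi> M1 \<in> extensional M1" by simp
      show "\<phi> \<in> extensional M1" using eigen_pairD(3)[OF \<phi>] by (simp add: dual_space_def)
      show "restrict \<psi> M1 x = \<phi> x" if "x \<in> M1" for x
        using that subsetD[OF M(3) that] by (simp add: \<psi>_def c(2))
    qed
    have "dual_norm M2 \<psi> = cmod c * sqrt (Re (\<sigma> (star v * v)))"
      by (rule dual_norm_eigen_pair[OF M(2) \<psi> v]) (simp add: \<psi>_def)
    then show "dual_norm M2 \<psi> = dual_norm M1 \<phi>"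
      using dual_norm_eigen_pair[OF M(1) \<phi> v c(2)] by simp
  qed
qed

text \<open>
A single element \<open>m\<close> of \<open>M1\<close> with \<open>\<psi> m \<noteq> 0\<close> recovers the range and the source from the values at
\<open>d * m\<close> and \<open>m * d\<close>, and after that the constant of proportionality.
\<close>

lemma eigenfunctional_determined:
  assumes M: "bimodule D M2" and \<psi>: "\<psi> \<in> eigenfunctionals D M2" and \<psi>': "\<psi>' \<in> eigenfunctionals D M2"
    and M1: "bimodule D M1" "M1 \<subseteq> M2" and eq: "\<And>x. x \<in> M1 \<Longrightarrow> \<psi> x = \<psi>' x" and m: "m \<in> M1" "\<psi> m \<noteq> 0"
  shows "\<psi> = \<psi>'"
proof -
  obtain \<rho> \<sigma> where p: "eigen_pair M2 \<rho> \<sigma> \<psi>" using eigen_pair_exists[OF M \<psi>] .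
  obtain \<rho>' \<sigma>' where p': "eigen_pair M2 \<rho>' \<sigma>' \<psi>'" using eigen_pair_exists[OF M \<psi>'] .
  have m2: "m \<in> M2" using m(1) M1(2) by blast
  have m': "\<psi>' m \<noteq> 0" using eq[OF m(1)] m(2) by simp
  have "\<rho> d = \<rho>' d \<and> \<sigma> d = \<sigma>' d" if d: "d \<in> D" for d
  proof -
    have "\<rho> d * \<psi> m = \<rho>' d * \<psi> m" "\<sigma> d * \<psi> m = \<sigma>' d * \<psi> m"
      using eigen_pairD(5,6)[OF p d m2] eigen_pairD(5,6)[OF p' d m2] eq[OF m(1)]
        eq[OF bimoduleD(2)[OF M1(1) d m(1)]] eq[OF bimoduleD(3)[OF M1(1) d m(1)]] by auto
    then show ?thesis using m(2) by simp
  qed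
  then have "\<rho> = \<rho>'" "\<sigma> = \<sigma>'"
    using eigen_pairD(1,2)[OF p] eigen_pairD(1,2)[OF p'] unfolding character_def
    by (auto intro!: extensionalityI[of _ D])
  then have p': "eigen_pair M2 \<rho> \<sigma> \<psi>'" using p' by simp
  obtain v where v: "intertwines v \<rho> \<sigma>" using intertwiner_exists[OF M p] .
  have s: "state_ext \<sigma> (star v * m) \<noteq> 0" by (rule state_ext_nonzero[OF M p v m2 m(2)])
  show ?thesis
  proof (rule extensionalityI)
    show "\<psi> \<in> extensional M2" "\<psi>' \<in> extensional M2"
      using eigen_pairD(3)[OF p] eigen_pairD(3)[OF p'] by (simp_all add: dual_space_def)
    fix x assume x: "x \<in> M2"
    have "state_ext \<sigma> (star v * m) * \<psi> x = state_ext \<sigma> (star v * m) * \<psi>' x"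
      using eigen_pair_proportional[OF M p v x m2] eigen_pair_proportional[OF M p' v x m2] eq[OF m(1)] by simp
    then show "\<psi> x = \<psi>' x" using s by simp
  qed
qed

section \<open>Convergence of extended eigenfunctionals\<close>

lemma tendsto_source_range:
  fixes \<psi> :: "'i \<Rightarrow> 'a \<Rightarrow> complex"
  assumes M: "bimodule D M2" and M1: "bimodule D M1" "M1 \<subseteq> M2"
    and p: "\<forall>\<^sub>F i in F. eigen_pair M2 (R i) (S i) (\<psi> i)" and p0: "eigen_pair M2 \<rho> \<sigma> \<psi>0"
    and m: "m \<in> M1" "\<psi>0 m \<noteq> 0" and conv: "\<And>x. x \<in> M1 \<Longrightarrow> ((\<lambda>i. \<psi> i x) \<longlongrightarrow> \<psi>0 x) F" and d: "d \<in> D"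
  shows "((\<lambda>i. S i d) \<longlongrightarrow> \<sigma> d) F" "((\<lambda>i. R i d) \<longlongrightarrow> \<rho> d) F"
proof -
  have m2: "m \<in> M2" using m(1) M1(2) by blast
  have nz: "\<forall>\<^sub>F i in F. \<psi> i m \<noteq> 0"
    by (rule tendsto_imp_eventually_ne[OF conv[OF m(1)] m(2)])
  have "((\<lambda>i. \<psi> i (m * d) / \<psi> i m) \<longlongrightarrow> \<psi>0 (m * d) / \<psi>0 m) F"
    using conv[OF bimoduleD(3)[OF M1(1) d m(1)]] conv[OF m(1)] m(2) by (rule tendsto_divide)
  moreover have "\<psi>0 (m * d) / \<psi>0 m = \<sigma> d" using eigen_pairD(6)[OF p0 d m2] m(2) by simp
  moreover have "\<forall>\<^sub>F i in F. \<psi> i (m * d) / \<psi> i m = S i d"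
    using p nz by eventually_elim (simp add: eigen_pairD(6)[OF _ d m2])
  ultimately show "((\<lambda>i. S i d) \<longlongrightarrow> \<sigma> d) F" by (simp add: Lim_transform_eventually)
  have "((\<lambda>i. \<psi> i (d * m) / \<psi> i m) \<longlongrightarrow> \<psi>0 (d * m) / \<psi>0 m) F"
    using conv[OF bimoduleD(2)[OF M1(1) d m(1)]] conv[OF m(1)] m(2) by (rule tendsto_divide)
  moreover have "\<psi>0 (d * m) / \<psi>0 m = \<rho> d" using eigen_pairD(5)[OF p0 d m2] m(2) by simp
  moreover have "\<forall>\<^sub>F i in F. \<psi> i (d * m) / \<psi> i m = R i d"
    using p nz by eventually_elim (simp add: eigen_pairD(5)[OF _ d m2])
  ultimately show "((\<lambda>i. R i d) \<longlongrightarrow> \<rho> d) F" by (simp add: Lim_transform_eventually)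
qed

lemma eigen_pair_normalizer_bound:
  assumes M: "bimodule D M" and \<phi>: "eigen_pair M \<rho> \<sigma> \<phi>" and K: "dual_norm M \<phi> \<le> K"
    and v: "v \<in> normalizers D M"
  shows "(cmod (\<phi> v))\<^sup>2 \<le> K\<^sup>2 * cmod (\<sigma> (star v * v))"
proof -
  note \<sigma> = eigen_pairD(2)[OF \<phi>]
  have vM: "v \<in> M" and vU: "v \<in> normalizers D UNIV" using v by (simp_all add: normalizers_def)
  have "(cmod (\<phi> v))\<^sup>2 - K\<^sup>2 * cmod (\<sigma> (star v * v)) \<le> K\<^sup>2 * \<epsilon>" if \<epsilon>: "0 < \<epsilon>" for \<epsilon>
  proof -
    obtain d where d: "d \<in> peaks \<sigma>" "(norm (v * d))\<^sup>2 \<le> cmod (\<sigma> (star v * v)) + \<epsilon>"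
      using norm_normalizer_peak[OF \<sigma> vU \<epsilon>] .
    have "\<phi> (v * d) = \<phi> v" by (simp add: eigen_pairD(6)[OF \<phi> peaksD(1)[OF d(1)] vM] peaksD(4)[OF d(1)])
    then have "cmod (\<phi> v) \<le> dual_norm M \<phi> * norm (v * d)"
      using eigen_pair_bound[OF M \<phi> bimoduleD(3)[OF M peaksD(1)[OF d(1)] vM]] by (simp only:)
    also have "\<dots> \<le> K * norm (v * d)" using K by (rule mult_right_mono) simp
    finally have "(cmod (\<phi> v))\<^sup>2 \<le> (K * norm (v * d))\<^sup>2" by (rule power_mono) simp
    also have "\<dots> = K\<^sup>2 * (norm (v * d))\<^sup>2" by (rule power_mult_distrib)
    also have "\<dots> \<le> K\<^sup>2 * (cmod (\<sigma> (star v * v)) + \<epsilon>)" using d(2) by (rule mult_left_mono) simp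
    finally show ?thesis by (simp add: distrib_left)
  qed
  then have "(cmod (\<phi> v))\<^sup>2 - K\<^sup>2 * cmod (\<sigma> (star v * v)) \<le> 0" by (rule le_of_le_mult_small)
  then show ?thesis by simp
qed

text \<open>
In this case \<open>v\<close> does not intertwine the limiting characters. Either its weight \<open>\<sigma> (star v * v)\<close>
vanishes, and \<open>eigen_pair_normalizer_bound\<close> makes the values small, or the intertwining relation fails
at some \<open>a\<close>. The second failure is an open condition on the characters, under which an
eigenfunctional vanishes at \<open>v\<close>.
\<close>

lemma tendsto_at_normalizer_zero:
  fixes \<psi> :: "'i \<Rightarrow> 'a \<Rightarrow> complex"
  assumes M: "bimodule D M2" and M1: "bimodule D M1" "M1 \<subseteq> M2"
    and p: "\<forall>\<^sub>F i in F. eigen_pair M2 (R i) (S i) (\<psi> i)" and p0: "eigen_pair M2 \<rho> \<sigma> \<psi>0"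
    and K: "\<forall>\<^sub>F i in F. dual_norm M2 (\<psi> i) \<le> K"
    and m: "m \<in> M1" "\<psi>0 m \<noteq> 0" and conv: "\<And>x. x \<in> M1 \<Longrightarrow> ((\<lambda>i. \<psi> i x) \<longlongrightarrow> \<psi>0 x) F"
    and v: "v \<in> normalizers D M2" "\<psi>0 v = 0"
  shows "((\<lambda>i. \<psi> i v) \<longlongrightarrow> 0) F"
proof -
  note \<sigma> = eigen_pairD(2)[OF p0]
  note tend = tendsto_source_range[OF M M1 p p0 m conv]
  have vU: "v \<in> normalizers D UNIV" and vM: "v \<in> M2" using v by (simp_all add: normalizers_def)
  note nv = normalizersD[OF vU]
  have "\<not> intertwines v \<rho> \<sigma>"
  proof
    assume i: "intertwines v \<rho> \<sigma>"
    obtain r where r: "0 < r" "\<sigma> (star v * v) = of_real r" "state_ext \<sigma> (star v * v) = of_real r"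
      using intertwiner_weight[OF \<sigma> i] .
    obtain c where c: "c \<noteq> 0" "\<And>x. x \<in> M2 \<Longrightarrow> \<psi>0 x = c * state_ext \<sigma> (star v * x)"
      using eigen_pair_form[OF M p0 i] by blast
    show False using c(1) c(2)[OF vM] v(2) r(1,3) by simp
  qed
  then consider "\<sigma> (star v * v) = 0" | a where "a \<in> D" "\<rho> (v * a * star v) \<noteq> \<sigma> a * \<sigma> (star v * v)"
    using vU unfolding intertwines_def by blast
  then show ?thesis
  proof cases
    case 1
    have "((\<lambda>i. K\<^sup>2 * cmod (S i (star v * v))) \<longlongrightarrow> K\<^sup>2 * cmod (\<sigma> (star v * v))) F"
      by (intro tendsto_intros tend(1)[OF _ nv(3)])
    then have "((\<lambda>i. K\<^sup>2 * cmod (S i (star v * v))) \<longlongrightarrow> 0) F" using 1 by simp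
    moreover have "\<forall>\<^sub>F i in F. norm ((cmod (\<psi> i v))\<^sup>2) \<le> K\<^sup>2 * cmod (S i (star v * v))"
      using p K by eventually_elim (simp add: eigen_pair_normalizer_bound[OF M _ _ v(1)])
    ultimately have "((\<lambda>i. (cmod (\<psi> i v))\<^sup>2) \<longlongrightarrow> 0) F" by (rule Lim_null_comparison[rotated])
    then have "((\<lambda>i. sqrt ((cmod (\<psi> i v))\<^sup>2)) \<longlongrightarrow> sqrt 0) F" by (rule tendsto_real_sqrt)
    then show ?thesis by (simp add: tendsto_norm_zero_iff)
  next
    case 2
    have "((\<lambda>i. R i (v * a * star v) - S i a * S i (star v * v)) \<longlongrightarrow>
        \<rho> (v * a * star v) - \<sigma> a * \<sigma> (star v * v)) F"
      by (intro tendsto_intros tend(2)[OF _ nv(1)[OF 2(1)]] tend(1)[OF _ 2(1)] tend(1)[OF _ nv(3)])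
    moreover have "\<rho> (v * a * star v) - \<sigma> a * \<sigma> (star v * v) \<noteq> 0"
      using 2(2) by (simp only: right_minus_eq not_False_eq_True)
    ultimately have "\<forall>\<^sub>F i in F. R i (v * a * star v) - S i a * S i (star v * v) \<noteq> 0"
      by (rule tendsto_imp_eventually_ne)
    then have "\<forall>\<^sub>F i in F. \<psi> i v = 0" using p
    proof eventually_elim
      case (elim i)
      show ?case
      proof (rule ccontr)
        assume "\<psi> i v \<noteq> 0"
        then have "intertwines v (R i) (S i)"
          by (rule normalizer_intertwines_of_nonzero[OF M elim(2) v(1)])
        then show False using intertwinesD(3)[OF _ 2(1)] elim(1) by simp
      qed
    qed
    then show ?thesis by (rule tendsto_eventually)
  qed
qed

text \<open>
Now \<open>v\<close> intertwines the limiting characters. The element \<open>w = v * d * star v * m * d\<close> lies in \<open>M1\<close>,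
where convergence is known, and is close to \<open>s * v * (d * d)\<close>. Every functional involved maps the
latter to \<open>s\<close> times its value at \<open>v\<close>, up to the square of its source character at \<open>d\<close>, which tends
to 1.
\<close>

lemma tendsto_at_normalizer_nonzero:
  fixes \<psi> :: "'i \<Rightarrow> 'a \<Rightarrow> complex"
  assumes M: "bimodule D M2" and M1: "bimodule D M1" "M1 \<subseteq> M2"
    and p: "\<forall>\<^sub>F i in F. eigen_pair M2 (R i) (S i) (\<psi> i)" and p0: "eigen_pair M2 \<rho> \<sigma> \<psi>0"
    and K: "\<forall>\<^sub>F i in F. dual_norm M2 (\<psi> i) \<le> K" "dual_norm M2 \<psi>0 \<le> K"
    and m: "m \<in> M1" "\<psi>0 m \<noteq> 0" and conv: "\<And>x. x \<in> M1 \<Longrightarrow> ((\<lambda>i. \<psi> i x) \<longlongrightarrow> \<psi>0 x) F"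
    and v: "v \<in> normalizers D M2" "\<psi>0 v \<noteq> 0"
  shows "((\<lambda>i. \<psi> i v) \<longlongrightarrow> \<psi>0 v) F"
proof -
  note \<sigma> = eigen_pairD(2)[OF p0]
  note tend = tendsto_source_range[OF M M1 p p0 m conv]
  have vU: "v \<in> normalizers D UNIV" and vM: "v \<in> M2" using v by (simp_all add: normalizers_def)
  have m2: "m \<in> M2" using m(1) M1(2) by blast
  have int: "intertwines v \<rho> \<sigma>" by (rule normalizer_intertwines_of_nonzero[OF M p0 v])
  define s where "s = state_ext \<sigma> (star v * m)"
  have s: "s \<noteq> 0" unfolding s_def by (rule state_ext_nonzero[OF M p0 int m2 m(2)])
  have bound: "cmod (\<phi> w - s * (\<tau> d * \<tau> d * \<phi> v)) \<le> K * e"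
    if \<phi>: "eigen_pair M2 \<theta> \<tau> \<phi>" and K\<phi>: "dual_norm M2 \<phi> \<le> K" and d: "d \<in> D"
      and w: "w \<in> M2" "norm (w - s *\<^sub>C (v * (d * d))) \<le> e" for \<phi> \<theta> \<tau> d w e
  proof -
    note lin = dual_spaceD[OF eigen_pairD(3)[OF \<phi>] bimoduleD(1)[OF M]]
    have vd: "v * (d * d) \<in> M2" "s *\<^sub>C (v * (d * d)) \<in> M2"
      using bimoduleD(3)[OF M _ vM, of "d * d"] d
        complex_vector.subspace_scale[OF bimoduleD(1)[OF M]] by simp_all
    have K0: "0 \<le> K" using dual_norm_pos[OF M \<phi>] K\<phi> by linarith
    have "\<phi> (v * (d * d)) = \<tau> d * \<tau> d * \<phi> v"
      using eigen_pairD(6)[OF \<phi> _ vM, of "d * d"] d character_mult[OF eigen_pairD(2)[OF \<phi>] d d] by simp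
    then have "\<phi> (w - s *\<^sub>C (v * (d * d))) = \<phi> w - s * (\<tau> d * \<tau> d * \<phi> v)"
      by (simp only: lin(3)[OF w(1) vd(2)] lin(2)[OF vd(1)])
    then have "cmod (\<phi> w - s * (\<tau> d * \<tau> d * \<phi> v)) \<le> dual_norm M2 \<phi> * norm (w - s *\<^sub>C (v * (d * d)))"
      using eigen_pair_bound[OF M \<phi> complex_vector.subspace_diff[OF bimoduleD(1)[OF M] w(1) vd(2)]]
      by (simp only:)
    also have "\<dots> \<le> K * e" using K\<phi> w(2) K0 by (intro mult_mono) simp_all
    finally show ?thesis .
  qed
  show ?thesis
  proof (rule tendstoI)
    fix \<eta> :: real assume \<eta>: "0 < \<eta>"
    \<comment> \<open>Below, \<open>s (\<psi> i v - \<psi>0 v)\<close> is a sum of four terms, each bounded by \<open>\<kappa>\<close>.\<close>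
    define \<kappa> where "\<kappa> = cmod s * \<eta> / 4"
    have \<kappa>: "0 < \<kappa>" using s \<eta> by (simp add: \<kappa>_def)
    \<comment> \<open>A positive bound for \<open>\<psi> i v\<close>, also if \<open>v\<close> or \<open>K\<close> is zero.\<close>
    define L where "L = \<bar>K\<bar> * norm v + 1"
    have L: "0 < L" by (simp add: L_def add_nonneg_pos)
    define \<epsilon> where "\<epsilon> = \<kappa> / L"
    have \<epsilon>: "0 < \<epsilon>" using \<kappa> L by (simp add: \<epsilon>_def)
    obtain d where d: "d \<in> peaks \<sigma>" "norm (d * (star v * m) * d - s *\<^sub>C (d * d)) \<le> \<epsilon>"
      unfolding s_def using compression[OF \<sigma> \<epsilon>] .
    note d' = peaksD[OF d(1)]
    define w where "w = v * d * star v * m * d"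
    have w: "norm (w - s *\<^sub>C (v * (d * d))) \<le> norm v * \<epsilon>"
      using intertwiner_compression(3)[OF M p0 int m2 d(1) d(2)[unfolded s_def]]
      unfolding w_def s_def .
    have w1: "w \<in> M1"
      unfolding w_def
      by (rule bimoduleD(3)[OF M1(1) d'(1) bimoduleD(2)[OF M1(1) normalizersD(1)[OF vU d'(1)] m(1)]])
    then have w2: "w \<in> M2" using M1(2) by blast
    have Ke: "K * (norm v * \<epsilon>) \<le> \<kappa>"
    proof -
      have "K * (norm v * \<epsilon>) \<le> \<bar>K\<bar> * norm v * \<epsilon>" using \<epsilon> by (simp add: mult_right_mono mult.assoc)
      also have "\<dots> \<le> L * \<epsilon>" using \<epsilon> by (intro mult_right_mono) (simp_all add: L_def)
      also have "\<dots> = \<kappa>" using L by (simp add: \<epsilon>_def)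
      finally show ?thesis .
    qed
    have b0: "cmod (\<psi>0 w - s * \<psi>0 v) \<le> \<kappa>"
      using bound[OF p0 K(2) d'(1) w2 w] Ke by (simp add: d'(4))
    have "((\<lambda>i. cmod (S i d * S i d - 1)) \<longlongrightarrow> cmod (\<sigma> d * \<sigma> d - 1)) F"
      by (intro tendsto_intros tend(1)[OF _ d'(1)])
    then have "((\<lambda>i. cmod (S i d * S i d - 1)) \<longlongrightarrow> 0) F" by (simp add: d'(4))
    then have "\<forall>\<^sub>F i in F. cmod (S i d * S i d - 1) < \<kappa> / (cmod s * L)"
      by (rule order_tendstoD) (use \<kappa> s L in simp)
    moreover have "\<forall>\<^sub>F i in F. dist (\<psi> i w) (\<psi>0 w) < \<kappa>"
      using conv[OF w1] \<kappa> by (rule tendstoD)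
    ultimately show "\<forall>\<^sub>F i in F. dist (\<psi> i v) (\<psi>0 v) < \<eta>" using p K(1)
    proof eventually_elim
      case (elim i)
      have "cmod (\<psi> i v) \<le> dual_norm M2 (\<psi> i) * norm v" by (rule eigen_pair_bound[OF M elim(3) vM])
      also have "\<dots> \<le> L"
      proof -
        have "dual_norm M2 (\<psi> i) * norm v \<le> \<bar>K\<bar> * norm v" using elim(4) by (intro mult_right_mono) simp_all
        then show ?thesis by (simp add: L_def)
      qed
      finally have vL: "cmod (\<psi> i v) \<le> L" .
      have t1: "cmod (s * ((S i d * S i d - 1) * \<psi> i v)) \<le> \<kappa>"
      proof -
        have "cmod (S i d * S i d - 1) * cmod (\<psi> i v) \<le> \<kappa> / (cmod s * L) * L"
          using elim(1) vL \<kappa> L by (intro mult_mono) simp_all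
        then have "cmod s * (cmod (S i d * S i d - 1) * cmod (\<psi> i v)) \<le> cmod s * (\<kappa> / (cmod s * L) * L)"
          by (rule mult_left_mono) simp
        then show ?thesis using s L by (simp add: norm_mult)
      qed
      have t2: "cmod (\<psi> i w - s * (S i d * S i d * \<psi> i v)) \<le> \<kappa>"
        using bound[OF elim(3,4) d'(1) w2 w] Ke by linarith
      have t3: "cmod (\<psi> i w - \<psi>0 w) < \<kappa>" using elim(2) by (simp add: dist_norm)
      have eq: "s * (\<psi> i v - \<psi>0 v) = (\<psi> i w - \<psi>0 w) + (\<psi>0 w - s * \<psi>0 v)
          - (\<psi> i w - s * (S i d * S i d * \<psi> i v)) - s * ((S i d * S i d - 1) * \<psi> i v)"
        by (simp add: algebra_simps)
      have "cmod (s * (\<psi> i v - \<psi>0 v)) \<le> cmod (\<psi> i w - \<psi>0 w) + cmod (\<psi>0 w - s * \<psi>0 v)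
          + cmod (\<psi> i w - s * (S i d * S i d * \<psi> i v)) + cmod (s * ((S i d * S i d - 1) * \<psi> i v))"
        unfolding eq by (rule order_trans[OF norm_triangle_ineq4 add_right_mono,
            OF order_trans[OF norm_triangle_ineq4 add_right_mono, OF norm_triangle_ineq]])
      also have "\<dots> < 4 * \<kappa>" using t1 t2 t3 b0 by linarith
      finally have "cmod s * cmod (\<psi> i v - \<psi>0 v) < cmod s * \<eta>" by (simp add: norm_mult \<kappa>_def)
      then show ?case using s by (simp add: dist_norm)
    qed
  qed
qed

text \<open>
The elements of \<open>M2\<close> at which convergence holds form a subspace, which contains all normalizers. The norm
bound extends convergence to the closure of this subspace.
\<close>

lemma tendsto_eigenfunctionals:
  fixes \<psi> :: "'i \<Rightarrow> 'a \<Rightarrow> complex"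
  assumes M: "bimodule D M2" "regular_subspace D M2" and M1: "bimodule D M1" "M1 \<subseteq> M2"
    and p: "\<forall>\<^sub>F i in F. \<psi> i \<in> eigenfunctionals D M2" and p0: "\<psi>0 \<in> eigenfunctionals D M2"
    and K: "\<forall>\<^sub>F i in F. dual_norm M2 (\<psi> i) \<le> K" "dual_norm M2 \<psi>0 \<le> K"
    and m: "m \<in> M1" "\<psi>0 m \<noteq> 0" and conv: "\<And>x. x \<in> M1 \<Longrightarrow> ((\<lambda>i. \<psi> i x) \<longlongrightarrow> \<psi>0 x) F"
    and x: "x \<in> M2"
  shows "((\<lambda>i. \<psi> i x) \<longlongrightarrow> \<psi>0 x) F"
proof -
  have "\<exists>q. \<psi> i \<in> eigenfunctionals D M2 \<longrightarrow> eigen_pair M2 (fst q) (snd q) (\<psi> i)" for i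
  proof (cases "\<psi> i \<in> eigenfunctionals D M2")
    case True
    then obtain \<rho> \<sigma> where "eigen_pair M2 \<rho> \<sigma> (\<psi> i)" using eigen_pair_exists[OF M(1)] by blast
    then show ?thesis by (intro exI[of _ "(\<rho>, \<sigma>)"]) simp
  qed simp
  then have "\<exists>Q. \<forall>i. \<psi> i \<in> eigenfunctionals D M2 \<longrightarrow> eigen_pair M2 (fst (Q i)) (snd (Q i)) (\<psi> i)"
    by (intro choice allI)
  then obtain Q where Q: "\<forall>i. \<psi> i \<in> eigenfunctionals D M2 \<longrightarrow> eigen_pair M2 (fst (Q i)) (snd (Q i)) (\<psi> i)"
    by (rule exE)
  define R S where "R i = fst (Q i)" and "S i = snd (Q i)" for i
  have RS: "eigen_pair M2 (R i) (S i) (\<psi> i)" if "\<psi> i \<in> eigenfunctionals D M2" for i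
    unfolding R_def S_def by (rule mp[OF spec[OF Q] that])
  have p: "\<forall>\<^sub>F i in F. eigen_pair M2 (R i) (S i) (\<psi> i)"
    using p by eventually_elim (rule RS)
  obtain \<rho> \<sigma> where p0: "eigen_pair M2 \<rho> \<sigma> \<psi>0" using eigen_pair_exists[OF M(1) p0] .
  have sub: "csubspace M2" by (rule bimoduleD(1)[OF M(1)])
  have on_normalizers: "((\<lambda>i. \<psi> i v) \<longlongrightarrow> \<psi>0 v) F" if v: "v \<in> normalizers D M2" for v
  proof (cases "\<psi>0 v = 0")
    case True
    then show ?thesis using tendsto_at_normalizer_zero[OF M(1) M1 p p0 K(1) m conv v] by simp
  next
    case False
    show ?thesis
      by (rule tendsto_at_normalizer_nonzero[where \<psi> = \<psi> and R = R and S = S and K = K and m = m,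
          OF M(1) M1 p p0 K m _ v False]) (rule conv)
  qed
  define W where "W = {y \<in> M2. ((\<lambda>i. \<psi> i y) \<longlongrightarrow> \<psi>0 y) F}"
  note lin0 = dual_spaceD[OF eigen_pairD(3)[OF p0] sub]
  note lin = dual_spaceD[OF eigen_pairD(3) sub]
  have "csubspace W"
  proof (rule complex_vector.subspaceI)
    have "\<forall>\<^sub>F i in F. \<psi> i 0 = \<psi>0 0" using p by eventually_elim (simp add: lin0(4) lin(4))
    then show "0 \<in> W" using complex_vector.subspace_0[OF sub] by (simp add: W_def tendsto_eventually)
  next
    fix y z assume "y \<in> W" "z \<in> W"
    then have yz: "y \<in> M2" "z \<in> M2" and t: "((\<lambda>i. \<psi> i y) \<longlongrightarrow> \<psi>0 y) F" "((\<lambda>i. \<psi> i z) \<longlongrightarrow> \<psi>0 z) F"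
      by (simp_all add: W_def)
    have "\<forall>\<^sub>F i in F. \<psi> i y + \<psi> i z = \<psi> i (y + z)" using p by eventually_elim (simp add: lin(1)[OF _ yz])
    then have "((\<lambda>i. \<psi> i (y + z)) \<longlongrightarrow> \<psi>0 y + \<psi>0 z) F"
      by (rule Lim_transform_eventually[OF tendsto_add[OF t]])
    then show "y + z \<in> W" using complex_vector.subspace_add[OF sub yz] by (simp add: W_def lin0(1)[OF yz])
  next
    fix c y assume "y \<in> W"
    then have y: "y \<in> M2" and t: "((\<lambda>i. \<psi> i y) \<longlongrightarrow> \<psi>0 y) F" by (simp_all add: W_def)
    have "\<forall>\<^sub>F i in F. c * \<psi> i y = \<psi> i (c *\<^sub>C y)" using p by eventually_elim (simp add: lin(2)[OF _ y])
    then have "((\<lambda>i. \<psi> i (c *\<^sub>C y)) \<longlongrightarrow> c * \<psi>0 y) F"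
      by (rule Lim_transform_eventually[OF tendsto_mult_left[OF t]])
    then show "c *\<^sub>C y \<in> W" using complex_vector.subspace_scale[OF sub y] by (simp add: W_def lin0(2)[OF y])
  qed
  moreover have "normalizers D M2 \<subseteq> W"
    using on_normalizers by (auto simp: W_def normalizers_def)
  ultimately have span: "cspan (normalizers D M2) \<subseteq> W"
    by (intro complex_vector.span_minimal)
  show ?thesis
  proof (rule tendstoI)
    fix \<eta> :: real assume \<eta>: "0 < \<eta>"
    define \<epsilon> where "\<epsilon> = (\<eta> / 3) / (\<bar>K\<bar> + 1)"
    have \<epsilon>: "0 < \<epsilon>" using \<eta> by (simp add: \<epsilon>_def add_nonneg_pos)
    have "x \<in> closure (cspan (normalizers D M2))" using x M(2) by (simp add: regular_subspace_def)
    then obtain y where "y \<in> cspan (normalizers D M2)" "dist y x < \<epsilon>"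
      using closure_approachable \<epsilon> by blast
    then have y: "y \<in> M2" "((\<lambda>i. \<psi> i y) \<longlongrightarrow> \<psi>0 y) F" "norm (x - y) < \<epsilon>"
      using span by (auto simp: W_def dist_norm norm_minus_commute)
    have near: "cmod (\<phi> x - \<phi> y) \<le> \<eta> / 3"
      if "eigen_pair M2 \<theta> \<tau> \<phi>" "dual_norm M2 \<phi> \<le> K" for \<phi> \<theta> \<tau>
    proof -
      have "cmod (\<phi> (x - y)) \<le> dual_norm M2 \<phi> * norm (x - y)"
        by (rule eigen_pair_bound[OF M(1) that(1) complex_vector.subspace_diff[OF sub x y(1)]])
      also have "\<dots> \<le> (\<bar>K\<bar> + 1) * norm (x - y)" using that(2) by (intro mult_right_mono) simp_all
      also have "\<dots> \<le> (\<bar>K\<bar> + 1) * \<epsilon>" using y(3) by (intro mult_left_mono) simp_all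
      also have "\<dots> = \<eta> / 3"
      proof -
        have "\<bar>K\<bar> + 1 \<noteq> 0" using abs_ge_zero[of K] by linarith
        moreover have "L * (\<eta> / 3 / L) = \<eta> / 3" if "L \<noteq> 0" for L using that by simp
        ultimately show ?thesis unfolding \<epsilon>_def by blast
      qed
      finally show ?thesis using lin(3)[OF that(1) x y(1)] by simp
    qed
    have "\<forall>\<^sub>F i in F. dist (\<psi> i y) (\<psi>0 y) < \<eta> / 3"
      using y(2) by (rule tendstoD) (use \<eta> in simp)
    then show "\<forall>\<^sub>F i in F. dist (\<psi> i x) (\<psi>0 x) < \<eta>" using p K(1)
    proof eventually_elim
      case (elim i)
      have "\<psi> i x - \<psi>0 x = (\<psi> i x - \<psi> i y) + (\<psi> i y - \<psi>0 y) - (\<psi>0 x - \<psi>0 y)" by simp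
      then have "cmod (\<psi> i x - \<psi>0 x) \<le> cmod (\<psi> i x - \<psi> i y) + cmod (\<psi> i y - \<psi>0 y) + cmod (\<psi>0 x - \<psi>0 y)"
        by (metis (no_types) norm_triangle_ineq4 norm_triangle_ineq add_right_mono order_trans)
      also have "\<dots> < \<eta>"
        using near[OF elim(2,3)] near[OF p0 K(2)] elim(1) by (simp add: dist_norm)
      finally show ?case by (simp add: dist_norm)
    qed
  qed
qed

end

section \<open>The space of eigenfunctionals\<close>

lemma topspace_eigenfunctional_topology [simp]:
  "topspace (eigenfunctional_topology D M) = eigenfunctionals D M"
  by (auto simp: eigenfunctional_topology_def weak_star_def eigenfunctionals_def dual_space_def
      PiE_def)

lemma continuous_map_evaluation:
  assumes "x \<in> M"
  shows "continuous_map (eigenfunctional_topology D M) euclidean (\<lambda>\<phi>. \<phi> x)"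
  unfolding eigenfunctional_topology_def weak_star_def
  by (intro continuous_map_from_subtopology continuous_map_product_projection assms)

lemma continuous_map_into_eigenfunctionals:
  assumes "f \<in> topspace X \<rightarrow> eigenfunctionals D M"
    and "\<And>x. x \<in> M \<Longrightarrow> continuous_map X euclidean (\<lambda>\<phi>. f \<phi> x)"
  shows "continuous_map X (eigenfunctional_topology D M) f"
  unfolding eigenfunctional_topology_def weak_star_def
  using assms
  by (auto simp: continuous_map_in_subtopology continuous_map_componentwise eigenfunctionals_def dual_space_def Pi_def)

theorem corollary4p16:
  fixes D M1 M2 :: "'a::cstar_algebra set"
  assumes "regular_cstar_inclusion D"
    and "bimodule D M1" and "closed M1"
    and "bimodule D M2" and "closed M2"
    and "M1 \<subseteq> M2"
  shows "(\<exists>!\<iota>. isometric_extension_map D M1 M2 \<iota>) \<and>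
    (\<forall>\<iota>. isometric_extension_map D M1 M2 \<iota> \<longrightarrow>
      openin (eigenfunctional_topology D M2) (\<iota> ` eigenfunctionals D M1) \<and>
      (regular_subspace D M2 \<longrightarrow>
        (\<forall>B\<subseteq>eigenfunctionals D M1. (\<exists>K. \<forall>\<phi>\<in>B. dual_norm M1 \<phi> \<le> K) \<longrightarrow>
          continuous_map (subtopology (eigenfunctional_topology D M1) B)
            (eigenfunctional_topology D M2) \<iota>)))"
proof -
  interpret regular_inclusion D by standard (rule assms(1))
  let ?E1 = "eigenfunctionals D M1" and ?E2 = "eigenfunctionals D M2"
  note M1 = assms(2) and M2 = assms(4) and sub = assms(6)
  have nonzero: "\<exists>m\<in>M1. \<phi> m \<noteq> 0" if "\<phi> \<in> ?E1" for \<phi>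
    using that by (simp add: eigenfunctionals_def)
  have unique: "\<psi> = \<psi>'" if \<psi>: "\<psi> \<in> ?E2" "\<psi>' \<in> ?E2" and eq: "restrict \<psi> M1 = restrict \<psi>' M1"
    and m: "m \<in> M1" "\<psi> m \<noteq> 0" for \<psi> \<psi>' m
  proof (rule eigenfunctional_determined[OF M2 \<psi> M1 sub _ m])
    show "\<psi> x = \<psi>' x" if "x \<in> M1" for x using fun_cong[OF eq, of x] that by simp
  qed
  have ext: "\<exists>\<psi>\<in>?E2. dual_norm M2 \<psi> = dual_norm M1 \<phi> \<and> restrict \<psi> M1 = \<phi>" if \<phi>: "\<phi> \<in> ?E1" for \<phi>
  proof -
    obtain \<rho> \<sigma> where "eigen_pair M1 \<rho> \<sigma> \<phi>" using eigen_pair_exists[OF M1 \<phi>] .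
    then obtain \<psi> where "eigen_pair M2 \<rho> \<sigma> \<psi>" "restrict \<psi> M1 = \<phi>" "dual_norm M2 \<psi> = dual_norm M1 \<phi>"
      by (rule eigen_pair_extension[OF M1 M2 sub])
    then show ?thesis using eigen_pair_eigenfunctional by blast
  qed
  have map_unique: "\<psi> = \<iota> \<phi>"
    if \<iota>: "isometric_extension_map D M1 M2 \<iota>" and \<phi>: "\<phi> \<in> ?E1" and \<psi>: "\<psi> \<in> ?E2" "restrict \<psi> M1 = \<phi>"
    for \<iota> \<phi> \<psi>
  proof -
    obtain m where m: "m \<in> M1" "\<phi> m \<noteq> 0" using nonzero[OF \<phi>] by blast
    have i: "\<iota> \<phi> \<in> ?E2" "restrict (\<iota> \<phi>) M1 = \<phi>"
      using \<iota> \<phi> by (auto simp: isometric_extension_map_def)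
    have "\<psi> m = \<phi> m" using fun_cong[OF \<psi>(2), of m] m(1) by simp
    then have nz: "\<psi> m \<noteq> 0" using m(2) by simp
    show ?thesis by (rule unique[OF \<psi>(1) i(1) _ m(1) nz]) (simp only: \<psi>(2) i(2))
  qed
  show ?thesis
  proof (intro conjI allI impI)
    have "\<forall>\<phi>\<in>?E1. \<exists>\<psi>. \<psi> \<in> ?E2 \<and> dual_norm M2 \<psi> = dual_norm M1 \<phi> \<and> restrict \<psi> M1 = \<phi>"
      using ext by blast
    from bchoice[OF this] obtain j where
      "\<forall>\<phi>\<in>?E1. j \<phi> \<in> ?E2 \<and> dual_norm M2 (j \<phi>) = dual_norm M1 \<phi> \<and> restrict (j \<phi>) M1 = \<phi>"
      by (rule exE)
    then have j: "j \<phi> \<in> ?E2 \<and> dual_norm M2 (j \<phi>) = dual_norm M1 \<phi> \<and> restrict (j \<phi>) M1 = \<phi>"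
      if "\<phi> \<in> ?E1" for \<phi> using that by (rule bspec)
    have ex: "isometric_extension_map D M1 M2 (restrict j ?E1)"
      using j by (auto simp: isometric_extension_map_def)
    show "\<exists>!\<iota>. isometric_extension_map D M1 M2 \<iota>"
    proof (rule ex1I)
      show "isometric_extension_map D M1 M2 (restrict j ?E1)" by (rule ex)
      fix \<iota> assume \<iota>: "isometric_extension_map D M1 M2 \<iota>"
      then have ie: "\<iota> \<in> extensional ?E1" by (simp add: isometric_extension_map_def PiE_def)
      show "\<iota> = restrict j ?E1"
      proof (rule extensionalityI[OF ie])
        show "restrict j ?E1 \<in> extensional ?E1" by simp
        fix \<phi> assume \<phi>: "\<phi> \<in> ?E1"
        show "\<iota> \<phi> = restrict j ?E1 \<phi>"
          using map_unique[OF \<iota> \<phi>, of "j \<phi>"] j[OF \<phi>] \<phi> by simp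
      qed
    qed
  next
    fix \<iota> assume \<iota>: "isometric_extension_map D M1 M2 \<iota>"
    then have \<iota>D: "\<iota> \<phi> \<in> ?E2" "restrict (\<iota> \<phi>) M1 = \<phi>" "dual_norm M2 (\<iota> \<phi>) = dual_norm M1 \<phi>" if "\<phi> \<in> ?E1" for \<phi>
      using that by (auto simp: isometric_extension_map_def)
    have \<iota>_M1: "\<iota> \<phi> m = \<phi> m" if "\<phi> \<in> ?E1" "m \<in> M1" for \<phi> m
      using fun_cong[OF \<iota>D(2)[OF that(1)], of m] that(2) by simp
    have "\<iota> ` ?E1 = (\<Union>m\<in>M1. {\<psi> \<in> ?E2. \<psi> m \<in> - {0}})"
    proof (intro set_eqI iffI)
      fix \<psi> assume "\<psi> \<in> \<iota> ` ?E1"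
      then obtain \<phi> where \<phi>: "\<phi> \<in> ?E1" "\<psi> = \<iota> \<phi>" by blast
      obtain m where "m \<in> M1" "\<phi> m \<noteq> 0" using nonzero[OF \<phi>(1)] by blast
      then show "\<psi> \<in> (\<Union>m\<in>M1. {\<psi> \<in> ?E2. \<psi> m \<in> - {0}})"
        using \<phi> \<iota>D(1)[OF \<phi>(1)] \<iota>_M1[OF \<phi>(1)] by auto
    next
      fix \<psi> assume "\<psi> \<in> (\<Union>m\<in>M1. {\<psi> \<in> ?E2. \<psi> m \<in> - {0}})"
      then obtain m where \<psi>: "\<psi> \<in> ?E2" and m: "m \<in> M1" "\<psi> m \<noteq> 0" by auto
      obtain \<rho> \<sigma> where p: "eigen_pair M2 \<rho> \<sigma> \<psi>" using eigen_pair_exists[OF M2 \<psi>] .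
      have r: "restrict \<psi> M1 \<in> ?E1"
        by (rule eigen_pair_eigenfunctional[OF eigen_pair_restrict[where \<psi> = \<psi>, OF M1 M2 sub p m]])
      then show "\<psi> \<in> \<iota> ` ?E1" by (rule rev_image_eqI) (rule map_unique[OF \<iota> r \<psi> refl])
    qed
    moreover have "openin (eigenfunctional_topology D M2) {\<psi> \<in> ?E2. \<psi> m \<in> - {0}}" if "m \<in> M1" for m
      using openin_continuous_map_preimage[OF continuous_map_evaluation[of m M2 D], of "- {0}"] that sub
      by (auto simp: open_openin[symmetric])
    ultimately show "openin (eigenfunctional_topology D M2) (\<iota> ` ?E1)" by auto
    fix B assume reg: "regular_subspace D M2" and B: "B \<subseteq> ?E1" and "\<exists>K. \<forall>\<phi>\<in>B. dual_norm M1 \<phi> \<le> K"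
    then obtain K where K: "\<And>\<phi>. \<phi> \<in> B \<Longrightarrow> dual_norm M1 \<phi> \<le> K" by blast
    let ?X = "subtopology (eigenfunctional_topology D M1) B"
    have top: "topspace ?X = B" using B by auto
    show "continuous_map ?X (eigenfunctional_topology D M2) \<iota>"
    proof (rule continuous_map_into_eigenfunctionals)
      show "\<iota> \<in> topspace ?X \<rightarrow> ?E2" using top B \<iota>D(1) by auto
      fix x assume x: "x \<in> M2"
      show "continuous_map ?X euclidean (\<lambda>\<phi>. \<iota> \<phi> x)"
        unfolding continuous_map_atin top limitin_canonical_iff
      proof
        fix \<phi>0 assume \<phi>0: "\<phi>0 \<in> B"
        have inB: "\<forall>\<^sub>F \<phi> in atin ?X \<phi>0. \<phi> \<in> B"
          unfolding eventually_atin
          using \<phi>0 top by (intro disjI2 exI[of _ "topspace ?X"] conjI openin_topspace) auto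
        obtain m where m: "m \<in> M1" "\<phi>0 m \<noteq> 0" using nonzero \<phi>0 B by blast
        show "((\<lambda>\<phi>. \<iota> \<phi> x) \<longlongrightarrow> \<iota> \<phi>0 x) (atin ?X \<phi>0)"
        proof (rule tendsto_eigenfunctionals[OF M2 reg M1 sub _ _ _ _ m(1) _ _ x])
          show "\<forall>\<^sub>F \<phi> in atin ?X \<phi>0. \<iota> \<phi> \<in> ?E2" using inB by eventually_elim (use B \<iota>D(1) in blast)
          show "\<iota> \<phi>0 \<in> ?E2" using \<phi>0 B \<iota>D(1) by blast
          show "\<forall>\<^sub>F \<phi> in atin ?X \<phi>0. dual_norm M2 (\<iota> \<phi>) \<le> K"
            using inB by eventually_elim (use B \<iota>D(3) K in auto)
          show "dual_norm M2 (\<iota> \<phi>0) \<le> K" using \<phi>0 B \<iota>D(3) K by auto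
          show "\<iota> \<phi>0 m \<noteq> 0" using m \<phi>0 B \<iota>_M1 by auto
          fix y assume y: "y \<in> M1"
          have "continuous_map ?X euclidean (\<lambda>\<phi>. \<phi> y)"
            by (intro continuous_map_from_subtopology continuous_map_evaluation y)
          then have "((\<lambda>\<phi>. \<phi> y) \<longlongrightarrow> \<phi>0 y) (atin ?X \<phi>0)"
            unfolding continuous_map_atin top limitin_canonical_iff using \<phi>0 by blast
          moreover have "\<forall>\<^sub>F \<phi> in atin ?X \<phi>0. \<phi> y = \<iota> \<phi> y"
            using inB by eventually_elim (use B \<iota>_M1 y in auto)
          moreover have "\<iota> \<phi>0 y = \<phi>0 y" using \<phi>0 B \<iota>_M1 y by blast
          ultimately show "((\<lambda>\<phi>. \<iota> \<phi> y) \<longlongrightarrow> \<iota> \<phi>0 y) (atin ?X \<phi>0)"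
            by (simp add: Lim_transform_eventually)
        qed
      qed
    qed
  qed
qed

end
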